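(* Let $\gamma\in(0,1)$ and let $k\ge 2$ be an integer. Consider the random process defined in the context (with parameter $k$ on a set of $n$ vertices), and let $\tau_{max}$ be the step at which it terminates. Then with high probability as $n\to\infty$ (that is, with probability tending to $1$ as $n\to\infty$, with $k,\gamma$ fixed), $\tau_{max}\ge (1-\gamma)n^2/6$.
   Context: A $3$-graph is a hypergraph all of whose edges have size $3$; it is identified with its edge set and $|\mathcal{S}|$ denotes the number of edges of $\mathcal{S}$. A forbidden configuration is a $3$-graph $\mathcal{S}$ with $|V(\mathcal{S})|=j$ and $|\mathcal{S}|=j-2$ for some $j\ge 4$. An Erdős-configuration is a forbidden configuration which does not contain any forbidden configuration as a proper subgraph. The process. Let $j_{max}:=k+2$ and let $V$ be a set of $n$ vertices. Set $\mathcal{A}(0):=\binom{V}{3}$ (the set of all $3$-subsets of $V$), $\mathcal{C}(0):=\emptyset$, and $i:=0$. As long as $\mathcal{A}(i)\ne\emptyset$: select $T^\ast(i)\in\mathcal{A}(i)$ uniformly at random; let $\mathcal{A}'(i)$ consist of all $T\in\mathcal{A}(i)$ for which there is $\mathcal{C}'\subseteq\mathcal{C}(i)$ such that $\{T,T^\ast(i)\}\cup\mathcal{C}'$ is an Erdős-configuration on at most $j_{max}$ points; put $\mathcal{A}(i+1):=\mathcal{A}(i)\setminus(\mathcal{A}'(i)\cup\{T^\ast(i)\})$ and $\mathcal{C}(i+1):=\mathcal{C}(i)\cup\{T^\ast(i)\}$; and increase $i$ by $1$. The process terminates at time $\tau_{max}:=\min\{i:\mathcal{A}(i)=\emptyset\}$.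 *)

theory Defs
  imports "HOL-Probability.Probability"
begin

text \<open>A 3-graph is identified with its edge set, so its vertex set is \<^term>\<open>\<Union> S\<close> (there are no
  isolated vertices) and its subgraphs are the subsets of \<^term>\<open>S\<close>.\<close>

definition three_graph :: "'a set set \<Rightarrow> bool" where
  "three_graph S \<longleftrightarrow> (\<forall>e\<in>S. card e = 3)"

text \<open>As \<^term>\<open>card\<close> is 0 on infinite sets, the bound \<^term>\<open>(4::nat) \<le> j\<close> makes the configuration
  finite; it also makes the subtraction on \<^typ>\<open>nat\<close> genuine.\<close>

definition forbidden_configuration :: "'a set set \<Rightarrow> bool" where
  "forbidden_configuration S \<longleftrightarrow>
     three_graph S \<and> (\<exists>j\<ge>4. card (\<Union> S) = j \<and> card S = j - 2)"

definition erdos_configuration :: "'a set set \<Rightarrow> bool" where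
  "erdos_configuration S \<longleftrightarrow>
     forbidden_configuration S \<and> \<not> (\<exists>S'. S' \<subset> S \<and> forbidden_configuration S')"

definition triples :: "'a set \<Rightarrow> 'a set set" where
  "triples V = {T. T \<subseteq> V \<and> card T = 3}"

text \<open>A state of the process is the pair \<open>(A(i), C(i))\<close> of available and chosen triples.\<close>

type_synonym 'a state = "'a set set \<times> 'a set set"

definition excluded :: "nat \<Rightarrow> 'a state \<Rightarrow> 'a set \<Rightarrow> 'a set set" where
  "excluded k s T' = (case s of (A, C) \<Rightarrow>
     {T \<in> A. \<exists>C' \<subseteq> C. erdos_configuration ({T, T'} \<union> C') \<and> card (\<Union> ({T, T'} \<union> C')) \<le> k + 2})"

text \<open>A state without available triples is absorbing.\<close>

definition process_step :: "nat \<Rightarrow> 'a state \<Rightarrow> 'a state pmf" where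
  "process_step k s = (case s of (A, C) \<Rightarrow>
     if A = {} then return_pmf (A, C)
     else map_pmf (\<lambda>T'. (A - (excluded k (A, C) T' \<union> {T'}), C \<union> {T'})) (pmf_of_set A))"

text \<open>The distribution of the list of the states at times \<open>0, \<dots>, m\<close>.\<close>

primrec trajectory :: "nat \<Rightarrow> 'a set \<Rightarrow> nat \<Rightarrow> 'a state list pmf" where
  "trajectory k V 0 = return_pmf [(triples V, {})]"
| "trajectory k V (Suc m) =
     bind_pmf (trajectory k V m) (\<lambda>ss. map_pmf (\<lambda>s. ss @ [s]) (process_step k (last ss)))"

text \<open>Every step before termination removes an available triple, so all runs have terminated by
  time \<^term>\<open>card (triples V)\<close> (see \<open>high_girth_process_terminates\<close>) and nothing is lost by
  truncating there.\<close>

definition high_girth_process :: "nat \<Rightarrow> 'a set \<Rightarrow> 'a state list pmf" where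
  "high_girth_process k V = trajectory k V (card (triples V))"

definition tau_max :: "'a state list \<Rightarrow> nat" where
  "tau_max ss = (LEAST i. i < length ss \<and> fst (ss ! i) = {})"

lemma finite_triples: "finite V \<Longrightarrow> finite (triples V)"
  by (rule finite_subset[of _ "Pow V"]) (auto simp: triples_def)

lemma process_step_available:
  assumes "finite (fst s)" "s' \<in> set_pmf (process_step k s)"
  shows "finite (fst s')" "card (fst s') \<le> card (fst s) - 1"
proof -
  obtain A C where s: "s = (A, C)" by (cases s)
  have A: "finite A" using assms(1) s by simp
  have "finite (fst s') \<and> card (fst s') \<le> card A - 1"
  proof (cases "A = {}")
    case True
    then show ?thesis using assms(2) s by (simp add: process_step_def)
  next
    case False
    then have "s' \<in> (\<lambda>T'. (A - (excluded k (A, C) T' \<union> {T'}), C \<union> {T'})) ` A"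
      using assms(2) A unfolding s process_step_def by (simp only: split set_map_pmf set_pmf_of_set[OF \<open>A \<noteq> {}\<close> A] if_False)
    then obtain T' where T': "T' \<in> A" "s' = (A - (excluded k (A, C) T' \<union> {T'}), C \<union> {T'})"
      by (rule imageE)
    have "card (fst s') \<le> card (A - {T'})"
      using A T'(2) by (intro card_mono) auto
    then show ?thesis using A T' by simp
  qed
  then show "finite (fst s')" "card (fst s') \<le> card (fst s) - 1" using s by auto
qed

lemma trajectory_available:
  assumes "finite V" "ss \<in> set_pmf (trajectory k V m)"
  shows "length ss = Suc m" "finite (fst (last ss))" "card (fst (last ss)) \<le> card (triples V) - m"
proof -
  have "length ss = Suc m \<and> finite (fst (last ss)) \<and> card (fst (last ss)) \<le> card (triples V) - m"
    using assms(2)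
  proof (induction m arbitrary: ss)
    case 0
    then show ?case using assms(1) by (simp add: finite_triples)
  next
    case (Suc m)
    then obtain ts s where ts: "ts \<in> set_pmf (trajectory k V m)" "ss = ts @ [s]"
      "s \<in> set_pmf (process_step k (last ts))" by auto
    note IH = Suc.IH[OF ts(1)]
    show ?case using IH process_step_available[OF _ ts(3)] ts(2) by fastforce
  qed
  then show "length ss = Suc m" "finite (fst (last ss))"
    "card (fst (last ss)) \<le> card (triples V) - m" by auto
qed

lemma high_girth_process_terminates:
  assumes "finite V" "ss \<in> set_pmf (high_girth_process k V)"
  shows "tau_max ss < length ss" "fst (ss ! tau_max ss) = {}"
proof -
  note * = trajectory_available[OF assms(1) assms(2)[unfolded high_girth_process_def]]
  have "fst (last ss) = {}" using *(2,3) by simp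
  then have "length ss - 1 < length ss \<and> fst (ss ! (length ss - 1)) = {}"
    using *(1) by (metis diff_less last_conv_nth length_0_conv nat.simps(3) zero_less_Suc zero_less_one)
  then have "tau_max ss < length ss \<and> fst (ss ! tau_max ss) = {}"
    unfolding tau_max_def by (rule LeastI)
  then show "tau_max ss < length ss" "fst (ss ! tau_max ss) = {}" by auto
qed

end

theory Submission
  imports Defs
begin

text \<open>
The process has the same law of chosen triples as the lazy chain which proposes in every step one of the
\<open>M\<close> triples of \<open>V\<close> uniformly at random and ignores unavailable proposals. For finite sets \<open>X\<close>, \<open>Y\<close> of
triples consider the probability that after \<open>u\<close> lazy steps all of \<open>X\<close> is available and all of \<open>Y\<close> is
chosen. Its one-step change is a linear combination of such probabilities for slightly larger \<open>(X, Y)\<close>: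
a member of \<open>X\<close> dies when a proposal completes a conflict through it. Since a proper subset of \<open>m \<ge> 2\<close>
edges of an Erdos configuration spans at least \<open>m + 3\<close> vertices, all conflicts that meet the
vertices of \<open>(X, Y)\<close> in more than the dying triple contribute only a factor \<open>O(1/n)\<close>, so in the limit the
hierarchy is solved by the product \<open>(p/n)^|Y| (1-p)^|\<partial>X| g(p)^|X|\<close>, where \<open>\<partial>X\<close> is the set of pairs
covered by \<open>X\<close>, \<open>g(p) = exp (- \<Sum>\<^sub>i \<kappa>\<^sub>i p^(i-1) / (i-1)!)\<close> accounts for the conflicts with \<open>i \<ge> 3\<close> edges,
and \<open>p' = (1-p)^3 g(p)\<close> in time units of \<open>M/n\<close> steps. As \<open>p\<close> tends to \<open>1\<close>, the expected number of chosen
triples reaches \<open>(1-\<epsilon>) n^2/6\<close>; as it never exceeds \<open>n^2/6\<close>, Markov's inequality finishes the proof,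
and no concentration estimate is needed.
\<close>

section \<open>Erdos configurations\<close>

text \<open>Laziness makes the equations linear: a proposal has the fixed probability
  1/\<open>M\<close>, whereas a step of the original process divides by the random number of
  available triples. The limit comes from a Poisson heuristic. About
  \<open>kappa i * n^(i-1) / (i-1)!\<close> conflicts with \<open>i\<close> edges pass through a
  given triple, and each needs \<open>i-1\<close> further triples chosen, with probability p/n each.
  The expected number of completed ones is the i-th term of the exponent, and g(p) is the
  probability that there is none. A pair is uncovered with probability 1-p, and the speed (1-p)^3
  g(p) is the probability that a single triple is available. The obstacle is that the hierarchy
  never closes, since the equation for (X, Y) involves larger pairs. The errors of all levels are
  therefore compared at once, starting from the crude bound (u/M)^|Y| for the chosen part, on time
  slabs so short that iterating the comparison gains a geometric factor. The horizon may stay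
  bounded independently of n, because p passes every level below 1 in bounded time.\<close>

lemma erdos_card:
  assumes "erdos_configuration S"
  shows "card (\<Union>S) = card S + 2" "2 \<le> card S" "finite S" "finite (\<Union>S)"
proof -
  have 1: "card (\<Union>S) \<ge> 4" "card S = card (\<Union>S) - 2"
    using assms by (auto simp: erdos_configuration_def forbidden_configuration_def)
  then show "card (\<Union>S) = card S + 2" "2 \<le> card S" by auto
  show "finite S" using 1 by (intro card_ge_0_finite) auto
  show "finite (\<Union>S)" using 1 by (intro card_ge_0_finite) auto
qed

lemma erdos_edge: "erdos_configuration S \<Longrightarrow> T \<in> S \<Longrightarrow> card T = 3"
  by (simp add: erdos_configuration_def forbidden_configuration_def three_graph_def)

lemma card_Un_triples_ge:
  assumes "card T = 3" "card U = 3" "T \<noteq> U"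
  shows "card (T \<union> U) \<ge> 4"
proof (rule ccontr)
  have fin: "finite T" "finite U" using assms by (auto intro: card_ge_0_finite)
  assume "\<not> ?thesis"
  then have "card (T \<union> U) \<le> 3" by simp
  then have "T = T \<union> U" "U = T \<union> U"
    using assms fin by (metis card_seteq finite_Un sup_ge1, metis card_seteq finite_Un sup_ge2)
  then show False using assms by simp
qed

text \<open>Deleting an edge leaves, by induction, \<open>card B - 1\<close> edges on at least
  \<open>card B + 2\<close> vertices, and equality for \<open>B\<close> would make it a forbidden
  configuration inside \<open>S\<close>. This one extra vertex drives every error estimate
  below.\<close>

lemma erdos_span:
  assumes S: "erdos_configuration S" and "B \<subset> S" "2 \<le> card B"
  shows "card B + 3 \<le> card (\<Union>B)"
  using assms(2,3)
proof (induction "card B" arbitrary: B)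
  case 0 then show ?case by simp
next
  case (Suc m)
  have finB: "finite B" using Suc.prems by (intro card_ge_0_finite) auto
  have finU: "finite (\<Union>B)" using erdos_card(4)[OF S] Suc.prems(1) by (rule_tac finite_subset) auto
  have three: "\<And>T. T \<in> B \<Longrightarrow> card T = 3" using erdos_edge[OF S] Suc.prems(1) by blast
  have nf: "\<not> forbidden_configuration B"
    using S Suc.prems(1) by (auto simp: erdos_configuration_def)
  have ge: "card (\<Union>B) \<ge> card B + 2"
  proof (cases "card B = 2")
    case True
    then obtain T U where B: "B = {T, U}" "T \<noteq> U" by (auto simp: card_2_iff)
    show ?thesis using card_Un_triples_ge[of T U] three B True by simp
  next
    case False
    then have "B \<noteq> {}" using Suc.prems by auto
    then obtain T where T: "T \<in> B" by auto
    have c: "card (B - {T}) = card B - 1" using T finB by simp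
    have "card (B - {T}) + 3 \<le> card (\<Union>(B - {T}))"
      using Suc.prems False Suc.hyps(2) T c by (intro Suc.hyps(1)) auto
    also have "\<dots> \<le> card (\<Union>B)" using finU by (intro card_mono) auto
    finally show ?thesis using c Suc.prems by simp
  qed
  have "card (\<Union>B) \<noteq> card B + 2"
  proof
    assume "card (\<Union>B) = card B + 2"
    then have "forbidden_configuration B"
      using three Suc.prems(2) by (auto simp: forbidden_configuration_def three_graph_def)
    with nf show False by simp
  qed
  with ge show ?case by simp
qed

text \<open>This weaker bound also covers single edges and the whole of \<open>S\<close>, where it
  is attained.\<close>

lemma erdos_span_nonempty:
  assumes S: "erdos_configuration S" and "B \<subseteq> S" "B \<noteq> {}"
  shows "card B + 2 \<le> card (\<Union>B)"
proof -
  have "finite B" using erdos_card(3)[OF S] assms(2) finite_subset by blast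
  then have "card B \<noteq> 0" using assms(3) by simp
  then have "B = S \<or> card B = 1 \<or> (B \<subset> S \<and> 2 \<le> card B)" using assms(2) by auto
  then consider "B = S" | "card B = 1" | "B \<subset> S" "2 \<le> card B" by auto
  then show ?thesis
  proof cases
    case 1
    then show ?thesis using erdos_card(1)[OF S] by simp
  next
    case 2
    then obtain T where "B = {T}" by (auto simp: card_1_singleton_iff)
    then show ?thesis using erdos_edge[OF S] assms(2) by auto
  next
    case 3
    then show ?thesis using erdos_span[OF S, of B] by simp
  qed
qed

section \<open>Invariance under relabelling and the counts \<open>kappa\<close>\<close>

lemma forbidden_image:
  assumes "forbidden_configuration S" "inj_on f (\<Union>S)"
  shows "forbidden_configuration ((`) f ` S)"
proof -
  have inj: "inj_on ((`) f) S"
    using assms(2) by (auto intro!: inj_onI dest: inj_on_image_eq_iff[of f "\<Union>S"] )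
  have "\<Union>((`) f ` S) = f ` \<Union>S" by auto
  moreover have "card (f ` \<Union>S) = card (\<Union>S)" by (rule card_image[OF assms(2)])
  moreover have "card ((`) f ` S) = card S" by (rule card_image[OF inj])
  moreover have "card (f ` T) = card T" if "T \<in> S" for T
    using assms(2) that by (intro card_image) (auto intro: inj_on_subset)
  ultimately show ?thesis
    using assms(1) by (auto simp: forbidden_configuration_def three_graph_def)
qed

text \<open>A forbidden proper subset of the image pulls back along the inverse of \<open>f\<close>,
  so minimality is preserved together with the edge and vertex counts.\<close>

lemma erdos_image:
  assumes "erdos_configuration S" "inj_on f (\<Union>S)"
  shows "erdos_configuration ((`) f ` S)"
  unfolding erdos_configuration_def
proof (intro conjI notI)
  show "forbidden_configuration ((`) f ` S)"
    using assms forbidden_image by (auto simp: erdos_configuration_def)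
  assume "\<exists>S'\<subset>(`) f ` S. forbidden_configuration S'"
  then obtain S' where S': "S' \<subset> (`) f ` S" "forbidden_configuration S'" by auto
  let ?g = "inv_into (\<Union>S) f"
  have inv: "(`) ?g ` ((`) f ` B) = B" if "B \<subseteq> S" for B
  proof -
    have "?g ` (f ` T) = T" if "T \<in> B" for T
      using that \<open>B \<subseteq> S\<close> assms(2) by (intro inv_into_image_cancel) auto
    then have "(\<lambda>T. ?g ` (f ` T)) ` B = id ` B" by (intro image_cong) auto
    then show ?thesis by (simp add: image_image)
  qed
  obtain B where B: "B \<subset> S" "S' = (`) f ` B"
    using S'(1) by (metis subset_image_iff psubset_eq psubsetI)
  have "inj_on ?g (\<Union>S')"
    using B by (intro inj_on_inv_into) auto
  then have "forbidden_configuration ((`) ?g ` S')" by (rule forbidden_image[OF S'(2)])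
  then have "forbidden_configuration B" using inv B by simp
  then show False using assms(1) B by (auto simp: erdos_configuration_def)
qed

text \<open>An Erdos configuration with \<open>i\<close> edges has exactly \<open>i + 2\<close>
  vertices, so this counts those on a fixed vertex set through a fixed edge. Concrete labels make
  the number independent of the ambient vertex type.\<close>

definition kappa :: "nat \<Rightarrow> nat" where
  "kappa i = card {S. erdos_configuration S \<and> \<Union>S = {..<i + 2} \<and> {0, 1, 2::nat} \<in> S}"

text \<open>One inequality suffices: the reverse one follows by applying it to the inverse bijection
  in \<open>card_configs_eq_kappa\<close>.\<close>

lemma card_configs_le:
  assumes "bij_betw f Y Z" "T \<subseteq> Y" "finite Z"
  shows "card {S. erdos_configuration S \<and> \<Union>S = Y \<and> T \<in> S}
    \<le> card {S. erdos_configuration S \<and> \<Union>S = Z \<and> f ` T \<in> S}"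
proof (rule card_inj_on_le[of "(`) ((`) f)"])
  have inj: "inj_on f Y" using assms(1) by (auto simp: bij_betw_def)
  have "inj_on ((`) f) (Pow Y)" by (rule inj_on_image_Pow[OF inj])
  then have "inj_on ((`) ((`) f)) (Pow (Pow Y))" by (rule inj_on_image_Pow)
  then show "inj_on ((`) ((`) f)) {S. erdos_configuration S \<and> \<Union>S = Y \<and> T \<in> S}"
    by (rule inj_on_subset) auto
  show "(`) ((`) f) ` {S. erdos_configuration S \<and> \<Union>S = Y \<and> T \<in> S}
     \<subseteq> {S. erdos_configuration S \<and> \<Union>S = Z \<and> f ` T \<in> S}"
  proof clarify
    fix S assume S: "erdos_configuration S" "Y = \<Union>S" "T \<in> S"
    have "erdos_configuration ((`) f ` S)" using erdos_image[OF S(1)] inj S by simp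
    moreover have "\<Union>((`) f ` S) = Z" using assms(1) S by (auto simp: bij_betw_def)
    ultimately show "erdos_configuration ((`) f ` S) \<and> \<Union>((`) f ` S) = Z \<and> f ` T \<in> (`) f ` S"
      using S by auto
  qed
  have "{S. erdos_configuration S \<and> \<Union>S = Z \<and> f ` T \<in> S} \<subseteq> Pow (Pow Z)" by auto
  then show "finite {S. erdos_configuration S \<and> \<Union>S = Z \<and> f ` T \<in> S}"
    by (rule finite_subset) (simp add: assms(3))
qed

lemma card_configs_eq_kappa:
  assumes "finite Y" "card Y = i + 2" "T \<subseteq> Y" "card T = 3"
  shows "card {S. erdos_configuration S \<and> \<Union>S = Y \<and> T \<in> S} = kappa i"
proof -
  have i: "i \<ge> 1" using card_mono[OF assms(1,3)] assms by simp
  have sub: "{0, 1, 2} \<subseteq> {..<i + 2}" using i by auto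
  have fT: "finite T" using assms finite_subset by blast
  obtain f where f: "bij_betw f T {0, 1, 2::nat}"
    using finite_same_card_bij[of T "{0, 1, 2::nat}"] fT assms by auto
  have "card (Y - T) = card ({..<i + 2} - {0, 1, 2::nat})"
    using card_Diff_subset[OF fT assms(3)] card_Diff_subset[OF _ sub] assms by simp
  then obtain g where g: "bij_betw g (Y - T) ({..<i + 2} - {0, 1, 2::nat})"
    using finite_same_card_bij[of "Y - T" "{..<i + 2} - {0, 1, 2::nat}"] assms by auto
  \<comment> \<open>Glueing a bijection on \<open>T\<close> to one on its complement sends the
    prescribed edge to \<open>{0, 1, 2}\<close>.\<close>
  define \<phi> where "\<phi> = (\<lambda>x. if x \<in> T then f x else g x)"
  have eqs: "T \<union> (Y - T) = Y" "{0, 1, 2} \<union> ({..<i + 2} - {0, 1, 2}) = {..<i + 2}"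
    using assms(3) sub by (simp_all only: Un_Diff_cancel Un_absorb1)
  have "bij_betw \<phi> (T \<union> (Y - T)) ({0, 1, 2} \<union> ({..<i + 2} - {0, 1, 2}))"
  proof (rule bij_betw_combine)
    show "bij_betw \<phi> T {0, 1, 2}" using f by (simp add: \<phi>_def cong: bij_betw_cong)
    show "bij_betw \<phi> (Y - T) ({..<i + 2} - {0, 1, 2})"
      using bij_betw_cong[of "Y - T" \<phi> g] g by (simp add: \<phi>_def)
  qed auto
  then have bij: "bij_betw \<phi> Y {..<i + 2}" unfolding eqs .
  have im: "\<phi> ` T = {0, 1, 2}" using f by (simp add: \<phi>_def bij_betw_def)
  let ?\<psi> = "inv_into Y \<phi>"
  have bij': "bij_betw ?\<psi> {..<i + 2} Y" by (rule bij_betw_inv_into[OF bij])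
  have im': "?\<psi> ` {0, 1, 2} = T"
    using inv_into_image_cancel[of \<phi> Y T] bij assms(3) im by (auto simp: bij_betw_def)
  show ?thesis
    using card_configs_le[OF bij assms(3)] card_configs_le[OF bij' sub assms(1)]
    unfolding im im' kappa_def by simp
qed

section \<open>The lazy chain\<close>

definition conflict :: "nat \<Rightarrow> 'a set set \<Rightarrow> bool" where
  "conflict k S \<longleftrightarrow> erdos_configuration S \<and> card (\<Union>S) \<le> k + 2"

text \<open>Two triples on four points form the smallest Erdos configuration, and
  \<open>2 \<le> k\<close> admits four points. Chosen triples therefore never share a pair.\<close>

lemma conflict_pair:
  assumes "2 \<le> k" "card T = 3" "card U = 3" "T \<noteq> U" "e \<subseteq> T" "e \<subseteq> U" "card e = 2"
  shows "conflict k {T, U}"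
proof -
  have fin: "finite T" "finite U" using assms by (auto intro: card_ge_0_finite)
  have "card e \<le> card (T \<inter> U)" using assms fin by (intro card_mono) auto
  then have "card (T \<union> U) \<le> 4" using card_Un_Int[of T U] assms fin by simp
  then have 4: "card (T \<union> U) = 4" using card_Un_triples_ge[of T U] assms by force
  then have forb: "forbidden_configuration {T, U}"
    using assms by (auto simp: forbidden_configuration_def three_graph_def)
  have "\<not> forbidden_configuration S'" if "S' \<subset> {T, U}" for S'
  proof -
    have "card S' < card {T, U}" using that by (intro psubset_card_mono) auto
    also have "\<dots> = 2" using \<open>T \<noteq> U\<close> by simp
    finally show ?thesis by (auto simp: forbidden_configuration_def)
  qed
  then show ?thesis using forb 4 assms by (auto simp: conflict_def erdos_configuration_def)
qed

text \<open>The left side consists of the first two terms of the binomial expansion. It acts as a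
  discrete derivative, once for probabilities bounded step by step and once for power sums.\<close>

lemma power_add_ge:
  fixes x y :: real
  assumes "0 \<le> x" "0 \<le> y"
  shows "x ^ Suc l + real (Suc l) * x ^ l * y \<le> (x + y) ^ Suc l"
proof (induction l)
  case (Suc l)
  have "0 \<le> real (Suc l) * x ^ l * y * y" using assms by simp
  then have "x ^ Suc (Suc l) + real (Suc (Suc l)) * x ^ Suc l * y
      \<le> (x + y) * (x ^ Suc l + real (Suc l) * x ^ l * y)"
    by (simp add: algebra_simps)
  also have "\<dots> \<le> (x + y) * (x + y) ^ Suc l"
    using Suc assms by (intro mult_left_mono) auto
  finally show ?case by simp
qed simp

locale lazy_process =
  fixes k :: nat and V :: "'a set"
  assumes k_ge: "2 \<le> k" and finite_V: "finite V" and card_V_ge: "3 \<le> card V"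
begin

text \<open>Along the process the set of available triples is determined by the set \<open>C\<close> of chosen ones, so
  \<open>C\<close> alone serves as the state.\<close>

definition avail :: "'a set set \<Rightarrow> 'a set set" where
  "avail C = {T \<in> triples V - C. \<not> (\<exists>S. conflict k S \<and> T \<in> S \<and> S \<subseteq> insert T C)}"

definition kills :: "'a set set \<Rightarrow> 'a set \<Rightarrow> 'a set \<Rightarrow> bool" where
  "kills C U T \<longleftrightarrow> (\<exists>S. conflict k S \<and> T \<in> S \<and> U \<in> S \<and> S \<subseteq> insert T (insert U C))"

definition conflict_free :: "'a set set \<Rightarrow> bool" where
  "conflict_free C \<longleftrightarrow> C \<subseteq> triples V \<and> (\<forall>S. conflict k S \<longrightarrow> \<not> S \<subseteq> C)"

definition lazy_step :: "'a set set \<Rightarrow> 'a set \<Rightarrow> 'a set set" where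
  "lazy_step C T = (if T \<in> avail C then insert T C else C)"

definition M :: real where "M = real (card (triples V))"

text \<open>The expectation after \<open>u\<close> lazy steps from the empty state, written with the
  transition operator acting on the test function, so that linearity and monotonicity replace
  measure theory.\<close>

primrec ev :: "nat \<Rightarrow> ('a set set \<Rightarrow> real) \<Rightarrow> real" where
  "ev 0 f = f {}"
| "ev (Suc u) f = ev u (\<lambda>C. (\<Sum>T\<in>triples V. f (lazy_step C T)) / M)"

lemma avail_subset: "avail C \<subseteq> triples V" and avail_disjoint: "T \<in> avail C \<Longrightarrow> T \<notin> C"
  by (auto simp: avail_def)

lemma finite_trip: "finite (triples V)"
  by (rule finite_triples[OF finite_V])

lemma finite_avail: "finite (avail C)"
  using avail_subset finite_trip finite_subset by blast

lemma card_triples: "card (triples V) = card V choose 3"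
  unfolding triples_def by (rule n_subsets[OF finite_V])

lemma M_pos: "M > 0"
  using card_V_ge by (simp add: M_def card_triples)

lemma M_eq: "M = real (card V) * (real (card V) - 1) * (real (card V) - 2) / 6"
proof -
  have "real (card V choose 3) = real (card V) gchoose 3" by (simp add: binomial_gbinomial)
  also have "\<dots> = real (card V) * (real (card V) - 1) * (real (card V) - 2) / 6"
    by (simp add: gbinomial_prod_rev fact_prod numeral_3_eq_3 atLeast0_lessThan_Suc field_simps)
  finally show ?thesis by (simp add: M_def card_triples)
qed

text \<open>A conflict through \<open>T\<close> that appears with the choice of \<open>U\<close>
  must contain \<open>U\<close>; every other one was visible before.\<close>

lemma avail_insert:
  assumes "U \<in> avail C"
  shows "avail (insert U C) = {T \<in> avail C. T \<noteq> U \<and> \<not> kills C U T}"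
proof (intro set_eqI iffI)
  fix T assume "T \<in> avail (insert U C)"
  then show "T \<in> {T \<in> avail C. T \<noteq> U \<and> \<not> kills C U T}"
    unfolding avail_def kills_def by blast
next
  fix T assume T: "T \<in> {T \<in> avail C. T \<noteq> U \<and> \<not> kills C U T}"
  have "\<not> S \<subseteq> insert T (insert U C)" if "conflict k S" "T \<in> S" for S
  proof (cases "U \<in> S")
    case True with T that show ?thesis by (auto simp: kills_def)
  next
    case False with T that show ?thesis by (auto simp: avail_def)
  qed
  with T show "T \<in> avail (insert U C)" by (auto simp: avail_def)
qed

lemma conflict_free_insert: "conflict_free C \<Longrightarrow> U \<in> avail C \<Longrightarrow> conflict_free (insert U C)"
  unfolding conflict_free_def avail_def by (auto 0 4)

lemma conflict_free_lazy_step: "conflict_free C \<Longrightarrow> conflict_free (lazy_step C T)"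
  by (simp add: lazy_step_def conflict_free_insert)

lemma conflict_card: 
  assumes "conflict k S" shows "2 \<le> card S" "card S \<le> k" "card (\<Union>S) = card S + 2" "finite S"
  using assms erdos_card[of S] by (auto simp: conflict_def)

lemma conflict_free_empty: "conflict_free {}"
  using conflict_card by (fastforce simp: conflict_free_def)

text \<open>The comparison is asked only on conflict-free states, which form an invariant set
  containing the start; the later combinatorial estimates are proved only there.\<close>

lemma ev_mono:
  assumes "\<And>C. conflict_free C \<Longrightarrow> f C \<le> g C"
  shows "ev u f \<le> ev u g"
  using assms
proof (induction u arbitrary: f g)
  case 0 then show ?case using conflict_free_empty by simp
next
  case (Suc u)
  show ?case unfolding ev.simps
    using Suc.prems conflict_free_lazy_step M_pos
    by (intro Suc.IH divide_right_mono sum_mono) auto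
qed

lemma ev_cong: "(\<And>C. conflict_free C \<Longrightarrow> f C = g C) \<Longrightarrow> ev u f = ev u g"
  by (intro antisym ev_mono) auto

lemma ev_add: "ev u (\<lambda>C. f C + g C) = ev u f + ev u g"
  by (induction u arbitrary: f g) (simp_all add: sum.distrib add_divide_distrib)

lemma ev_cmult: "ev u (\<lambda>C. c * f C) = c * ev u f"
proof (induction u arbitrary: f)
  case (Suc u)
  show ?case
    using Suc[of "\<lambda>C. (\<Sum>T\<in>triples V. f (lazy_step C T)) / M"]
    by (simp add: sum_distrib_left)
qed simp

lemma ev_minus: "ev u (\<lambda>C. - f C) = - ev u f"
  using ev_cmult[of u "-1" f] by simp

lemma ev_diff: "ev u (\<lambda>C. f C - g C) = ev u f - ev u g"
  using ev_add[of u f "\<lambda>C. - g C"] ev_minus by simp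

lemma ev_const: "ev u (\<lambda>C. c) = c"
  using M_pos by (induction u) (simp_all add: M_def)

lemma ev_sum: "finite I \<Longrightarrow> ev u (\<lambda>C. \<Sum>i\<in>I. f i C) = (\<Sum>i\<in>I. ev u (f i))"
  by (induction I rule: finite_induct) (simp_all add: ev_const ev_add)

lemma ev_nonneg: "(\<And>C. conflict_free C \<Longrightarrow> 0 \<le> f C) \<Longrightarrow> 0 \<le> ev u f"
  using ev_mono[of "\<lambda>_. 0" f u] by (simp add: ev_const)

lemma ev_Suc: "ev (Suc u) f = ev u f + ev u (\<lambda>C. \<Sum>T\<in>triples V. f (lazy_step C T) - f C) / M"
proof -
  have "(\<Sum>T\<in>triples V. f (lazy_step C T)) / M
      = f C + (1 / M) * (\<Sum>T\<in>triples V. f (lazy_step C T) - f C)" for C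
    using M_pos by (simp add: sum_subtractf M_def field_simps)
  then have "ev (Suc u) f = ev u (\<lambda>C. f C + (1 / M) * (\<Sum>T\<in>triples V. f (lazy_step C T) - f C))"
    by simp
  also have "\<dots> = ev u f + (1 / M) * ev u (\<lambda>C. \<Sum>T\<in>triples V. f (lazy_step C T) - f C)"
    by (simp only: ev_add ev_cmult)
  finally show ?thesis by simp
qed

lemma ev_chosen_le:
  assumes "finite R"
  shows "ev u (\<lambda>C. of_bool (R \<subseteq> C)) \<le> (real u / M) ^ card R"
  using assms
proof (induction u arbitrary: R)
  case 0
  then show ?case by (cases "R = {}") auto
next
  case (Suc u)
  let ?m = "card R" and ?x = "real u / M"
  have "ev (Suc u) (\<lambda>C. of_bool (R \<subseteq> C))
      \<le> ev u (\<lambda>C. of_bool (R \<subseteq> C) + (1 / M) * (\<Sum>c\<in>R. of_bool (R - {c} \<subseteq> C)))"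
    unfolding ev.simps
  proof (rule ev_mono)
    fix C
    have "(\<Sum>T\<in>triples V. of_bool (R \<subseteq> lazy_step C T) :: real)
        \<le> (\<Sum>T\<in>triples V. of_bool (R \<subseteq> C) + of_bool (T \<in> R \<and> R - {T} \<subseteq> C))"
      by (rule sum_mono) (auto simp: lazy_step_def of_bool_def)
    also have "\<dots> = M * of_bool (R \<subseteq> C) + (\<Sum>T\<in>triples V. of_bool (T \<in> R \<and> R - {T} \<subseteq> C))"
      by (simp add: sum.distrib M_def)
    also have "(\<Sum>T\<in>triples V. of_bool (T \<in> R \<and> R - {T} \<subseteq> C) :: real)
        = (\<Sum>T\<in>triples V \<inter> R. of_bool (R - {T} \<subseteq> C))"
      using finite_trip by (intro sum.mono_neutral_cong_right) auto
    also have "\<dots> \<le> (\<Sum>T\<in>R. of_bool (R - {T} \<subseteq> C))"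
      using Suc.prems by (intro sum_mono2) auto
    finally show "(\<Sum>T\<in>triples V. of_bool (R \<subseteq> lazy_step C T)) / M
        \<le> of_bool (R \<subseteq> C) + (1 / M) * (\<Sum>c\<in>R. of_bool (R - {c} \<subseteq> C))"
      using M_pos by (simp add: field_simps)
  qed
  also have "\<dots> = ev u (\<lambda>C. of_bool (R \<subseteq> C)) + (1 / M) * (\<Sum>c\<in>R. ev u (\<lambda>C. of_bool (R - {c} \<subseteq> C)))"
    using Suc.prems by (simp only: ev_add ev_cmult ev_sum)
  also have "\<dots> \<le> ?x ^ ?m + (1 / M) * (\<Sum>c\<in>R. ?x ^ (?m - 1))"
  proof (intro add_mono mult_left_mono sum_mono)
    fix c assume "c \<in> R"
    then show "ev u (\<lambda>C. of_bool (R - {c} \<subseteq> C)) \<le> ?x ^ (?m - 1)"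
      using Suc.IH[of "R - {c}"] Suc.prems by simp
  qed (use Suc M_pos in auto)
  also have "\<dots> = ?x ^ ?m + real ?m * ?x ^ (?m - 1) * (1 / M)" by simp
  also have "\<dots> \<le> (?x + 1 / M) ^ ?m"
  proof (cases ?m)
    case (Suc l)
    then show ?thesis using power_add_ge[of ?x "1 / M" l] M_pos by simp
  qed simp
  also have "?x + 1 / M = real (Suc u) / M" by (simp add: add_divide_distrib)
  finally show ?case .
qed

text \<open>With \<open>\<sigma>\<close> bounding the rescaled time, each prescribed triple costs a
  factor of order 1/n. The exponent of \<open>\<sigma>\<close> is enlarged to a fixed
  \<open>m\<close> to be uniform over index sets.\<close>

lemma ev_chosen_le_scaled:
  assumes "finite R" "1 \<le> \<sigma>" "real u * (real (card V) / M) \<le> \<sigma>" "card R \<le> m"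
  shows "ev u (\<lambda>C. of_bool (R \<subseteq> C)) \<le> \<sigma> ^ m * (1 / real (card V)) ^ card R"
proof -
  have n: "real (card V) > 0" using card_V_ge by simp
  have "ev u (\<lambda>C. of_bool (R \<subseteq> C)) \<le> (real u / M) ^ card R" by (rule ev_chosen_le[OF assms(1)])
  also have "\<dots> \<le> (\<sigma> * (1 / real (card V))) ^ card R"
    using assms(3) n M_pos by (intro power_mono) (auto simp: field_simps)
  also have "\<dots> = \<sigma> ^ card R * (1 / real (card V)) ^ card R" by (rule power_mult_distrib)
  also have "\<dots> \<le> \<sigma> ^ m * (1 / real (card V)) ^ card R"
    using assms by (intro mult_right_mono power_increasing) auto
  finally show ?thesis .
qed

text \<open>By \<open>conflict_pair\<close> distinct chosen triples cover disjoint sets of three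
  pairs each, inside the set of all pairs of vertices.\<close>

lemma card_conflict_free_le:
  assumes "conflict_free C"
  shows "6 * real (card C) \<le> (real (card V))\<^sup>2"
proof -
  have C: "C \<subseteq> triples V" using assms by (simp add: conflict_free_def)
  then have finC: "finite C" using finite_trip finite_subset by blast
  have T: "finite T" "card T = 3" "T \<subseteq> V" if "T \<in> C" for T
    using C that finite_V by (auto simp: triples_def intro: finite_subset)
  have disj: "{e. e \<subseteq> T \<and> card e = 2} \<inter> {e. e \<subseteq> U \<and> card e = 2} = {}"
    if "T \<in> C" "U \<in> C" "T \<noteq> U" for T U
  proof (rule ccontr)
    assume "\<not> ?thesis"
    then obtain e where e: "e \<subseteq> T" "e \<subseteq> U" "card e = 2" by auto
    have "conflict k {T, U}" using conflict_pair[OF k_ge _ _ that(3) e] T that by simp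
    then show False using assms that by (auto simp: conflict_free_def)
  qed
  have "3 * card C = (\<Sum>T\<in>C. card {e. e \<subseteq> T \<and> card e = 2})"
    using T by (simp add: n_subsets choose_two)
  also have "\<dots> = card (\<Union>T\<in>C. {e. e \<subseteq> T \<and> card e = 2})"
    using finC T disj by (intro card_UN_disjoint[symmetric]) auto
  also have "\<dots> \<le> card {e. e \<subseteq> V \<and> card e = 2}"
  proof (rule card_mono)
    show "(\<Union>T\<in>C. {e. e \<subseteq> T \<and> card e = 2}) \<subseteq> {e. e \<subseteq> V \<and> card e = 2}"
      using T(3) by blast
  qed (use finite_V in auto)
  also have "\<dots> = card V choose 2" by (rule n_subsets[OF finite_V])
  finally have "6 * card C \<le> 2 * (card V choose 2)" by simp
  also have "\<dots> \<le> card V * (card V - 1)" by (simp add: choose_two)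
  also have "\<dots> \<le> card V * card V" by simp
  finally have "real (6 * card C) \<le> real (card V * card V)" by (simp only: of_nat_le_iff)
  then show ?thesis by (simp add: power2_eq_square)
qed

section \<open>Transfer from the lazy chain to the original process\<close>

lemma conflict_not_singleton: "conflict k S \<Longrightarrow> S \<subseteq> {T} \<Longrightarrow> False"
  using conflict_card(1)[of S] card_mono[of "{T}" S] by simp

lemma avail_empty: "avail {} = triples V"
  unfolding avail_def using conflict_not_singleton by auto

text \<open>The rule of the process removes exactly the triples described by \<open>kills\<close>,
  so its first component remains \<open>avail\<close> of the second.\<close>

lemma process_step_avail:
  "process_step k (avail C, C) = (if avail C = {} then return_pmf (avail C, C)
     else map_pmf (\<lambda>T. (avail (insert T C), insert T C)) (pmf_of_set (avail C)))"
proof (cases "avail C = {}")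
  case False
  have "(avail C - (excluded k (avail C, C) U \<union> {U}), C \<union> {U}) = (avail (insert U C), insert U C)"
    if U: "U \<in> avail C" for U
  proof -
    have "T \<in> excluded k (avail C, C) U \<longleftrightarrow> kills C U T" if T: "T \<in> avail C" for T
    proof
      assume "T \<in> excluded k (avail C, C) U"
      then obtain C' where "C' \<subseteq> C" "conflict k ({T, U} \<union> C')"
        by (auto simp: excluded_def conflict_def)
      then show "kills C U T" unfolding kills_def by (intro exI[of _ "{T, U} \<union> C'"]) auto
    next
      assume "kills C U T"
      then obtain S where S: "conflict k S" "T \<in> S" "U \<in> S" "S \<subseteq> insert T (insert U C)"
        by (auto simp: kills_def)
      then have "{T, U} \<union> (S - {T, U}) = S" "S - {T, U} \<subseteq> C" by auto
      then show "T \<in> excluded k (avail C, C) U"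
        unfolding excluded_def using T S(1)
        by (simp only: split mem_Collect_eq) (metis conflict_def)
    qed
    then show ?thesis unfolding avail_insert[OF U] by auto
  qed
  then have "map_pmf (\<lambda>U. (avail C - (excluded k (avail C, C) U \<union> {U}), C \<union> {U})) (pmf_of_set (avail C))
      = map_pmf (\<lambda>T. (avail (insert T C), insert T C)) (pmf_of_set (avail C))"
    using set_pmf_of_set[OF False finite_avail] by (intro map_pmf_cong[OF refl]) simp
  then show ?thesis using False by (simp add: process_step_def)
qed (simp add: process_step_def)

text \<open>Unlike \<open>trajectory\<close>, this recursion peels off the first step, which permits
  induction over arbitrary starting states; \<open>run_Suc_right\<close> links the two.\<close>

primrec run :: "nat \<Rightarrow> 'a state \<Rightarrow> 'a state pmf" where
  "run 0 s = return_pmf s"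
| "run (Suc m) s = bind_pmf (process_step k s) (run m)"

lemma run_Suc_right: "run (Suc m) s = bind_pmf (run m s) (process_step k)"
proof (induction m arbitrary: s)
  case 0
  have "run 0 = return_pmf" by (simp add: fun_eq_iff)
  then show ?case by (simp add: bind_return_pmf bind_return_pmf')
next
  case (Suc m)
  have "run (Suc m) = (\<lambda>t. bind_pmf (run m t) (process_step k))" using Suc.IH by (rule ext)
  then have "run (Suc (Suc m)) s = bind_pmf (process_step k s) (\<lambda>t. bind_pmf (run m t) (process_step k))"
    by (subst run.simps(2)) (simp only:)
  then show ?case by (simp only: run.simps(2) bind_assoc_pmf)
qed

lemma last_trajectory: "map_pmf last (trajectory k V m) = run m (triples V, {})"
proof (induction m)
  case (Suc m)
  have "map_pmf last (trajectory k V (Suc m))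
      = bind_pmf (trajectory k V m) (\<lambda>ss. process_step k (last ss))"
    by (simp add: map_bind_pmf map_pmf_comp)
  also have "\<dots> = bind_pmf (map_pmf last (trajectory k V m)) (process_step k)"
    by (simp add: bind_map_pmf)
  finally show ?case unfolding Suc.IH run_Suc_right .
qed simp

text \<open>The counterpart of \<open>ev\<close> for the original process, with the starting state
  as an argument so that it can itself serve as a test function of \<open>ev\<close>.\<close>

primrec greedy :: "nat \<Rightarrow> ('a set set \<Rightarrow> real) \<Rightarrow> 'a set set \<Rightarrow> real" where
  "greedy 0 f C = f C"
| "greedy (Suc m) f C = (if avail C = {} then f C
     else (\<Sum>T\<in>avail C. greedy m f (insert T C)) / real (card (avail C)))"

lemma greedy_no_avail: "avail C = {} \<Longrightarrow> greedy m f C = f C"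
  by (cases m) auto

lemma prob_bind_pmf:
  "measure_pmf.prob (bind_pmf p f) A = measure_pmf.expectation p (\<lambda>x. measure_pmf.prob (f x) A)"
proof -
  have "ennreal (measure_pmf.prob (bind_pmf p f) A) = (\<integral>\<^sup>+x. ennreal (measure_pmf.prob (f x) A) \<partial>measure_pmf p)"
    by (simp add: emeasure_bind_pmf flip: measure_pmf.emeasure_eq_measure)
  also have "\<dots> = ennreal (measure_pmf.expectation p (\<lambda>x. measure_pmf.prob (f x) A))"
    by (intro nn_integral_eq_integral measure_pmf.integrable_const_bound[where B = 1]) auto
  finally show ?thesis by (simp add: integral_nonneg_AE)
qed

lemma prob_run:
  "measure_pmf.prob (run m (avail C, C)) {s. Q (snd s)} = greedy m (\<lambda>C. of_bool (Q C)) C"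
proof (induction m arbitrary: C)
  case 0
  then show ?case by (simp add: indicator_def)
next
  case (Suc m)
  show ?case
  proof (cases "avail C = {}")
    case True
    have "process_step k (avail C, C) = return_pmf (avail C, C)"
      using process_step_avail[of C] True by (simp only: simp_thms if_True)
    then have "run (Suc m) (avail C, C) = run m (avail C, C)" by (simp only: run.simps bind_return_pmf)
    then show ?thesis using Suc.IH[of C] by (simp only: greedy_no_avail[OF True])
  next
    case False
    have "run (Suc m) (avail C, C)
        = bind_pmf (pmf_of_set (avail C)) (\<lambda>T. run m (avail (insert T C), insert T C))"
      using False by (simp add: process_step_avail bind_map_pmf)
    then have "measure_pmf.prob (run (Suc m) (avail C, C)) {s. Q (snd s)}
        = measure_pmf.expectation (pmf_of_set (avail C)) (\<lambda>T. greedy m (\<lambda>C. of_bool (Q C)) (insert T C))"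
      by (simp only: prob_bind_pmf Suc.IH)
    then show ?thesis using False finite_avail by (simp add: integral_pmf_of_set)
  qed
qed

lemma card_avail_insert:
  assumes "T \<in> avail C" shows "card (avail (insert T C)) < card (avail C)"
  using avail_insert[OF assms] assms by (intro psubset_card_mono finite_avail) auto

text \<open>Every step removes at least the chosen triple from the available ones, so nothing
  changes after \<open>card (avail C)\<close> steps.\<close>

lemma greedy_stable: "card (avail C) \<le> m \<Longrightarrow> greedy (Suc m) f C = greedy m f C"
proof (induction m arbitrary: C)
  case 0
  then show ?case using finite_avail by simp
next
  case (Suc m)
  show ?case
  proof (cases "avail C = {}")
    case False
    have "greedy (Suc m) f (insert T C) = greedy m f (insert T C)" if "T \<in> avail C" for T
      using card_avail_insert[OF that] Suc.prems by (intro Suc.IH) simp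
    then have "(\<Sum>T\<in>avail C. greedy (Suc m) f (insert T C)) = (\<Sum>T\<in>avail C. greedy m f (insert T C))"
      by (rule sum.cong[OF refl])
    then show ?thesis using False by (subst (1 2) greedy.simps(2)) simp
  qed (simp add: greedy_no_avail)
qed

lemma greedy_ge:
  assumes "\<And>C T. conflict_free C \<Longrightarrow> T \<in> avail C \<Longrightarrow> f C \<le> f (insert T C)" "conflict_free C"
  shows "f C \<le> greedy m f C"
  using assms(2)
proof (induction m arbitrary: C)
  case (Suc m)
  show ?case
  proof (cases "avail C = {}")
    case False
    then have pos: "0 < real (card (avail C))" using finite_avail by (simp add: card_gt_0_iff)
    have "real (card (avail C)) * f C = (\<Sum>T\<in>avail C. f C)" by simp
    also have "\<dots> \<le> (\<Sum>T\<in>avail C. greedy m f (insert T C))"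
    proof (rule sum_mono)
      fix T assume T: "T \<in> avail C"
      show "f C \<le> greedy m f (insert T C)"
        using assms(1)[OF Suc.prems T] Suc.IH[OF conflict_free_insert[OF Suc.prems T]] by simp
    qed
    finally show ?thesis using False pos by (simp add: field_simps)
  qed simp
qed simp

text \<open>The greedy value is harmonic for the lazy chain: idle lazy steps do not change it.\<close>

lemma ev_le_greedy:
  assumes "\<And>C T. conflict_free C \<Longrightarrow> T \<in> avail C \<Longrightarrow> f C \<le> f (insert T C)"
  shows "ev u f \<le> greedy (card (triples V)) f {}"
proof -
  let ?N = "card (triples V)"
  let ?g = "greedy ?N f"
  have N: "card (avail C) \<le> ?N" for C by (rule card_mono[OF finite_trip avail_subset])
  have harmonic: "(\<Sum>T\<in>triples V. ?g (lazy_step C T)) / M = ?g C" for C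
  proof -
    have "(\<Sum>T\<in>avail C. ?g (insert T C)) = real (card (avail C)) * ?g C"
    proof (cases "avail C = {}")
      case False
      then have "?N \<noteq> 0" using N[of C] finite_avail by (metis card_0_eq le_zero_eq)
      then obtain m where m: "?N = Suc m" using not0_implies_Suc by blast
      \<comment> \<open>After the insertion one step fewer is left, but the horizon is long enough
        for the value to be stable.\<close>
      have "greedy (Suc m) f (insert T C) = greedy m f (insert T C)" if "T \<in> avail C" for T
        using card_avail_insert[OF that] N[of C] m by (intro greedy_stable) simp
      then have "(\<Sum>T\<in>avail C. ?g (insert T C)) = (\<Sum>T\<in>avail C. greedy m f (insert T C))"
        unfolding m by (rule sum.cong[OF refl])
      then show ?thesis using False finite_avail unfolding m by simp
    qed simp
    moreover have "(\<Sum>T\<in>triples V. ?g (lazy_step C T))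
        = (\<Sum>T\<in>triples V - avail C. ?g C) + (\<Sum>T\<in>avail C. ?g (insert T C))"
      by (subst sum.subset_diff[OF avail_subset[of C] finite_trip])
        (auto simp: lazy_step_def intro!: arg_cong2[of _ _ _ _ "(+)"])
    moreover have "real (card (triples V - avail C)) = M - real (card (avail C))"
      using card_Diff_subset[OF finite_avail avail_subset] N[of C] by (simp add: M_def of_nat_diff)
    ultimately have "(\<Sum>T\<in>triples V. ?g (lazy_step C T)) = M * ?g C" by (simp add: algebra_simps)
    then show ?thesis using M_pos by simp
  qed
  have "ev u f \<le> ev u ?g" using assms by (intro ev_mono greedy_ge) auto
  also have "ev u ?g = ?g {}"
  proof (induction u)
    case (Suc u)
    have "ev (Suc u) ?g = ev u ?g" unfolding ev.simps harmonic ..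
    then show ?case using Suc by simp
  qed simp
  finally show ?thesis .
qed

text \<open>A run gains at most one triple per step and freezes once nothing is available. Together
  these facts bound the number of triples in the last state by \<open>tau_max\<close>.\<close>

lemma trajectory_invariant:
  assumes "ss \<in> set_pmf (trajectory k V m)"
  shows "\<forall>i<length ss. card (snd (ss ! i)) \<le> i \<and> (fst (ss ! i) = {} \<longrightarrow> last ss = ss ! i)"
  using assms
proof (induction m arbitrary: ss)
  case (Suc m)
  then obtain ts s where ts: "ts \<in> set_pmf (trajectory k V m)" "ss = ts @ [s]"
    "s \<in> set_pmf (process_step k (last ts))" by auto
  note IH = Suc.IH[OF ts(1)]
  have len: "length ts = Suc m" by (rule trajectory_available(1)[OF finite_V ts(1)])
  then have last: "last ts = ts ! m" by (metis diff_Suc_1 last_conv_nth length_0_conv nat.simps(3))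
  obtain A C where AC: "last ts = (A, C)" by (cases "last ts")
  have A: "finite A" using trajectory_available(2)[OF finite_V ts(1)] AC by simp
  have C: "card C \<le> m" using IH len last AC by (metis lessI snd_conv)
  have s: "card (snd s) \<le> Suc m \<and> (A = {} \<longrightarrow> s = (A, C))"
  proof (cases "A = {}")
    case True
    then show ?thesis using ts(3) AC C by (simp add: process_step_def)
  next
    case False
    then obtain U where "s = (A - (excluded k (A, C) U \<union> {U}), C \<union> {U})"
      using ts(3) A unfolding AC process_step_def by (auto simp: set_pmf_of_set)
    then have "card (snd s) \<le> card C + 1" using card_Un_le[of C "{U}"] by simp
    then show ?thesis using C False by simp
  qed
  show ?case
  proof (intro allI impI)
    fix i assume i: "i < length ss"
    show "card (snd (ss ! i)) \<le> i \<and> (fst (ss ! i) = {} \<longrightarrow> last ss = ss ! i)"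
    proof (cases "i = Suc m")
      case True
      then show ?thesis using ts(2) len s by (simp add: nth_append)
    next
      case False
      then have i': "i < length ts" using i ts(2) len by simp
      then have nth: "ss ! i = ts ! i" using ts(2) by (simp add: nth_append)
      have "last ss = ss ! i" if "fst (ss ! i) = {}"
      proof -
        have "last ts = ts ! i" using IH i' that nth by simp
        then show ?thesis using s AC that nth ts(2) by (metis fst_conv last_snoc)
      qed
      then show ?thesis using IH i' nth by simp
    qed
  qed
qed simp

text \<open>The number of chosen triples grows along transitions, so its threshold event passes
  through \<open>ev_le_greedy\<close>; in the final state this number is at most the termination
  time.\<close>

lemma prob_tau_max_ge:
  "ev u (\<lambda>C. of_bool (x \<le> real (card C))) \<le>
     measure_pmf.prob (high_girth_process k V) {ss. real (tau_max ss) \<ge> x}"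
proof -
  let ?N = "card (triples V)" and ?Q = "\<lambda>C. x \<le> real (card C)"
  have "ev u (\<lambda>C. of_bool (?Q C)) \<le> greedy ?N (\<lambda>C. of_bool (?Q C)) {}"
  proof (rule ev_le_greedy)
    fix C T assume "conflict_free C" "T \<in> avail C"
    then have "finite C" using finite_trip finite_subset by (auto simp: conflict_free_def)
    then have "card C \<le> card (insert T C)" by (intro card_mono) auto
    then have "?Q C \<longrightarrow> ?Q (insert T C)" by linarith
    then show "of_bool (?Q C) \<le> (of_bool (?Q (insert T C)) :: real)" by auto
  qed
  also have "\<dots> = measure_pmf.prob (run ?N (triples V, {})) {s. ?Q (snd s)}"
    using prob_run[of ?N "{}" ?Q] by (simp add: avail_empty)
  also have "\<dots> = measure_pmf.prob (high_girth_process k V) {ss. ?Q (snd (last ss))}"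
    unfolding last_trajectory[symmetric] high_girth_process_def by (simp add: vimage_def)
  also have "\<dots> \<le> measure_pmf.prob (high_girth_process k V) {ss. real (tau_max ss) \<ge> x}"
  proof (rule measure_pmf.finite_measure_mono_AE)
    have "?Q (snd (last ss)) \<longrightarrow> x \<le> real (tau_max ss)" if ss: "ss \<in> set_pmf (high_girth_process k V)" for ss
    proof -
      note t = high_girth_process_terminates[OF finite_V ss]
      have "card (snd (last ss)) \<le> tau_max ss"
        using trajectory_invariant[OF ss[unfolded high_girth_process_def]] t by metis
      then show ?thesis by linarith
    qed
    then show "AE ss in measure_pmf (high_girth_process k V).
        ss \<in> {ss. ?Q (snd (last ss))} \<longrightarrow> ss \<in> {ss. real (tau_max ss) \<ge> x}"
      by (simp add: AE_measure_pmf_iff)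
  qed simp
  finally show ?thesis .
qed

end

section \<open>The one-step drift of the correlation probabilities\<close>

lemma sum_of_bool_card:
  assumes "finite I"
  shows "(\<Sum>i\<in>I. of_bool (Q i)) = real (card {i \<in> I. Q i})"
  using assms by (simp add: sum_of_bool_eq Int_def)

text \<open>An index whose value is already taken contributes at least one ordered colliding pair.
  This Bonferroni bound controls double counting of killers.\<close>

lemma card_le_image_plus_collisions:
  assumes "finite I"
  shows "card I \<le> card (f ` I) + card {(i, j). i \<in> I \<and> j \<in> I \<and> i \<noteq> j \<and> f i = f j}"
  using assms
proof (induction I rule: finite_induct)
  case (insert x I)
  let ?P = "\<lambda>I. {(i, j). i \<in> I \<and> j \<in> I \<and> i \<noteq> j \<and> f i = f j}"
  have fin: "finite (?P (insert x I))"
    by (rule finite_subset[of _ "insert x I \<times> insert x I"]) (use insert in auto)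
  show ?case
  proof (cases "f x \<in> f ` I")
    case True
    then obtain y where y: "y \<in> I" "f x = f y" by auto
    have "card (?P I) < card (?P (insert x I))"
      using insert y by (intro psubset_card_mono[OF fin]) (auto simp: psubset_eq)
    moreover have "card (f ` insert x I) = card (f ` I)" using True by (simp add: insert_absorb)
    ultimately show ?thesis using insert by simp
  next
    case False
    then have "card (f ` insert x I) = Suc (card (f ` I))" using insert by simp
    moreover have "card (?P I) \<le> card (?P (insert x I))" by (intro card_mono[OF fin]) auto
    ultimately show ?thesis using insert by simp
  qed
qed simp

context lazy_process
begin

definition ind :: "'a set set \<Rightarrow> 'a set set \<Rightarrow> 'a set set \<Rightarrow> real" where
  "ind X Y C = of_bool (X \<subseteq> avail C \<and> Y \<subseteq> C)"

text \<open>For inconsistent \<open>(X, Y)\<close>, availability of \<open>X\<close> after the choice of \<open>Y\<close> is impossible.\<close>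

definition consistent :: "'a set set \<Rightarrow> 'a set set \<Rightarrow> bool" where
  "consistent X Y \<longleftrightarrow> X \<subseteq> triples V \<and> Y \<subseteq> triples V \<and> X \<inter> Y = {} \<and>
     (\<forall>S. conflict k S \<longrightarrow> S \<subseteq> X \<union> Y \<longrightarrow> 2 \<le> card (S \<inter> X))"

definition shadow :: "'a set set \<Rightarrow> 'a set set" where
  "shadow X = {e. card e = 2 \<and> (\<exists>T\<in>X. e \<subseteq> T)}"

text \<open>The ways in which a proposal \<open>U\<close> can kill some \<open>T \<in> X\<close>: by covering a pair of \<open>T\<close> with a new vertex
  (\<open>pair_idx\<close>), by completing a conflict \<open>S\<close> with at least three edges that is attached to the vertices
  of \<open>(X, Y)\<close> only along \<open>T\<close> (\<open>conf_idx\<close>), or through an accidental overlap (\<open>near_idx\<close>). Double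
  counting in \<open>conf_idx\<close> is controlled by \<open>clash_idx\<close>, and \<open>gain_idx\<close> covers the case that the choice
  of a member of \<open>Y\<close> kills a member of \<open>X\<close>.\<close>

definition pair_idx :: "'a set set \<Rightarrow> 'a set set \<Rightarrow> 'a set set" where
  "pair_idx X Y = {U \<in> triples V. U \<inter> \<Union>(X \<union> Y) \<in> shadow X}"

definition conf_idx :: "'a set set \<Rightarrow> 'a set set \<Rightarrow> ('a set \<times> 'a set set \<times> 'a set) set" where
  "conf_idx X Y = {(T, S, U). T \<in> X \<and> conflict k S \<and> S \<subseteq> triples V \<and> T \<in> S \<and> U \<in> S - {T} \<and>
     3 \<le> card S \<and> \<Union>S \<inter> \<Union>(X \<union> Y) = T}"

definition near_idx :: "'a set set \<Rightarrow> 'a set set \<Rightarrow> ('a set \<times> 'a set set \<times> 'a set) set" where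
  "near_idx X Y = {(T, S, U). T \<in> X \<and> conflict k S \<and> S \<subseteq> triples V \<and> T \<in> S \<and> U \<in> S - {T} \<and>
     S \<inter> X = {T} \<and> U \<notin> Y \<and> card (S \<inter> (X \<union> Y)) + 3 \<le> card (\<Union>S \<inter> \<Union>(X \<union> Y))}"

definition clash_idx :: "'a set set \<Rightarrow> 'a set set \<Rightarrow>
    (('a set \<times> 'a set set \<times> 'a set) \<times> ('a set \<times> 'a set set \<times> 'a set)) set" where
  "clash_idx X Y = {(i, j). i \<in> conf_idx X Y \<and> j \<in> conf_idx X Y \<and> i \<noteq> j \<and>
     snd (snd i) = snd (snd j)}"

definition gain_idx :: "'a set set \<Rightarrow> 'a set set \<Rightarrow> ('a set \<times> 'a set set \<times> 'a set) set" where
  "gain_idx X Y = {(T, S, U). T \<in> X \<and> conflict k S \<and> S \<subseteq> triples V \<and> T \<in> S \<and> U \<in> S \<and>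
     U \<in> Y \<and> S \<inter> X = {T} \<and> card (S \<inter> (X \<union> Y)) + 3 \<le> card (\<Union>S \<inter> \<Union>(X \<union> Y))}"

lemma tripleD: "T \<in> triples V \<Longrightarrow> card T = 3" "T \<in> triples V \<Longrightarrow> T \<subseteq> V" "T \<in> triples V \<Longrightarrow> finite T"
  using finite_V by (auto simp: triples_def intro: finite_subset)

lemma consistentD:
  assumes "consistent X Y"
  shows "X \<subseteq> triples V" "Y \<subseteq> triples V" "X \<inter> Y = {}" "finite X" "finite Y"
    "\<And>S. conflict k S \<Longrightarrow> S \<subseteq> X \<union> Y \<Longrightarrow> 2 \<le> card (S \<inter> X)"
    "\<Union>(X \<union> Y) \<subseteq> V" "finite (\<Union>(X \<union> Y))"
proof -
  show *: "X \<subseteq> triples V" "Y \<subseteq> triples V" "X \<inter> Y = {}"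
    "\<And>S. conflict k S \<Longrightarrow> S \<subseteq> X \<union> Y \<Longrightarrow> 2 \<le> card (S \<inter> X)"
    using assms by (auto simp: consistent_def)
  show "finite X" "finite Y" using * finite_trip finite_subset by blast+
  show **: "\<Union>(X \<union> Y) \<subseteq> V" using * by (auto simp: triples_def)
  show "finite (\<Union>(X \<union> Y))" by (rule finite_subset[OF ** finite_V])
qed

lemma finite_idx_triples:
  assumes "consistent X Y" 
    "I \<subseteq> {(T, S, U). T \<in> X \<and> S \<subseteq> triples V \<and> U \<in> S}"
  shows "finite I"
  by (rule finite_subset[of _ "X \<times> Pow (triples V) \<times> triples V"])
    (use assms consistentD(4)[OF assms(1)] finite_trip in auto)

lemma finite_idx:
  assumes "consistent X Y"
  shows "finite (pair_idx X Y)" "finite (conf_idx X Y)" "finite (near_idx X Y)"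
    "finite (clash_idx X Y)" "finite (gain_idx X Y)"
proof -
  show *: "finite (conf_idx X Y)" "finite (near_idx X Y)" "finite (gain_idx X Y)"
    by (rule finite_idx_triples[OF assms]; auto simp: conf_idx_def near_idx_def gain_idx_def)+
  show "finite (pair_idx X Y)" using finite_trip by (simp add: pair_idx_def)
  show "finite (clash_idx X Y)"
    by (rule finite_subset[of _ "conf_idx X Y \<times> conf_idx X Y"]) (use * in \<open>auto simp: clash_idx_def\<close>)
qed

lemma conflict_span:
  assumes "conflict k S" "B \<subset> S" "2 \<le> card B"
  shows "card B + 3 \<le> card (\<Union>B)"
  using assms erdos_span[of S B] by (simp add: conflict_def)

lemma conflict_edge:
  assumes "conflict k S" "T \<in> S" shows "card T = 3" "finite T"
proof -
  show "card T = 3" using assms erdos_edge[of S T] by (simp add: conflict_def)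
  then show "finite T" by (intro card_ge_0_finite) simp
qed

lemma conflict_Union:
  assumes "conflict k S" shows "finite (\<Union>S)" "card (\<Union>S) = card S + 2" "card (\<Union>S) \<le> k + 2"
  using assms erdos_card[of S] by (simp_all add: conflict_def)

text \<open>In a conflict with at least three edges, two of them form a proper subset and hence span
  at least five vertices.\<close>

lemma conflict_Int_le:
  assumes "conflict k S" "3 \<le> card S" "T \<in> S" "U \<in> S" "T \<noteq> U"
  shows "card (T \<inter> U) \<le> 1"
proof -
  have c2: "card {T, U} = 2" using assms(5) by simp
  then have "{T, U} \<noteq> S" using assms(2) by (intro notI) simp
  moreover have "{T, U} \<subseteq> S" using assms(3,4) by simp
  ultimately have "{T, U} \<subset> S" by (rule_tac psubsetI)
  then have "card {T, U} + 3 \<le> card (\<Union>{T, U})" using assms(1) c2 by (intro conflict_span) simp_all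
  moreover have "finite T" "finite U" "card T = 3" "card U = 3"
    using assms conflict_edge by blast+
  ultimately show ?thesis using card_Un_Int[of T U] c2 by simp
qed

text \<open>The edges of \<open>S\<close> in \<open>X \<union> Y\<close> span only support vertices,
  so their surplus of three carries over to the whole intersection with the support.\<close>

lemma span_in_support:
  assumes "consistent X Y" "conflict k S" "S \<inter> (X \<union> Y) \<subset> S" "2 \<le> card (S \<inter> (X \<union> Y))"
  shows "card (S \<inter> (X \<union> Y)) + 3 \<le> card (\<Union>S \<inter> \<Union>(X \<union> Y))"
proof -
  have "card (S \<inter> (X \<union> Y)) + 3 \<le> card (\<Union>(S \<inter> (X \<union> Y)))"
    using assms by (intro conflict_span) auto
  also have "\<dots> \<le> card (\<Union>S \<inter> \<Union>(X \<union> Y))"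
    using conflict_Union[OF assms(2)] by (intro card_mono) auto
  finally show ?thesis .
qed

abbreviation lost :: "'a set set \<Rightarrow> 'a set set \<Rightarrow> 'a set set" where
  "lost X C \<equiv> {U \<in> avail C. U \<in> X \<or> (\<exists>T\<in>X. kills C U T)}"

text \<open>The split is by the number of support vertices on the conflict \<open>S\<close>. If they
  are too few for \<open>near_idx\<close>, then \<open>span_in_support\<close> leaves
  \<open>T\<close> as the only common edge and its vertices as the only common vertices; the size of
  \<open>S\<close> decides between the two main types.\<close>

lemma killer_cases:
  assumes cons: "consistent X Y" and C: "conflict_free C" "X \<subseteq> avail C" "Y \<subseteq> C"
    and U: "U \<in> avail C" "U \<notin> X" and T: "T \<in> X" "kills C U T"
  shows "U \<in> pair_idx X Y \<or> (\<exists>T S. (T, S, U) \<in> conf_idx X Y \<and> S - {T, U} \<subseteq> C)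
    \<or> (\<exists>T S. (T, S, U) \<in> near_idx X Y \<and> S - {T, U} \<subseteq> C)"
proof -
  obtain S where S: "conflict k S" "T \<in> S" "U \<in> S" "S \<subseteq> insert T (insert U C)"
    using T(2) by (auto simp: kills_def)
  have TU: "T \<noteq> U" using U T by auto
  have UC: "U \<notin> C" "U \<notin> Y" using U C(3) avail_disjoint by auto
  have XC: "X \<inter> C = {}" using C(2) avail_disjoint by auto
  have SX: "S \<inter> X = {T}" using S T(1) U(2) XC by auto
  have triv: "S \<subseteq> triples V"
    using S(4) T(1) U(1) C(1) consistentD(1)[OF cons] avail_subset[of C] by (auto simp: conflict_free_def)
  have SC: "S - {T, U} \<subseteq> C" using S by auto
  let ?W = "\<Union>(X \<union> Y)"
  have TW: "T \<subseteq> ?W" using T by auto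
  show ?thesis
  proof (cases "card (S \<inter> (X \<union> Y)) + 3 \<le> card (\<Union>S \<inter> ?W)")
    case True
    then have "(T, S, U) \<in> near_idx X Y" using S T triv TU SX UC by (auto simp: near_idx_def)
    with SC show ?thesis by blast
  next
    case False
    have "S \<inter> (X \<union> Y) \<subset> S" using S(3) U(2) UC by auto
    with False have "card (S \<inter> (X \<union> Y)) < 2" using span_in_support[OF cons S(1)] by linarith
    moreover have "finite (S \<inter> (X \<union> Y))" using conflict_card[OF S(1)] by auto
    ultimately have one: "card (S \<inter> (X \<union> Y)) = 1"
    proof -
      assume "card (S \<inter> (X \<union> Y)) < 2" "finite (S \<inter> (X \<union> Y))"
      moreover have "S \<inter> (X \<union> Y) \<noteq> {}" using S(2) T(1) by blast
      ultimately show ?thesis by (metis One_nat_def card_0_eq less_2_cases)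
    qed
    have "T = \<Union>S \<inter> ?W"
      using False one conflict_edge[OF S(1,2)] conflict_Union[OF S(1)] S(2) TW
      by (intro card_seteq) auto
    then have W: "\<Union>S \<inter> ?W = T" by simp
    show ?thesis
    proof (cases "3 \<le> card S")
      case True
      then have "(T, S, U) \<in> conf_idx X Y" using S T triv TU W by (auto simp: conf_idx_def)
      with SC show ?thesis by blast
    next
      case False
      then have "card S = 2" using conflict_card[OF S(1)] by simp
      then have S2: "S = {T, U}" using S TU by (metis card_2_iff doubleton_eq_iff insert_iff singletonD)
      have c4: "card (T \<union> U) = 4" using conflict_Union[OF S(1)] \<open>card S = 2\<close> S2 by simp
      have "card T = 3" "card U = 3" "finite T" "finite U"
        using conflict_edge[OF S(1)] S by blast+
      then have "card (U \<inter> T) = 2" using c4 card_Un_Int[of T U] by (simp add: Int_commute)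
      moreover have "U \<inter> ?W = U \<inter> T" using W S2 TW by auto
      ultimately have "U \<in> pair_idx X Y"
        using T U(1) avail_subset[of C] by (auto simp: pair_idx_def shadow_def)
      then show ?thesis by simp
    qed
  qed
qed

lemma lost_le:
  assumes cons: "consistent X Y" and C: "conflict_free C" "X \<subseteq> avail C" "Y \<subseteq> C"
  shows "card (lost X C) \<le> card X + card {U \<in> pair_idx X Y. U \<in> avail C}
    + card {(T, S, U). (T, S, U) \<in> conf_idx X Y \<and> U \<in> avail C \<and> S - {T, U} \<subseteq> C}
    + card {(T, S, U). (T, S, U) \<in> near_idx X Y \<and> S - {T, U} \<subseteq> C}"
    (is "_ \<le> _ + card ?A + card ?B + card ?D")
proof -
  let ?u = "\<lambda>i. snd (snd i)"
  have "?B \<subseteq> conf_idx X Y" "?D \<subseteq> near_idx X Y" by auto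
  then have fin: "finite X" "finite ?A" "finite ?B" "finite ?D"
    using finite_idx[OF cons] consistentD(4)[OF cons] finite_subset by auto
  have "lost X C \<subseteq> X \<union> ?A \<union> ?u ` ?B \<union> ?u ` ?D"
  proof
    fix U assume U: "U \<in> lost X C"
    show "U \<in> X \<union> ?A \<union> ?u ` ?B \<union> ?u ` ?D"
    proof (cases "U \<in> X")
      case False
      then obtain T where "T \<in> X" "kills C U T" using U by auto
      from killer_cases[OF cons C _ False this] U
      show ?thesis by (force simp: image_iff)
    qed simp
  qed
  then have "card (lost X C) \<le> card (X \<union> ?A \<union> ?u ` ?B \<union> ?u ` ?D)"
    using fin by (intro card_mono) auto
  also have "\<dots> \<le> card X + card ?A + card (?u ` ?B) + card (?u ` ?D)"
    by (meson add_le_mono1 card_Un_le le_trans)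
  also have "\<dots> \<le> card X + card ?A + card ?B + card ?D"
    using fin by (intro add_mono card_image_le) auto
  finally show ?thesis .
qed

lemma pair_idx_kills:
  assumes cons: "consistent X Y" and U: "U \<in> pair_idx X Y"
  shows "\<exists>T\<in>X. T \<noteq> U \<and> U \<inter> \<Union>(X \<union> Y) = T \<inter> U \<and> conflict k {T, U}"
proof -
  let ?W = "\<Union>(X \<union> Y)"
  obtain T where T: "T \<in> X" "U \<inter> ?W \<subseteq> T" "card (U \<inter> ?W) = 2"
    using U by (auto simp: pair_idx_def shadow_def)
  have c: "card T = 3" "card U = 3"
    using T U consistentD(1)[OF cons] tripleD by (auto simp: pair_idx_def)
  have ne: "T \<noteq> U"
  proof
    assume "T = U"
    then have "U \<inter> ?W = U" using T(1) by auto
    then show False using T(3) c by simp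
  qed
  have "conflict k {T, U}" by (rule conflict_pair[OF k_ge c ne T(2) _ T(3)]) auto
  moreover have "U \<inter> ?W = T \<inter> U" using T by auto
  ultimately show ?thesis using T ne by blast
qed

text \<open>Pair killers and conflict killers are disjoint because two edges of a larger conflict
  share at most one vertex. A conflict killer that is counted repeatedly is paid for by
  \<open>clash_idx\<close>.\<close>

lemma lost_ge:
  assumes cons: "consistent X Y" and C: "conflict_free C" "X \<subseteq> avail C" "Y \<subseteq> C"
  shows "card {U \<in> pair_idx X Y. U \<in> avail C}
    + card {(T, S, U). (T, S, U) \<in> conf_idx X Y \<and> U \<in> avail C \<and> S - {T, U} \<subseteq> C}
    \<le> card (lost X C) + card {((T, S, U), (T', S', U')). ((T, S, U), (T', S', U')) \<in> clash_idx X Y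
        \<and> S - {T, U} \<subseteq> C \<and> S' - {T', U'} \<subseteq> C}"
    (is "card ?A + card ?B \<le> _ + card ?D")
proof -
  let ?u = "\<lambda>i. snd (snd i)"
  have sub: "?B \<subseteq> conf_idx X Y" "?D \<subseteq> clash_idx X Y" by auto
  then have fin: "finite ?A" "finite ?B" "finite ?D"
    using finite_idx[OF cons] finite_subset by auto
  have disj: "?A \<inter> ?u ` ?B = {}"
  proof (rule ccontr)
    assume "\<not> ?thesis"
    then obtain T S U where U: "U \<in> pair_idx X Y" "(T, S, U) \<in> conf_idx X Y" by auto
    from U(2) have *: "conflict k S" "3 \<le> card S" "T \<in> S" "U \<in> S" "T \<noteq> U"
      "\<Union>S \<inter> \<Union>(X \<union> Y) = T" by (auto simp: conf_idx_def)
    have "card (U \<inter> \<Union>(X \<union> Y)) \<le> card (T \<inter> U)"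
    proof (rule card_mono)
      show "U \<inter> \<Union>(X \<union> Y) \<subseteq> T \<inter> U" using *(4,6) by blast
    qed (use conflict_edge[OF *(1,3)] in simp)
    also have "\<dots> \<le> 1" by (rule conflict_Int_le[OF *(1-5)])
    finally show False using U(1) by (auto simp: pair_idx_def shadow_def)
  qed
  have sublost: "?A \<union> ?u ` ?B \<subseteq> lost X C"
  proof
    fix U assume "U \<in> ?A \<union> ?u ` ?B"
    then consider "U \<in> ?A" | T S where "(T, S, U) \<in> ?B" by force
    then show "U \<in> lost X C"
    proof cases
      case 1
      then obtain T where "T \<in> X" "conflict k {T, U}" using pair_idx_kills[OF cons] by blast
      then have "kills C U T" unfolding kills_def by (intro exI[of _ "{T, U}"]) auto
      then show ?thesis using 1 \<open>T \<in> X\<close> by auto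
    next
      case 2
      then have "T \<in> X" "conflict k S" "T \<in> S" "U \<in> S" "S - {T, U} \<subseteq> C" "U \<in> avail C"
        by (simp_all add: conf_idx_def)
      moreover from this have "kills C U T" unfolding kills_def by (intro exI[of _ S]) auto
      ultimately have "T \<in> X" "kills C U T" "U \<in> avail C" by simp_all
      then show ?thesis by auto
    qed
  qed
  have "card ?B \<le> card (?u ` ?B) + card {(i, j). i \<in> ?B \<and> j \<in> ?B \<and> i \<noteq> j \<and> ?u i = ?u j}"
    by (rule card_le_image_plus_collisions[OF fin(2)])
  also have "card {(i, j). i \<in> ?B \<and> j \<in> ?B \<and> i \<noteq> j \<and> ?u i = ?u j} \<le> card ?D"
    by (intro card_mono[OF fin(3)]) (auto simp: clash_idx_def)
  finally have "card ?A + card ?B \<le> card ?A + card (?u ` ?B) + card ?D" by simp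
  also have "card ?A + card (?u ` ?B) = card (?A \<union> ?u ` ?B)"
    using fin disj by (intro card_Un_disjoint[symmetric]) auto
  also have "\<dots> \<le> card (lost X C)" using sublost finite_avail by (intro card_mono) auto
  finally show ?thesis by simp
qed

abbreviation gained :: "'a set set \<Rightarrow> 'a set set \<Rightarrow> 'a set set \<Rightarrow> 'a set \<Rightarrow> bool" where
  "gained X Y C c \<equiv> c \<in> avail C \<and> Y - {c} \<subseteq> C \<and> X \<subseteq> avail (insert c C)"

text \<open>The indicator can rise only when the proposal is the last missing member of
  \<open>Y\<close>, and can fall only when the proposal lies in \<open>X\<close> or kills a member
  of \<open>X\<close>.\<close>

lemma sum_ind_lazy_step:
  assumes cons: "consistent X Y" and C: "conflict_free C"
  shows "(\<Sum>U\<in>triples V. ind X Y (lazy_step C U) - ind X Y C)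
    = (\<Sum>c\<in>Y. of_bool (gained X Y C c)) - ind X Y C * real (card (lost X C))"
proof -
  have "ind X Y (lazy_step C U) - ind X Y C
      = of_bool (U \<in> Y \<and> gained X Y C U) - ind X Y C * of_bool (U \<in> lost X C)" for U
  proof (cases "U \<in> avail C")
    case True
    note av = avail_insert[OF True]
    have UC: "U \<notin> C" using True avail_disjoint by auto
    consider "X \<subseteq> avail C" "Y \<subseteq> C" | "\<not> (X \<subseteq> avail C \<and> Y \<subseteq> C)" "U \<in> Y"
      | "\<not> (X \<subseteq> avail C \<and> Y \<subseteq> C)" "U \<notin> Y" by blast
    then show ?thesis
    proof cases
      case 1
      then have "X \<subseteq> avail (insert U C) \<longleftrightarrow> U \<notin> lost X C" using av True by auto
      moreover have "U \<notin> Y" using 1 UC by auto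
      ultimately show ?thesis using 1 True UC by (auto simp: ind_def lazy_step_def)
    next
      case 2
      then have "Y \<subseteq> insert U C \<longleftrightarrow> Y - {U} \<subseteq> C" by auto
      then show ?thesis using 2 True by (auto simp: ind_def lazy_step_def)
    next
      case 3
      have "avail (insert U C) \<subseteq> avail C" using av by auto
      moreover have "Y \<subseteq> insert U C \<longleftrightarrow> Y \<subseteq> C" using 3 by auto
      ultimately have "\<not> (X \<subseteq> avail (insert U C) \<and> Y \<subseteq> insert U C)" using 3 by blast
      then show ?thesis using 3 True by (auto simp: ind_def lazy_step_def)
    qed
  qed (simp add: lazy_step_def)
  then have "(\<Sum>U\<in>triples V. ind X Y (lazy_step C U) - ind X Y C)
      = (\<Sum>U\<in>triples V. of_bool (U \<in> Y \<and> gained X Y C U))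
        - ind X Y C * (\<Sum>U\<in>triples V. of_bool (U \<in> lost X C))"
    by (simp only: sum_subtractf sum_distrib_left)
  also have "(\<Sum>U\<in>triples V. of_bool (U \<in> Y \<and> gained X Y C U)) 
      = (\<Sum>c\<in>Y. of_bool (gained X Y C c) :: real)"
    using consistentD(2)[OF cons] finite_trip by (intro sum.mono_neutral_cong_right) auto
  also have "(\<Sum>U\<in>triples V. of_bool (U \<in> lost X C)) = real (card (lost X C))"
  proof -
    have "{U \<in> triples V. U \<in> lost X C} = lost X C" using avail_subset by blast
    then show ?thesis using sum_of_bool_card[OF finite_trip, of "\<lambda>U. U \<in> lost X C"] by simp
  qed
  finally show ?thesis .
qed

text \<open>The left side asks for availability only before \<open>c\<close> is chosen. If
  \<open>c\<close> then kills some \<open>T\<close> in \<open>X\<close>, consistency keeps the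
  conflict from lying inside \<open>X \<union> Y\<close>. Its edges there are a proper subset
  containing \<open>T\<close> and \<open>c\<close>, so the vertex surplus puts it into
  \<open>gain_idx\<close>.\<close>

lemma gained_ge:
  assumes cons: "consistent X Y" and C: "conflict_free C" and c: "c \<in> Y"
  shows "ind (insert c X) (Y - {c}) C \<le> of_bool (gained X Y C c)
    + (\<Sum>(T, S, U)\<in>{i \<in> gain_idx X Y. snd (snd i) = c}. of_bool ((Y - {U}) \<union> (S - {T, U}) \<subseteq> C))"
    (is "_ \<le> _ + ?sum")
proof -
  have nn: "?sum \<ge> 0" by (intro sum_nonneg) auto
  show ?thesis
  proof (cases "insert c X \<subseteq> avail C \<and> Y - {c} \<subseteq> C \<and> \<not> gained X Y C c")
    case False
    then show ?thesis using nn by (auto simp: ind_def)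
  next
    case True
    then have av: "c \<in> avail C" "X \<subseteq> avail C" "Y - {c} \<subseteq> C" by auto
    have cX: "c \<notin> X" using c consistentD(3)[OF cons] by auto
    from True obtain T where T: "T \<in> X" "kills C c T" using avail_insert[OF av(1)] cX by auto
    then obtain S where S: "conflict k S" "T \<in> S" "c \<in> S" "S \<subseteq> insert T (insert c C)"
      by (auto simp: kills_def)
    have XC: "X \<inter> C = {}" using av(2) avail_disjoint by auto
    have SX: "S \<inter> X = {T}" using S T(1) cX XC by auto
    have triv: "S \<subseteq> triples V"
      using S(4) T(1) av(1) C(1) consistentD(1)[OF cons] avail_subset[of C] by (auto simp: conflict_free_def)
    have "\<not> S \<subseteq> X \<union> Y" using consistentD(6)[OF cons S(1)] SX by auto
    then have "S \<inter> (X \<union> Y) \<subset> S" by auto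
    moreover have "2 \<le> card (S \<inter> (X \<union> Y))"
    proof -
      have "card {T, c} \<le> card (S \<inter> (X \<union> Y))"
        using S c T conflict_card[OF S(1)] by (intro card_mono) auto
      moreover have "T \<noteq> c" using cX T by auto
      ultimately show ?thesis by simp
    qed
    ultimately have "(T, S, c) \<in> gain_idx X Y"
      using span_in_support[OF cons S(1)] S T c SX triv by (auto simp: gain_idx_def)
    moreover have "finite (gain_idx X Y)" by (rule finite_idx[OF cons])
    ultimately have "(case (T, S, c) of (T, S, U) \<Rightarrow> of_bool ((Y - {U}) \<union> (S - {T, U}) \<subseteq> C)) \<le> ?sum"
      by (intro member_le_sum) auto
    moreover have "(Y - {c}) \<union> (S - {T, c}) \<subseteq> C" using av S by auto
    ultimately show ?thesis by (auto simp: ind_def)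
  qed
qed

text \<open>The part of the increment that is again a combination of indicators \<open>ind\<close>,
  so that its expectation closes up into the hierarchy.\<close>

definition drift :: "'a set set \<Rightarrow> 'a set set \<Rightarrow> 'a set set \<Rightarrow> real" where
  "drift X Y C = (\<Sum>c\<in>Y. ind (insert c X) (Y - {c}) C) - (\<Sum>U\<in>pair_idx X Y. ind (insert U X) Y C)
    - (\<Sum>(T, S, U)\<in>conf_idx X Y. ind (insert U X) (Y \<union> (S - {T, U})) C)"

text \<open>Availability requirements are dropped, since only chosen triples supply powers of
  1/n.\<close>

definition drift_error :: "'a set set \<Rightarrow> 'a set set \<Rightarrow> 'a set set \<Rightarrow> real" where
  "drift_error X Y C = real (card X) * of_bool (Y \<subseteq> C)
    + (\<Sum>(T, S, U)\<in>near_idx X Y. of_bool (Y \<union> (S - {T, U}) \<subseteq> C))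
    + (\<Sum>((T, S, U), (T', S', U'))\<in>clash_idx X Y.
         of_bool (Y \<union> (S - {T, U} \<union> (S' - {T', U'})) \<subseteq> C))
    + (\<Sum>(T, S, U)\<in>gain_idx X Y. of_bool ((Y - {U}) \<union> (S - {T, U}) \<subseteq> C))"

lemma drift_approx:
  assumes cons: "consistent X Y" and C: "conflict_free C"
  shows "\<bar>(\<Sum>U\<in>triples V. ind X Y (lazy_step C U) - ind X Y C) - drift X Y C\<bar> \<le> drift_error X Y C"
proof -
  let ?near = "\<Sum>(T, S, U)\<in>near_idx X Y. of_bool (Y \<union> (S - {T, U}) \<subseteq> C) :: real"
  let ?clash = "\<Sum>((T, S, U), (T', S', U'))\<in>clash_idx X Y.
         of_bool (Y \<union> (S - {T, U} \<union> (S' - {T', U'})) \<subseteq> C) :: real"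
  let ?gain = "\<Sum>(T, S, U)\<in>gain_idx X Y. of_bool ((Y - {U}) \<union> (S - {T, U}) \<subseteq> C) :: real"
  let ?pair = "\<Sum>U\<in>pair_idx X Y. ind (insert U X) Y C"
  let ?conf = "\<Sum>(T, S, U)\<in>conf_idx X Y. ind (insert U X) (Y \<union> (S - {T, U})) C"
  note fin = finite_idx[OF cons] 
  have nn: "?near \<ge> 0" "?clash \<ge> 0" "?gain \<ge> 0" by (auto intro!: sum_nonneg)
  have g1: "(\<Sum>c\<in>Y. of_bool (gained X Y C c)) \<le> (\<Sum>c\<in>Y. ind (insert c X) (Y - {c}) C)"
    using avail_insert by (intro sum_mono) (fastforce simp: ind_def)
  have "(\<Sum>c\<in>Y. ind (insert c X) (Y - {c}) C) \<le> (\<Sum>c\<in>Y. of_bool (gained X Y C c)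
    + (\<Sum>(T, S, U)\<in>{i \<in> gain_idx X Y. snd (snd i) = c}. of_bool ((Y - {U}) \<union> (S - {T, U}) \<subseteq> C)))"
    by (intro sum_mono gained_ge[OF cons C])
  also have "\<dots> = (\<Sum>c\<in>Y. of_bool (gained X Y C c)) + (\<Sum>c\<in>Y.
     (\<Sum>(T, S, U)\<in>{i \<in> gain_idx X Y. snd (snd i) = c}. of_bool ((Y - {U}) \<union> (S - {T, U}) \<subseteq> C)))"
    by (rule sum.distrib)
  also have "(\<Sum>c\<in>Y. (\<Sum>(T, S, U)\<in>{i \<in> gain_idx X Y. snd (snd i) = c}.
      of_bool ((Y - {U}) \<union> (S - {T, U}) \<subseteq> C))) = ?gain"
    using fin consistentD(5)[OF cons] by (intro sum.group) (auto simp: gain_idx_def)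
  finally have g2: "(\<Sum>c\<in>Y. ind (insert c X) (Y - {c}) C)
      \<le> (\<Sum>c\<in>Y. of_bool (gained X Y C c)) + ?gain" .
  have loss: "\<bar>ind X Y C * real (card (lost X C)) - (?pair + ?conf)\<bar>
      \<le> real (card X) * of_bool (Y \<subseteq> C) + ?near + ?clash"
  proof (cases "X \<subseteq> avail C \<and> Y \<subseteq> C")
    case False
    \<comment> \<open>Every main loss term demands at least \<open>X\<close> and \<open>Y\<close>,
      so all of them vanish together.\<close>
    then have 0: "ind X' Y' C = 0" if "X \<subseteq> X'" "Y \<subseteq> Y'" for X' Y' using that by (auto simp: ind_def)
    have "?pair = 0" "?conf = 0" "ind X Y C = 0"
      by (auto intro!: sum.neutral 0)
    then show ?thesis using nn by simp
  next
    case True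
    then have X: "X \<subseteq> avail C" "Y \<subseteq> C" by auto
    have *: "card (lost X C) \<le> card X + card {U \<in> pair_idx X Y. U \<in> avail C}
    + card {i \<in> conf_idx X Y. case i of (T, S, U) \<Rightarrow> U \<in> avail C \<and> S - {T, U} \<subseteq> C}
    + card {i \<in> near_idx X Y. case i of (T, S, U) \<Rightarrow> S - {T, U} \<subseteq> C}"
      using lost_le[OF cons C X] by (simp add: case_prod_unfold)
    have **: "card {U \<in> pair_idx X Y. U \<in> avail C}
    + card {i \<in> conf_idx X Y. case i of (T, S, U) \<Rightarrow> U \<in> avail C \<and> S - {T, U} \<subseteq> C}
    \<le> card (lost X C) + card {i \<in> clash_idx X Y. case i of ((T, S, U), (T', S', U')) \<Rightarrow>
        S - {T, U} \<subseteq> C \<and> S' - {T', U'} \<subseteq> C}"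
      using lost_ge[OF cons C X] by (simp add: case_prod_unfold)
    have 1: "?pair = card {U \<in> pair_idx X Y. U \<in> avail C}"
      unfolding sum_of_bool_card[OF fin(1), symmetric]
      using X by (intro sum.cong) (auto simp: ind_def)
    have 2: "?conf = card {i \<in> conf_idx X Y. case i of (T, S, U) \<Rightarrow> U \<in> avail C \<and> S - {T, U} \<subseteq> C}"
      unfolding sum_of_bool_card[OF fin(2), symmetric]
      using X by (intro sum.cong) (auto simp: ind_def)
    have 3: "?near = card {i \<in> near_idx X Y. case i of (T, S, U) \<Rightarrow> S - {T, U} \<subseteq> C}"
      unfolding sum_of_bool_card[OF fin(3), symmetric]
      using X by (intro sum.cong) auto
    have 4: "?clash = card {i \<in> clash_idx X Y. case i of ((T, S, U), (T', S', U')) \<Rightarrow>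
        S - {T, U} \<subseteq> C \<and> S' - {T', U'} \<subseteq> C}"
      unfolding sum_of_bool_card[OF fin(4), symmetric]
      using X by (intro sum.cong) auto
    have "ind X Y C = 1" using X by (simp add: ind_def)
    then show ?thesis using * ** X unfolding 1 2 3 4 by simp
  qed
  show ?thesis
    unfolding sum_ind_lazy_step[OF cons C] drift_def drift_error_def
    using loss g1 g2 nn by linarith
qed

section \<open>Consistency of the enlarged pairs\<close>

lemma conflict_minimal: "conflict k S \<Longrightarrow> conflict k S' \<Longrightarrow> S' \<subseteq> S \<Longrightarrow> S' = S"
  by (auto simp: conflict_def erdos_configuration_def psubset_eq)

lemma conflict_span_ge:
  assumes "conflict k S" "B \<subset> S" "B \<noteq> {}"
  shows "card B + 2 \<le> card (\<Union>B)" "2 \<le> card B \<Longrightarrow> card B + 3 \<le> card (\<Union>B)"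
  using assms erdos_span_nonempty[of S B] conflict_span[of S B] by (auto simp: conflict_def)

text \<open>The error comparison covers consistent pairs only, so the pairs produced by the drift
  must be consistent again.\<close>

lemma consistent_extend:
  assumes cons: "consistent X Y" and T: "T \<in> X"
    and S: "conflict k S" "S \<subseteq> triples V" "T \<in> S" "U \<in> S" "T \<noteq> U" "\<Union>S \<inter> \<Union>(X \<union> Y) = T"
  shows "consistent (insert U X) (Y \<union> (S - {T, U}))" "U \<notin> X" "U \<notin> Y" "(S - {T, U}) \<inter> Y = {}"
proof -
  let ?W = "\<Union>(X \<union> Y)" and ?A = "S - {T}"
  note cD = consistentD[OF cons]
  have fT: "finite T" "card T = 3" using conflict_edge[OF S(1,3)] by auto
  have edge: "E = T" if "E \<in> S" "E \<in> X \<union> Y" for E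
  proof -
    have "E \<subseteq> T" using that S(6) by blast
    then show ?thesis using conflict_edge[OF S(1) that(1)] fT by (intro card_subset_eq) auto
  qed
  have TY: "T \<notin> Y" using T cD(3) by auto
  show UX: "U \<notin> X" and UY: "U \<notin> Y" and SY: "(S - {T, U}) \<inter> Y = {}"
    using edge S(4,5) TY by blast+
  show "consistent (insert U X) (Y \<union> (S - {T, U}))"
    unfolding consistent_def
  proof (intro conjI allI impI)
    show "insert U X \<subseteq> triples V" "Y \<union> (S - {T, U}) \<subseteq> triples V" using cD S by auto
    show "insert U X \<inter> (Y \<union> (S - {T, U})) = {}" using cD(3) UY edge by blast
    \<comment> \<open>A violating \<open>S'\<close> would split into an old and a new part that share at most the vertices of \<open>T\<close>,
      but then the two parts span too many vertices.\<close>
    fix S' assume S': "conflict k S'" "S' \<subseteq> insert U X \<union> (Y \<union> (S - {T, U}))"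
    have finS': "finite S'" using conflict_card[OF S'(1)] by simp
    show "2 \<le> card (S' \<inter> insert U X)"
    proof (rule ccontr)
      assume small: "\<not> ?thesis"
      have two: False if "E \<in> S' \<inter> insert U X" "E' \<in> S' \<inter> insert U X" "E \<noteq> E'" for E E'
      proof -
        have "card {E, E'} \<le> card (S' \<inter> insert U X)" using that finS' by (intro card_mono) auto
        then show False using small that(3) by simp
      qed
      define B where "B = S' \<inter> ?A"
      define B0 where "B0 = S' \<inter> (X \<union> Y)"
      have S'_eq: "S' = B \<union> B0" using S' S(4,5) UX UY unfolding B_def B0_def by blast
      have dB: "B \<inter> B0 = {}" using edge unfolding B_def B0_def by blast
      have finB: "finite B" "finite B0" using finS' by (auto simp: B_def B0_def)
      have BS: "B \<subset> S" using S(3) by (auto simp: B_def)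
      have ne: "B \<noteq> {}" "B0 \<noteq> {}"
      proof -
        show "B \<noteq> {}"
        proof
          assume "B = {}"
          then have "S' \<subseteq> X \<union> Y" using S'_eq by (auto simp: B0_def)
          then have "2 \<le> card (S' \<inter> X)" by (rule cD(6)[OF S'(1)])
          also have "\<dots> \<le> card (S' \<inter> insert U X)" using finS' by (intro card_mono) auto
          finally show False using small by simp
        qed
        show "B0 \<noteq> {}"
        proof
          assume "B0 = {}"
          then have "S' \<subset> S" using S'_eq BS by auto
          then show False using conflict_minimal[OF S(1) S'(1)] by auto
        qed
      qed
      have pr: "B \<subset> S'" "B0 \<subset> S'" using S'_eq dB ne by blast+
      define I where "I = \<Union>B \<inter> \<Union>B0"
      have I: "I \<subseteq> T" using S(6) BS by (auto simp: I_def B0_def B_def)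
      have cS: "card S' = card B + card B0" using S'_eq dB finB by (simp add: card_Un_disjoint)
      have finU: "finite (\<Union>B)" "finite (\<Union>B0)"
      proof -
        have "\<Union>B \<subseteq> \<Union>S'" "\<Union>B0 \<subseteq> \<Union>S'" using pr by blast+
        then show "finite (\<Union>B)" "finite (\<Union>B0)"
          using conflict_Union(1)[OF S'(1)] finite_subset by blast+
      qed
      have "\<Union>S' = \<Union>B \<union> \<Union>B0" using S'_eq by auto
      \<comment> \<open>\<open>S'\<close> spans two more vertices than it has edges, so the
        surpluses of its two parts add up to \<open>2 + card I\<close>. This is contradicted below:
        a part with at least two edges has surplus at least 3, a single edge has surplus 2, and
        \<open>card I\<close> is at most 3.\<close>
      then have sp: "card B + card B0 + 2 + card I = card (\<Union>B) + card (\<Union>B0)"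
        using card_Un_Int[OF finU] conflict_Union(2)[OF S'(1)] cS by (simp add: I_def)
      note spB = conflict_span_ge[OF S'(1) pr(1) ne(1)] conflict_span_ge[OF S'(1) pr(2) ne(2)]
      have I3: "card I \<le> 3" using card_mono[OF fT(1) I] fT by simp
      have cpos: "card B \<noteq> 0" "card B0 \<noteq> 0" using ne finB by auto
      have lt3: "card (Q \<inter> T) \<le> 2" if "Q \<noteq> T" "card Q = 3" "finite Q" for Q
        using card_Un_triples_ge[of Q T] card_Un_Int[of Q T] that fT by force
      show False
      proof (cases "2 \<le> card B")
        case True
        show False
        proof (cases "2 \<le> card B0")
          case True
          with \<open>2 \<le> card B\<close> show False using spB sp I3 by linarith
        next
          case False
          then have "card B0 = 1" using cpos by linarith
          then obtain E where E: "B0 = {E}" by (auto simp: card_1_singleton_iff)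
          have "E \<in> S'" using E S'_eq by auto
          note E3 = conflict_edge[OF S'(1) this]
          show False
          proof (cases "E = T")
            case True
            \<comment> \<open>If the old part is \<open>T\<close> alone, minimality gives
              \<open>S' = S\<close>, which contains two members of the enlarged
              \<open>X\<close>.\<close>
            then have "S' \<subseteq> S" using S'_eq E BS S(3) by auto
            then have "S' = S" by (rule conflict_minimal[OF S(1) S'(1)])
            then show False using two[of T U] T S by auto
          next
            case False
            have "I \<subseteq> E \<inter> T" using I E by (auto simp: I_def)
            then have "card I \<le> card (E \<inter> T)" using fT by (intro card_mono) auto
            then have "card I \<le> 2" using lt3[OF False E3] by simp
            moreover have "card (\<Union>B0) = 3" using E E3 by simp
            ultimately show False using spB(2)[OF \<open>2 \<le> card B\<close>] sp \<open>card B0 = 1\<close> by linarith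
          qed
        qed
      next
        case False
        then have B1: "card B = 1" using cpos by linarith
        then obtain E where E: "B = {E}" by (auto simp: card_1_singleton_iff)
        have E': "E \<in> S'" "E \<in> S" "E \<noteq> T" using E by (auto simp: B_def)
        note E3 = conflict_edge[OF S'(1) E'(1)]
        have IE: "I \<subseteq> E \<inter> T" using I E by (auto simp: I_def)
        then have "card I \<le> card (E \<inter> T)" using fT by (intro card_mono) auto
        then have I2: "card I \<le> 2" using lt3[OF E'(3) E3] by simp
        have UB: "card (\<Union>B) = 3" using E E3 by simp
        show False
        proof (cases "2 \<le> card B0")
          case True
          then show False using spB(4) sp UB I2 B1 by linarith
        next
          case False
          then have B01: "card B0 = 1" using cpos by linarith
          then obtain F where F: "B0 = {F}" by (auto simp: card_1_singleton_iff)
          have F': "F \<in> S'" "F \<in> X \<union> Y" using F by (auto simp: B0_def)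
          note F3 = conflict_edge[OF S'(1) F'(1)]
          have UB0: "card (\<Union>B0) = 3" using F F3 by simp
          have cI: "card I = 2" using sp B1 B01 UB UB0 by simp
          \<comment> \<open>Both parts are now single edges meeting in a pair inside
            \<open>T\<close>, which a larger conflict \<open>S\<close> does not allow.\<close>
          have "\<not> 3 \<le> card S"
          proof
            assume "3 \<le> card S"
            then have "card (T \<inter> E) \<le> 1" using conflict_Int_le[OF S(1) _ S(3) E'(2)] E'(3) by simp
            moreover have "card I \<le> card (T \<inter> E)" using IE fT by (intro card_mono) auto
            ultimately show False using cI by simp
          qed
          then have "card S = 2" using conflict_card(1)[OF S(1)] by simp
          moreover have "{T, U} \<subseteq> S" "card {T, U} = 2" using S by auto
          ultimately have "S = {T, U}" using conflict_card(4)[OF S(1)] by (metis card_subset_eq)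
          then have EU: "E = U" using E' by auto
          show False
          proof (cases "F \<in> X")
            case True
            then show False using two[of F U] F' E' EU UX by auto
          next
            case False
            then have FY: "F \<in> Y" using F' by auto
            have FT: "F \<noteq> T" using FY TY by auto
            have "I \<subseteq> F" "I \<subseteq> T" using I F by (auto simp: I_def)
            \<comment> \<open>A member of \<open>Y\<close> sharing a pair with a member of
              \<open>X\<close> contradicts the consistency of the old pair.\<close>
            then have "conflict k {F, T}"
              using conflict_pair[OF k_ge F3(1) fT(2) FT _ _ cI] by simp
            then have "2 \<le> card ({F, T} \<inter> X)" using FY T by (intro cD(6)) auto
            also have "{F, T} \<inter> X = {T}" using T False by auto
            finally show False by simp
          qed
        qed
      qed
    qed
  qed
qed

lemma pair_idx_extend:
  assumes cons: "consistent X Y" and U: "U \<in> pair_idx X Y"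
  shows "consistent (insert U X) Y" "U \<notin> X"
proof -
  obtain T where T: "T \<in> X" "T \<noteq> U" "U \<inter> \<Union>(X \<union> Y) = T \<inter> U" "conflict k {T, U}"
    using pair_idx_kills[OF assms] by auto
  have "T \<in> triples V" "U \<in> triples V" using T U consistentD(1)[OF cons] by (auto simp: pair_idx_def)
  moreover have "\<Union>{T, U} \<inter> \<Union>(X \<union> Y) = T" using T by auto
  ultimately have "consistent (insert U X) (Y \<union> ({T, U} - {T, U}))" "U \<notin> X"
    using consistent_extend[OF cons T(1,4), of U] T by auto
  then show "consistent (insert U X) Y" "U \<notin> X" by simp_all
qed

lemma conf_idx_extend:
  assumes cons: "consistent X Y" and i: "(T, S, U) \<in> conf_idx X Y"
  shows "consistent (insert U X) (Y \<union> (S - {T, U}))" "U \<notin> X"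
    "card (Y \<union> (S - {T, U})) = card Y + (card S - 2)" "3 \<le> card S" "card S \<le> k" "card (T \<inter> U) \<le> 1"
proof -
  have *: "T \<in> X" "conflict k S" "S \<subseteq> triples V" "T \<in> S" "U \<in> S" "T \<noteq> U"
    "\<Union>S \<inter> \<Union>(X \<union> Y) = T" "3 \<le> card S" using i by (auto simp: conf_idx_def)
  note ext = consistent_extend[OF cons *(1-7)]
  show "consistent (insert U X) (Y \<union> (S - {T, U}))" "U \<notin> X" "3 \<le> card S" "card S \<le> k"
    using ext * conflict_card(2) by auto
  show "card (T \<inter> U) \<le> 1" by (rule conflict_Int_le[OF *(2,8,4,5,6)])
  have "card (S - {T, U}) = card S - 2"
    using * conflict_card(4)[OF *(2)] by (simp add: card_Diff_subset)
  then show "card (Y \<union> (S - {T, U})) = card Y + (card S - 2)"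
    using ext(4) consistentD(5)[OF cons] conflict_card(4)[OF *(2)]
    by (subst card_Un_disjoint) auto
qed

text \<open>Moving a triple from \<open>Y\<close> to \<open>X\<close> leaves the union unchanged and
  can only enlarge intersections with \<open>X\<close>.\<close>

lemma chosen_extend:
  assumes cons: "consistent X Y" and c: "c \<in> Y"
  shows "consistent (insert c X) (Y - {c})" "c \<notin> X"
proof -
  note cD = consistentD[OF cons]
  show cX: "c \<notin> X" using cD(3) c by auto
  show "consistent (insert c X) (Y - {c})"
    unfolding consistent_def
  proof (intro conjI allI impI)
    show "insert c X \<subseteq> triples V" "Y - {c} \<subseteq> triples V" using cD c by auto
    show "insert c X \<inter> (Y - {c}) = {}" using cD(3) by auto
    fix S assume S: "conflict k S" "S \<subseteq> insert c X \<union> (Y - {c})"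
    then have "2 \<le> card (S \<inter> X)" using c by (intro cD(6)) auto
    also have "\<dots> \<le> card (S \<inter> insert c X)" using conflict_card(4)[OF S(1)] by (intro card_mono) auto
    finally show "2 \<le> card (S \<inter> insert c X)" .
  qed
qed

section \<open>Growth of the shadow\<close>

lemma finite_shadow: "consistent X Y \<Longrightarrow> finite (shadow X)"
  by (rule finite_subset[of _ "Pow V"])
    (use finite_V consistentD(1)[of X Y] in \<open>auto simp: shadow_def triples_def\<close>)

lemma card_pairs: "T \<in> triples V \<Longrightarrow> card {e. e \<subseteq> T \<and> card e = 2} = 3"
  using tripleD[of T] by (simp add: n_subsets choose_two)

lemma card_shadow_le:
  assumes "consistent X Y" shows "card (shadow X) \<le> 3 * card X"
proof -
  have "shadow X = (\<Union>T\<in>X. {e. e \<subseteq> T \<and> card e = 2})" by (auto simp: shadow_def)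
  then have "card (shadow X) \<le> (\<Sum>T\<in>X. card {e. e \<subseteq> T \<and> card e = 2})"
    using card_UN_le[OF consistentD(4)[OF assms]] by simp
  also have "\<dots> = (\<Sum>T\<in>X. 3)"
    using consistentD(1)[OF assms] card_pairs by (intro sum.cong) auto
  finally show ?thesis by simp
qed

lemma card_shadow_insert:
  assumes cons: "consistent X Y" and U: "U \<in> triples V"
  shows "card (shadow (insert U X)) + card {e \<in> shadow X. e \<subseteq> U} = card (shadow X) + 3"
proof -
  have "shadow (insert U X) = shadow X \<union> {e. e \<subseteq> U \<and> card e = 2}" by (auto simp: shadow_def)
  moreover have "{e \<in> shadow X. e \<subseteq> U} = shadow X \<inter> {e. e \<subseteq> U \<and> card e = 2}"
    by (auto simp: shadow_def)
  moreover have "finite {e. e \<subseteq> U \<and> card e = 2}" using tripleD(3)[OF U] by simp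
  ultimately show ?thesis
    using card_Un_Int[OF finite_shadow[OF cons], of "{e. e \<subseteq> U \<and> card e = 2}"] card_pairs[OF U]
    by simp
qed

lemma shadow_subset_support: "e \<in> shadow X \<Longrightarrow> e \<subseteq> \<Union>(X \<union> Y)"
  by (auto simp: shadow_def)

text \<open>\<open>U\<close> meets the support in exactly one pair, which is already in the shadow,
  so two pairs are new. This gives the exponent \<open>b + 2\<close> in
  \<open>lim_drift\<close>.\<close>

lemma card_shadow_pair:
  assumes cons: "consistent X Y" and U: "U \<in> pair_idx X Y"
  shows "card (shadow (insert U X)) = card (shadow X) + 2"
proof -
  let ?e = "U \<inter> \<Union>(X \<union> Y)"
  have e: "?e \<in> shadow X" "U \<in> triples V" using U by (auto simp: pair_idx_def)
  have "{e \<in> shadow X. e \<subseteq> U} = {?e}"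
  proof (intro set_eqI iffI)
    fix e assume "e \<in> {e \<in> shadow X. e \<subseteq> U}"
    then have *: "e \<subseteq> ?e" "card e = 2" using shadow_subset_support[of e X Y] by (auto simp: shadow_def)
    moreover have "card ?e = 2" using e by (simp add: shadow_def)
    moreover have "finite ?e" using tripleD(3)[OF e(2)] by simp
    ultimately have "e = ?e" by (intro card_subset_eq) auto
    then show "e \<in> {?e}" by simp
  qed (use e in auto)
  then show ?thesis using card_shadow_insert[OF cons e(2)] by simp
qed

text \<open>Only vertices of \<open>T\<close> can lie both on \<open>U\<close> and in the support,
  and there is at most one of them, so all three pairs are new.\<close>

lemma card_shadow_conf:
  assumes cons: "consistent X Y" and i: "(T, S, U) \<in> conf_idx X Y"
  shows "card (shadow (insert U X)) = card (shadow X) + 3"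
proof -
  have *: "T \<in> X" "conflict k S" "S \<subseteq> triples V" "T \<in> S" "U \<in> S" 
    "\<Union>S \<inter> \<Union>(X \<union> Y) = T" using i by (auto simp: conf_idx_def)
  have "{e \<in> shadow X. e \<subseteq> U} = {}"
  proof (rule ccontr)
    assume "\<not> ?thesis"
    then obtain e where e: "e \<in> shadow X" "e \<subseteq> U" by auto
    have "e \<subseteq> T \<inter> U" using e shadow_subset_support[of e X Y] *(5,6) by blast
    then have "card e \<le> card (T \<inter> U)" using conflict_edge[OF *(2,4)] by (intro card_mono) auto
    then show False using conf_idx_extend(6)[OF assms] e by (simp add: shadow_def)
  qed
  then have "card {e \<in> shadow X. e \<subseteq> U} = 0" by (simp only: card.empty)
  then show ?thesis using card_shadow_insert[OF cons, of U] * by auto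
qed

text \<open>A pair common to \<open>c\<close> and some \<open>T\<close> in \<open>X\<close> would
  make \<open>{T, c}\<close> a conflict with a single edge in \<open>X\<close>, against
  consistency.\<close>

lemma card_shadow_chosen:
  assumes cons: "consistent X Y" and c: "c \<in> Y"
  shows "card (shadow (insert c X)) = card (shadow X) + 3"
proof -
  note cD = consistentD[OF cons]
  have "{e \<in> shadow X. e \<subseteq> c} = {}"
  proof (rule ccontr)
    assume "\<not> ?thesis"
    then obtain e T where e: "e \<subseteq> T" "e \<subseteq> c" "card e = 2" "T \<in> X" by (auto simp: shadow_def)
    have "T \<noteq> c" "T \<notin> Y" "c \<notin> X" using e c cD(3) by auto
    then have "conflict k {T, c}"
      using e c cD(1,2) by (intro conflict_pair[OF k_ge _ _ _ e(1,2,3)] tripleD) auto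
    then have "2 \<le> card ({T, c} \<inter> X)" using e c by (intro cD(6)) auto
    also have "{T, c} \<inter> X = {T}" using e \<open>c \<notin> X\<close> by auto
    finally show False by simp
  qed
  then have "card {e \<in> shadow X. e \<subseteq> c} = 0" by (simp only: card.empty)
  then show ?thesis using card_shadow_insert[OF cons, of c] c cD(2) by auto
qed

end

text \<open>There are at most n^s vertex sets of size s, which cancels the weight n^(-s); each size
  from 0 to \<open>r\<close> thus contributes at most \<open>c\<close>.\<close>

lemma sum_inverse_power_support_le:
  fixes vt :: "'i \<Rightarrow> 'a set"
  assumes fin: "finite I" "finite V" and pos: "0 < card V"
    and vt: "\<And>i. i \<in> I \<Longrightarrow> vt i \<subseteq> V \<and> card (vt i) \<le> r"
    and fibre: "\<And>Z. finite Z \<Longrightarrow> card Z \<le> r \<Longrightarrow> card {i \<in> I. vt i = Z} \<le> c"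
  shows "(\<Sum>i\<in>I. (1 / real (card V)) ^ card (vt i)) \<le> real ((r + 1) * c)"
proof -
  let ?n = "real (card V)" and ?g = "\<lambda>Z. (1 / real (card V)) ^ card Z"
  let ?Z = "{Z. Z \<subseteq> V \<and> card Z \<le> r}"
  have finZ: "finite ?Z" using fin(2) by simp
  have "(\<Sum>i\<in>I. ?g (vt i)) = (\<Sum>Z\<in>?Z. \<Sum>i\<in>{i \<in> I. vt i = Z}. ?g (vt i))"
    using fin finZ vt by (intro sum.group[symmetric]) auto
  also have "\<dots> = (\<Sum>Z\<in>?Z. real (card {i \<in> I. vt i = Z}) * ?g Z)"
    by (intro sum.cong) auto
  also have "\<dots> \<le> (\<Sum>Z\<in>?Z. real c * ?g Z)"
    using fibre fin(2) finite_subset by (intro sum_mono mult_right_mono) auto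
  also have "\<dots> = (\<Sum>s\<in>{..r}. \<Sum>Z\<in>{Z \<in> ?Z. card Z = s}. real c * ?g Z)"
    using finZ by (intro sum.group[symmetric]) auto
  also have "\<dots> \<le> (\<Sum>s\<in>{..r}. real c)"
  proof (rule sum_mono)
    fix s assume s: "s \<in> {..r}"
    have eq: "{Z \<in> ?Z. card Z = s} = {Z. Z \<subseteq> V \<and> card Z = s}" using s by auto
    have "(\<Sum>Z\<in>{Z \<in> ?Z. card Z = s}. real c * ?g Z) = real (card V choose s) * (real c * (1 / ?n) ^ s)"
      unfolding eq by (simp add: n_subsets[OF fin(2)])
    also have "\<dots> \<le> ?n ^ s * (real c * (1 / ?n) ^ s)"
    proof (rule mult_right_mono)
      show "real (card V choose s) \<le> ?n ^ s"
        using binomial_le_pow[of s "card V"] by (cases "s \<le> card V") (auto simp: binomial_eq_0 simp flip: of_nat_power)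
    qed simp
    also have "\<dots> = real c" using pos by (simp add: power_one_over)
    finally show "(\<Sum>Z\<in>{Z \<in> ?Z. card Z = s}. real c * ?g Z) \<le> real c" .
  qed
  finally show ?thesis by (simp add: algebra_simps)
qed

text \<open>A crude bound for the number of index triples (edge, conflict, edge) on \<open>z\<close>
  vertices, counting arbitrary subsets and set families.\<close>

definition triple_count :: "nat \<Rightarrow> nat" where
  "triple_count z = 2 ^ z * (2 ^ 2 ^ z * 2 ^ z)"

text \<open>The summand \<open>real m\<close> is for proposals inside \<open>X\<close>, the factor 3
  for the near, clash and gain sums. Two conflicts have at most \<open>2 * k + 4\<close> vertices
  off the support, hence \<open>2 * k + 5\<close> possible sizes; the support has at most
  \<open>3 * m\<close> vertices; the square allows for pairs of indices.\<close>

definition err_const :: "nat \<Rightarrow> nat \<Rightarrow> real \<Rightarrow> real" where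
  "err_const k m \<sigma> = \<sigma> ^ (m + 2 * k) *
     (real m + 3 * real ((2 * k + 5) * (triple_count (3 * m + 2 * k + 4))\<^sup>2))"

section \<open>Bounding the drift error\<close>

context lazy_process
begin

lemma card_index_le:
  assumes "finite Q" "card Q \<le> z" "I \<subseteq> Pow Q \<times> Pow (Pow Q) \<times> Pow Q"
  shows "card I \<le> triple_count z"
proof -
  have "card I \<le> card (Pow Q \<times> Pow (Pow Q) \<times> Pow Q)"
    using assms by (intro card_mono) auto
  also have "\<dots> = 2 ^ card Q * (2 ^ 2 ^ card Q * 2 ^ card Q)"
    using assms(1) by (simp add: card_cartesian_product card_Pow)
  also have "\<dots> \<le> triple_count z"
    unfolding triple_count_def using assms(2) by (intro mult_le_mono power_increasing) auto
  finally show ?thesis .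
qed

lemma card_support_le:
  assumes "consistent X Y" shows "card (\<Union>(X \<union> Y)) \<le> 3 * (card X + card Y)"
proof -
  note cD = consistentD[OF assms]
  have "card (\<Union>(X \<union> Y)) \<le> (\<Sum>T\<in>X \<union> Y. card T)"
    using card_UN_le[of "X \<union> Y" "\<lambda>T. T"] cD by simp
  also have "\<dots> = (\<Sum>T\<in>X \<union> Y. 3)" using cD tripleD(1) by (intro sum.cong) auto
  also have "\<dots> = 3 * (card X + card Y)" using cD by (simp add: card_Un_disjoint)
  finally show ?thesis .
qed

text \<open>The rescaling uses up \<open>y\<close> of the prescribed triples, and each of the other
  \<open>v\<close> still yields a factor 1/n.\<close>

lemma ev_weight_le:
  assumes "finite R" "1 \<le> \<sigma>" "real u * (real (card V) / M) \<le> \<sigma>" "card R \<le> l" "y + v \<le> card R"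
  shows "real (card V) ^ y * ev u (\<lambda>C. of_bool (R \<subseteq> C)) \<le> \<sigma> ^ l * (1 / real (card V)) ^ v"
proof -
  let ?n = "real (card V)"
  have n: "?n \<ge> 1" using card_V_ge by simp
  have "?n ^ y * ev u (\<lambda>C. of_bool (R \<subseteq> C)) \<le> ?n ^ y * (\<sigma> ^ l * (1 / ?n) ^ card R)"
    using ev_chosen_le_scaled[OF assms(1-4)] by (intro mult_left_mono) auto
  also have "\<dots> \<le> ?n ^ y * (\<sigma> ^ l * (1 / ?n) ^ (y + v))"
    using assms n by (intro mult_left_mono power_decreasing) auto
  also have "\<dots> = \<sigma> ^ l * (1 / ?n) ^ v" using n by (simp add: power_add power_one_over)
  finally show ?thesis .
qed

abbreviation anchored :: "'a set set \<Rightarrow> 'a set \<times> 'a set set \<times> 'a set \<Rightarrow> bool" where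
  "anchored X i \<equiv> fst i \<in> X \<and> fst i \<in> fst (snd i) \<and> snd (snd i) \<in> fst (snd i) \<and>
     conflict k (fst (snd i)) \<and> fst (snd i) \<subseteq> triples V"

text \<open>Each term prescribes at least as many additional chosen triples as it has vertices off
  the support, so the probability pays for the choice of these vertices and the sum stays bounded in
  n. Mapping into pairs of indices treats single and paired index sets alike.\<close>

lemma weighted_support_sum_le:
  fixes g :: "'i \<Rightarrow> ('a set \<times> 'a set set \<times> 'a set) \<times> ('a set \<times> 'a set set \<times> 'a set)"
  defines "vt \<equiv> \<lambda>X Y i. (\<Union>(fst (snd (fst (g i)))) \<union> \<Union>(fst (snd (snd (g i))))) - \<Union>(X \<union> Y)"
  assumes cons: "consistent X Y" and m: "card X + card Y \<le> m"
    and \<sigma>: "1 \<le> \<sigma>" "real u * (real (card V) / M) \<le> \<sigma>"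
    and fin: "finite I" and inj: "inj_on g I"
    and g: "\<And>i. i \<in> I \<Longrightarrow> anchored X (fst (g i)) \<and> anchored X (snd (g i))"
    and R: "\<And>i. i \<in> I \<Longrightarrow> finite (R i) \<and> card Y + card (vt X Y i) \<le> card (R i) \<and> card (R i) \<le> card Y + 2 * k"
  shows "real (card V) ^ card Y * (\<Sum>i\<in>I. ev u (\<lambda>C. of_bool (R i \<subseteq> C)))
    \<le> \<sigma> ^ (m + 2 * k) * real ((2 * k + 5) * (triple_count (3 * m + 2 * k + 4))\<^sup>2)"
proof -
  let ?n = "real (card V)" and ?W = "\<Union>(X \<union> Y)" and ?c = "triple_count (3 * m + 2 * k + 4)"
  have "?n ^ card Y * (\<Sum>i\<in>I. ev u (\<lambda>C. of_bool (R i \<subseteq> C)))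
      \<le> (\<Sum>i\<in>I. \<sigma> ^ (m + 2 * k) * (1 / ?n) ^ card (vt X Y i))"
    unfolding sum_distrib_left using R m by (intro sum_mono ev_weight_le[OF _ \<sigma>]) fastforce+
  also have "\<dots> = \<sigma> ^ (m + 2 * k) * (\<Sum>i\<in>I. (1 / ?n) ^ card (vt X Y i))"
    by (rule sum_distrib_left[symmetric])
  also have "(\<Sum>i\<in>I. (1 / ?n) ^ card (vt X Y i)) \<le> real ((2 * k + 4 + 1) * ?c\<^sup>2)"
  proof (rule sum_inverse_power_support_le[OF fin finite_V])
    show "0 < card V" using card_V_ge by simp
    fix i assume "i \<in> I"
    then obtain T S U T' S' U' where i: "g i = ((T, S, U), (T', S', U'))"
      "anchored X (T, S, U)" "anchored X (T', S', U')" using g by (metis prod.collapse)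
    then have fU: "finite (\<Union>S)" "finite (\<Union>S')" "card (\<Union>S) \<le> k + 2" "card (\<Union>S') \<le> k + 2"
      using conflict_Union[of S] conflict_Union[of S'] by simp_all
    have "card (vt X Y i) \<le> card (\<Union>S \<union> \<Union>S')"
      unfolding vt_def i(1) using fU by (intro card_mono) auto
    also have "\<dots> \<le> card (\<Union>S) + card (\<Union>S')" by (rule card_Un_le)
    finally have "card (vt X Y i) \<le> 2 * k + 4" using fU by simp
    moreover have "vt X Y i \<subseteq> V" using i unfolding vt_def by (auto simp: triples_def)
    ultimately show "vt X Y i \<subseteq> V \<and> card (vt X Y i) \<le> 2 * k + 4" by simp
  next
    fix Z :: "'a set" assume Z: "finite Z" "card Z \<le> 2 * k + 4"
    let ?Q = "?W \<union> Z"
    let ?P = "Pow ?Q \<times> Pow (Pow ?Q) \<times> Pow ?Q"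
    have finQ: "finite ?Q" using Z consistentD(8)[OF cons] by simp
    have "card ?Q \<le> card ?W + card Z" by (rule card_Un_le)
    also have "\<dots> \<le> 3 * m + 2 * k + 4" using card_support_le[OF cons] m Z by simp
    finally have Q: "card ?Q \<le> 3 * m + 2 * k + 4" .
    \<comment> \<open>Once the vertices off the support are fixed, everything lives on
      \<open>?Q\<close>, whose size is bounded independently of n.\<close>
    have "g ` {i \<in> I. vt X Y i = Z} \<subseteq> ?P \<times> ?P"
    proof
      fix x assume "x \<in> g ` {i \<in> I. vt X Y i = Z}"
      then obtain i where i: "i \<in> I" "vt X Y i = Z" "x = g i" by auto
      have "\<Union>(fst (snd (fst x))) \<subseteq> ?Q" "\<Union>(fst (snd (snd x))) \<subseteq> ?Q"
        using i(2) unfolding i(3) vt_def by blast+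
      then show "x \<in> ?P \<times> ?P" using g[OF i(1)] unfolding i(3) mem_Times_iff by blast
    qed
    moreover have "inj_on g {i \<in> I. vt X Y i = Z}" by (rule inj_on_subset[OF inj]) auto
    ultimately have "card {i \<in> I. vt X Y i = Z} \<le> card (?P \<times> ?P)"
      using finQ by (intro card_inj_on_le[of g]) auto
    also have "\<dots> = card ?P * card ?P" by (rule card_cartesian_product)
    also have "\<dots> \<le> ?c * ?c" using card_index_le[OF finQ Q] by (intro mult_le_mono) auto
    finally show "card {i \<in> I. vt X Y i = Z} \<le> ?c\<^sup>2" by (simp add: power2_eq_square)
  qed
  also have "2 * k + 4 + 1 = 2 * k + 5" by simp
  finally show ?thesis using \<sigma>(1) by (simp add: mult_left_mono)
qed

text \<open>Of the \<open>card S + 2\<close> vertices, the support contains three more than the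
  number of old edges. So there are fewer new vertices than new edges, and \<open>U\<close>, which
  is proposed rather than chosen, can be discarded.\<close>

lemma near_weight:
  assumes cons: "consistent X Y" and i: "(T, S, U) \<in> near_idx X Y"
  shows "card Y + card (\<Union>S - \<Union>(X \<union> Y)) \<le> card (Y \<union> (S - {T, U}))"
    "card (Y \<union> (S - {T, U})) \<le> card Y + 2 * k"
proof -
  let ?W = "\<Union>(X \<union> Y)" and ?R = "S - (X \<union> Y) - {U}"
  have *: "T \<in> X" "conflict k S" "T \<in> S" "U \<in> S" "T \<noteq> U" "S \<inter> X = {T}" "U \<notin> Y"
    "card (S \<inter> (X \<union> Y)) + 3 \<le> card (\<Union>S \<inter> ?W)" using i by (auto simp: near_idx_def)
  note fS = conflict_card(4)[OF *(2)] and fY = consistentD(5)[OF cons]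
  have "U \<notin> X" using * by auto
  then have "card ?R = card (S - (X \<union> Y)) - 1" using * fS by (subst card_Diff_singleton) auto
  moreover have "card (S - (X \<union> Y)) = card S - card (S \<inter> (X \<union> Y))"
    using fS by (simp add: card_Diff_subset_Int)
  moreover have "card (\<Union>S - ?W) = card S + 2 - card (\<Union>S \<inter> ?W)"
    using conflict_Union[OF *(2)] by (simp add: card_Diff_subset_Int)
  ultimately have "card (\<Union>S - ?W) \<le> card ?R" using *(8) by linarith
  moreover have "card Y + card ?R = card (Y \<union> ?R)"
    using fS fY by (intro card_Un_disjoint[symmetric]) auto
  moreover have "card (Y \<union> ?R) \<le> card (Y \<union> (S - {T, U}))"
    using fS fY * by (intro card_mono) auto
  ultimately show "card Y + card (\<Union>S - ?W) \<le> card (Y \<union> (S - {T, U}))" by linarith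
  have "card (Y \<union> (S - {T, U})) \<le> card Y + card (S - {T, U})" by (rule card_Un_le)
  also have "card (S - {T, U}) \<le> card S" using fS by (intro card_mono) auto
  finally show "card (Y \<union> (S - {T, U})) \<le> card Y + 2 * k" using conflict_card(2)[OF *(2)] by simp
qed

text \<open>Here \<open>Y - {U}\<close> is one triple short, and the strict surplus of new edges
  over new vertices makes up for it.\<close>

lemma gain_weight:
  assumes cons: "consistent X Y" and i: "(T, S, U) \<in> gain_idx X Y"
  shows "card Y + card (\<Union>S - \<Union>(X \<union> Y)) \<le> card (Y - {U} \<union> (S - {T, U}))"
    "card (Y - {U} \<union> (S - {T, U})) \<le> card Y + 2 * k"
proof -
  let ?W = "\<Union>(X \<union> Y)" and ?R = "S - (X \<union> Y)"
  have *: "T \<in> X" "conflict k S" "T \<in> S" "U \<in> S" "S \<inter> X = {T}" "U \<in> Y"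
    "card (S \<inter> (X \<union> Y)) + 3 \<le> card (\<Union>S \<inter> ?W)" using i by (auto simp: gain_idx_def)
  note fS = conflict_card(4)[OF *(2)] and fY = consistentD(5)[OF cons]
  have "card ?R = card S - card (S \<inter> (X \<union> Y))"
    using fS by (simp add: card_Diff_subset_Int)
  moreover have "card (\<Union>S - ?W) = card S + 2 - card (\<Union>S \<inter> ?W)"
    using conflict_Union[OF *(2)] by (simp add: card_Diff_subset_Int)
  moreover have "card (\<Union>S \<inter> ?W) \<le> card S + 2"
    using conflict_Union[OF *(2)] card_mono[of "\<Union>S" "\<Union>S \<inter> ?W"] by simp
  ultimately have "card (\<Union>S - ?W) + 1 \<le> card ?R" using *(7) by linarith
  moreover have "card (Y - {U}) + card ?R = card (Y - {U} \<union> ?R)"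
    using fS fY by (intro card_Un_disjoint[symmetric]) auto
  moreover have "card (Y - {U}) = card Y - 1" "card Y \<noteq> 0" using *(6) fY by auto
  moreover have "card (Y - {U} \<union> ?R) \<le> card (Y - {U} \<union> (S - {T, U}))"
    using fS fY * by (intro card_mono) auto
  ultimately show "card Y + card (\<Union>S - ?W) \<le> card (Y - {U} \<union> (S - {T, U}))" by linarith
  have "card (Y - {U} \<union> (S - {T, U})) \<le> card (Y \<union> S)" using fS fY by (intro card_mono) auto
  also have "\<dots> \<le> card Y + card S" by (rule card_Un_le)
  finally show "card (Y - {U} \<union> (S - {T, U})) \<le> card Y + 2 * k" using conflict_card(2)[OF *(2)] by simp
qed

text \<open>\<open>insert T B\<close> is still a proper subset of \<open>S\<close> with at least two
  edges, so it spans at least \<open>card B + 4\<close> vertices, and only the three of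
  \<open>T\<close> lie in \<open>W\<close>.\<close>

lemma conf_new_vertices:
  assumes "conflict k S" "T \<in> S" "\<Union>S \<inter> W = T" "B \<subseteq> S - {T}" "B \<noteq> {}" "insert T B \<noteq> S"
  shows "card B + 1 \<le> card (\<Union>B - W)"
proof -
  note fS = conflict_card(4)[OF assms(1)] and T = conflict_edge[OF assms(1,2)]
  have fB: "finite B" using fS assms(4) finite_subset by blast
  have cB: "card (insert T B) = card B + 1" using assms(4) fB by (subst card_insert_disjoint) auto
  have "insert T B \<subset> S" using assms by auto
  moreover have "2 \<le> card (insert T B)" using cB assms(5) fB by (simp add: Suc_le_eq card_gt_0_iff)
  ultimately have 1: "card (insert T B) + 3 \<le> card (\<Union>(insert T B))"
    by (rule conflict_span[OF assms(1)])
  have sub: "\<Union>(insert T B) \<subseteq> T \<union> (\<Union>B - W)" using assms(3,4) by blast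
  have fin: "finite (\<Union>B - W)"
    using conflict_Union(1)[OF assms(1)] assms(4) by (rule_tac finite_subset[of _ "\<Union>S"]) auto
  have "card (\<Union>(insert T B)) \<le> card (T \<union> (\<Union>B - W))"
    using T fin by (intro card_mono[OF _ sub]) auto
  also have "\<dots> \<le> 3 + card (\<Union>B - W)" using card_Un_le[of T "\<Union>B - W"] T by simp
  finally show ?thesis using 1 cB by linarith
qed

lemma clash_weight:
  assumes cons: "consistent X Y" and i: "((T, S, U), (T', S', U')) \<in> clash_idx X Y"
  shows "card Y + card ((\<Union>S \<union> \<Union>S') - \<Union>(X \<union> Y)) \<le> card (Y \<union> (S - {T, U} \<union> (S' - {T', U'})))"
    "card (Y \<union> (S - {T, U} \<union> (S' - {T', U'}))) \<le> card Y + 2 * k"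
proof -
  let ?W = "\<Union>(X \<union> Y)"
  have idx: "(T, S, U) \<in> conf_idx X Y" "(T', S', U') \<in> conf_idx X Y" "U = U'"
    "T \<noteq> T' \<or> S \<noteq> S'" using i by (auto simp: clash_idx_def)
  have a: "T \<in> X" "conflict k S" "S \<subseteq> triples V" "T \<in> S" "U \<in> S" "T \<noteq> U" "\<Union>S \<inter> ?W = T" "3 \<le> card S"
    using idx(1) by (auto simp: conf_idx_def)
  have b: "T' \<in> X" "conflict k S'" "S' \<subseteq> triples V" "T' \<in> S'" "U \<in> S'" "T' \<noteq> U" "\<Union>S' \<inter> ?W = T'" "3 \<le> card S'"
    using idx(2,3) by (auto simp: conf_idx_def)
  define A where "A = S - {T}"
  define A' where "A' = S' - {T'}"
  define B where "B = A \<inter> A'"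
  note fS = conflict_card(4)[OF a(2)] conflict_card(4)[OF b(2)]
  note fU = conflict_Union(1)[OF a(2)] conflict_Union(1)[OF b(2)]
  note fY = consistentD(5)[OF cons]
  have fA: "finite A" "finite A'" "finite B" using fS by (auto simp: A_def A'_def B_def)
  have cA: "card A + 1 = card S" "card A' + 1 = card S'"
    using a b fS by (auto simp: A_def A'_def card_gt_0_iff)
  have UB: "U \<in> B" using a b by (auto simp: A_def A'_def B_def)
  have newS: "card (\<Union>S - ?W) = card A"
    using fU conflict_Union(2)[OF a(2)] a(7) cA conflict_edge[OF a(2,4)]
    by (simp add: card_Diff_subset_Int)
  have newS': "card (\<Union>S' - ?W) = card A'"
    using fU conflict_Union(2)[OF b(2)] b(7) cA conflict_edge[OF b(2,4)]
    by (simp add: card_Diff_subset_Int)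
  have AXY: "A \<inter> (X \<union> Y) = {}"
  proof (rule ccontr)
    assume "\<not> ?thesis"
    then obtain E where E: "E \<in> S" "E \<noteq> T" "E \<in> X \<union> Y" by (auto simp: A_def)
    then have "E \<subseteq> T" using a(7) by blast
    then show False
      using E conflict_edge[OF a(2,4)] conflict_edge(1)[OF a(2) E(1)] card_subset_eq by metis
  qed
  have AXY': "A' \<inter> (X \<union> Y) = {}"
  proof (rule ccontr)
    assume "\<not> ?thesis"
    then obtain E where E: "E \<in> S'" "E \<noteq> T'" "E \<in> X \<union> Y" by (auto simp: A'_def)
    then have "E \<subseteq> T'" using b(7) by blast
    then show False
      using E conflict_edge[OF b(2,4)] conflict_edge(1)[OF b(2) E(1)] card_subset_eq by metis
  qed
  have key: "card B + 1 \<le> card (\<Union>B - ?W)"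
  proof (cases "insert T B = S \<and> insert T' B = S'")
    case False
    have B: "B \<subseteq> S - {T}" "B \<subseteq> S' - {T'}" "B \<noteq> {}" using UB by (auto simp: B_def A_def A'_def)
    show ?thesis
    proof (cases "insert T B = S")
      case True
      with False have "insert T' B \<noteq> S'" by simp
      then show ?thesis by (rule conf_new_vertices[OF b(2,4,7) B(2,3)])
    next
      case False
      then show ?thesis by (rule conf_new_vertices[OF a(2,4,7) B(1,3)])
    qed
  next
    case True
    \<comment> \<open>Both conflicts consist of \<open>B\<close> and an anchor. As \<open>B\<close>
      already covers all vertices of each, both anchors are its part in the support, so the two
      indices would coincide.\<close>
    then have AB: "A = B" "A' = B" by (auto simp: A_def A'_def B_def)
    have "2 \<le> card B" using cA(1) a(8) AB(1) by simp
    then have "card B + 3 \<le> card (\<Union>B)"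
      using a(4) AB by (intro conflict_span[OF a(2)]) (auto simp: A_def)
    then have "card (\<Union>S) \<le> card (\<Union>B)" "card (\<Union>S') \<le> card (\<Union>B)"
      using cA[unfolded AB] conflict_Union(2)[OF a(2)] conflict_Union(2)[OF b(2)] by simp_all
    moreover have "\<Union>B \<subseteq> \<Union>S" "\<Union>B \<subseteq> \<Union>S'" by (auto simp: B_def A_def A'_def)
    ultimately have "\<Union>B = \<Union>S" "\<Union>B = \<Union>S'" using fU card_seteq by blast+
    then have "T = T'" using a(7) b(7) by simp
    then have "S = S'" using True by metis
    with \<open>T = T'\<close> idx(4) show ?thesis by simp
  qed
  have "card (\<Union>B - ?W) \<le> card ((\<Union>S - ?W) \<inter> (\<Union>S' - ?W))"
    using fU by (intro card_mono) (auto simp: B_def A_def A'_def)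
  moreover have "card ((\<Union>S - ?W) \<union> (\<Union>S' - ?W)) + card ((\<Union>S - ?W) \<inter> (\<Union>S' - ?W)) = card A + card A'"
    using fU newS newS' card_Un_Int[of "\<Union>S - ?W" "\<Union>S' - ?W"] by simp
  moreover have "card (A \<union> A') + card B = card A + card A'"
    using fA card_Un_Int[of A A'] by (simp add: B_def)
  ultimately have "card ((\<Union>S - ?W) \<union> (\<Union>S' - ?W)) + 1 \<le> card (A \<union> A')"
    using key by linarith
  moreover have "(\<Union>S - ?W) \<union> (\<Union>S' - ?W) = (\<Union>S \<union> \<Union>S') - ?W" by auto
  moreover have "card (A \<union> A' - {U}) = card (A \<union> A') - 1" using UB fA by (auto simp: B_def)
  ultimately have *: "card ((\<Union>S \<union> \<Union>S') - ?W) \<le> card (A \<union> A' - {U})" by simp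
  have R: "S - {T, U} \<union> (S' - {T', U'}) = A \<union> A' - {U}"
    using idx(3) by (auto simp: A_def A'_def)
  have cU: "card (Y \<union> (A \<union> A' - {U})) = card Y + card (A \<union> A' - {U})"
    using fY fA AXY AXY' by (intro card_Un_disjoint) auto
  show "card Y + card ((\<Union>S \<union> \<Union>S') - ?W) \<le> card (Y \<union> (S - {T, U} \<union> (S' - {T', U'})))"
    unfolding R cU using * by simp
  have "card (A \<union> A' - {U}) \<le> card (A \<union> A')" using fA by (intro card_mono) auto
  also have "\<dots> \<le> card A + card A'" by (rule card_Un_le)
  also have "\<dots> \<le> 2 * k" using cA conflict_card(2)[OF a(2)] conflict_card(2)[OF b(2)] by linarith
  finally show "card (Y \<union> (S - {T, U} \<union> (S' - {T', U'}))) \<le> card Y + 2 * k"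
    unfolding R cU by simp
qed

lemma ev_drift_error_le:
  assumes cons: "consistent X Y" and m: "card X + card Y \<le> m"
    and \<sigma>: "1 \<le> \<sigma>" "real u * (real (card V) / M) \<le> \<sigma>"
  shows "real (card V) ^ card Y * ev u (drift_error X Y) \<le> err_const k m \<sigma>"
proof -
  let ?n = "real (card V)" and ?y = "card Y" and ?l = "m + 2 * k"
  let ?K = "real ((2 * k + 5) * (triple_count (3 * m + 2 * k + 4))\<^sup>2)"
  note fin = finite_idx[OF cons] and fY = consistentD(5)[OF cons]
  note sum_le = weighted_support_sum_le[OF cons m \<sigma>]
  have fS: "finite S" if "S \<subseteq> triples V" for S using that finite_trip finite_subset by blast
  let ?near = "\<lambda>(T, S, U). Y \<union> (S - {T, U})"
  let ?clash = "\<lambda>((T, S, U), (T', S', U')). Y \<union> (S - {T, U} \<union> (S' - {T', U'}))"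
  let ?gain = "\<lambda>(T, S, U). Y - {U} \<union> (S - {T, U})"
  let ?E = "\<lambda>I R. \<Sum>i\<in>I. ev u (\<lambda>C. of_bool (R i \<subseteq> C))"
  have eq: "ev u (drift_error X Y) = real (card X) * ev u (\<lambda>C. of_bool (Y \<subseteq> C))
      + ?E (near_idx X Y) ?near + ?E (clash_idx X Y) ?clash + ?E (gain_idx X Y) ?gain"
    unfolding drift_error_def by (simp only: ev_add ev_cmult ev_sum fin case_prod_unfold)
  have 1: "?n ^ ?y * (real (card X) * ev u (\<lambda>C. of_bool (Y \<subseteq> C))) \<le> real m * \<sigma> ^ ?l"
  proof -
    have "?n ^ ?y * ev u (\<lambda>C. of_bool (Y \<subseteq> C)) \<le> \<sigma> ^ ?l * (1 / ?n) ^ 0"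
      using fY m by (intro ev_weight_le[OF _ \<sigma>]) auto
    then have "real (card X) * (?n ^ ?y * ev u (\<lambda>C. of_bool (Y \<subseteq> C))) \<le> real m * \<sigma> ^ ?l"
      using m \<sigma>(1) by (intro mult_mono mult_nonneg_nonneg ev_nonneg) auto
    then show ?thesis by (simp add: mult_ac)
  qed
  have 2: "?n ^ ?y * ?E (near_idx X Y) ?near \<le> \<sigma> ^ ?l * ?K"
  \<comment> \<open>A single index is read as a pair of equal ones.\<close>
  proof (rule sum_le[where g = "\<lambda>i. (i, i)"])
    fix i assume "i \<in> near_idx X Y"
    then obtain T S U where i: "i = (T, S, U)" "(T, S, U) \<in> near_idx X Y" by (cases i) auto
    then have S: "T \<in> X" "T \<in> S" "U \<in> S" "conflict k S" "S \<subseteq> triples V" by (simp_all add: near_idx_def)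
    show "anchored X (fst (i, i)) \<and> anchored X (snd (i, i))" using S i(1) by simp
    show "finite (?near i) \<and> ?y + card ((\<Union>(fst (snd (fst (i, i)))) \<union> \<Union>(fst (snd (snd (i, i))))) - \<Union>(X \<union> Y))
        \<le> card (?near i) \<and> card (?near i) \<le> ?y + 2 * k"
      using near_weight[OF cons i(2)] fS[OF S(5)] fY unfolding i(1) by simp
  qed (use fin in \<open>auto intro: inj_onI\<close>)
  have 3: "?n ^ ?y * ?E (gain_idx X Y) ?gain \<le> \<sigma> ^ ?l * ?K"
  proof (rule sum_le[where g = "\<lambda>i. (i, i)"])
    fix i assume "i \<in> gain_idx X Y"
    then obtain T S U where i: "i = (T, S, U)" "(T, S, U) \<in> gain_idx X Y" by (cases i) auto
    then have S: "T \<in> X" "T \<in> S" "U \<in> S" "conflict k S" "S \<subseteq> triples V" by (simp_all add: gain_idx_def)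
    show "anchored X (fst (i, i)) \<and> anchored X (snd (i, i))" using S i(1) by simp
    show "finite (?gain i) \<and> ?y + card ((\<Union>(fst (snd (fst (i, i)))) \<union> \<Union>(fst (snd (snd (i, i))))) - \<Union>(X \<union> Y))
        \<le> card (?gain i) \<and> card (?gain i) \<le> ?y + 2 * k"
      using gain_weight[OF cons i(2)] fS[OF S(5)] fY unfolding i(1) by simp
  qed (use fin in \<open>auto intro: inj_onI\<close>)
  have 4: "?n ^ ?y * ?E (clash_idx X Y) ?clash \<le> \<sigma> ^ ?l * ?K"
  proof (rule sum_le[where g = "\<lambda>i. i"])
    fix i assume "i \<in> clash_idx X Y"
    then obtain T S U T' S' U' where i: "i = ((T, S, U), (T', S', U'))"
      "((T, S, U), (T', S', U')) \<in> clash_idx X Y" by (metis prod.collapse)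
    then have S: "anchored X (T, S, U)" "anchored X (T', S', U')"
      by (auto simp: clash_idx_def conf_idx_def)
    show "anchored X (fst i) \<and> anchored X (snd i)" using S unfolding i(1) by simp
    show "finite (?clash i) \<and> ?y + card ((\<Union>(fst (snd (fst i))) \<union> \<Union>(fst (snd (snd i)))) - \<Union>(X \<union> Y))
        \<le> card (?clash i) \<and> card (?clash i) \<le> ?y + 2 * k"
      using clash_weight[OF cons i(2)] fS[of S] fS[of S'] S fY unfolding i(1) by simp
  qed (use fin in \<open>auto intro: inj_onI\<close>)
  have "?n ^ ?y * ev u (drift_error X Y) \<le> real m * \<sigma> ^ ?l + \<sigma> ^ ?l * ?K + \<sigma> ^ ?l * ?K + \<sigma> ^ ?l * ?K"
    unfolding eq distrib_left by (intro add_mono 1 2 3 4)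
  also have "\<dots> = err_const k m \<sigma>" by (simp add: err_const_def algebra_simps)
  finally show ?thesis .
qed

end

section \<open>The limiting product\<close>

text \<open>Each factor differs from \<open>n\<close> by at most \<open>L\<close>, and the induction
  keeps the relative error below \<open>((1 + L) ^ d - 1) / n\<close>.\<close>

lemma falling_product_approx:
  fixes n w L :: real
  assumes "1 \<le> n" "0 \<le> w" "\<And>j. j < d \<Longrightarrow> w + real j \<le> L"
  shows "\<bar>(\<Prod>j<d. n - w - real j) - n ^ d\<bar> \<le> ((1 + L) ^ d - 1) * n ^ d / n"
  using assms(3)
proof (induction d)
  case (Suc d)
  let ?a = "\<Prod>j<d. n - w - real j" and ?x = "w + real d"
  have L: "?x \<le> L" "0 \<le> ?x" using Suc.prems[of d] assms(2) by auto
  have Lp: "1 \<le> (1 + L) ^ d" using L by (intro one_le_power) linarith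
  have IH: "\<bar>?a - n ^ d\<bar> \<le> ((1 + L) ^ d - 1) * n ^ d / n" using Suc by simp
  have nx: "\<bar>n - ?x\<bar> \<le> n * (1 + L)"
  proof -
    have "L \<le> n * L" using mult_right_mono[of 1 n L] assms(1) L by simp
    then show ?thesis using L assms(1) by (auto simp: abs_if algebra_simps)
  qed
  have "(\<Prod>j<Suc d. n - w - real j) - n ^ Suc d = (?a - n ^ d) * (n - ?x) - n ^ d * ?x"
    by (simp add: algebra_simps)
  then have "\<bar>(\<Prod>j<Suc d. n - w - real j) - n ^ Suc d\<bar>
      \<le> \<bar>?a - n ^ d\<bar> * \<bar>n - ?x\<bar> + \<bar>n ^ d * ?x\<bar>"
    by (metis abs_mult abs_triangle_ineq4)
  also have "\<dots> \<le> (((1 + L) ^ d - 1) * n ^ d / n) * (n * (1 + L)) + n ^ d * L"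
    using IH nx L assms(1) Lp by (intro add_mono mult_mono) (auto simp: abs_mult)
  also have "\<dots> = ((1 + L) ^ Suc d - 1) * n ^ Suc d / n"
    using assms(1) by (simp add: field_simps)
  finally show ?case .
qed simp

text \<open>A conflict with \<open>d + 1\<close> edges through a fixed one has \<open>d\<close> free
  vertices and, besides the proposal, \<open>d - 1\<close> triples to be chosen. The net count is
  n/d! up to a bounded error, uniformly in the number \<open>w\<close> of excluded vertices.\<close>

lemma binomial_scaled_approx:
  assumes "w \<le> n" "1 \<le> n" "w \<le> W" "1 \<le> d" "d \<le> k"
  shows "\<bar>real (n - w choose d) * (1 / real n) ^ (d - 1) - real n / fact d\<bar> \<le> (1 + real W + real k) ^ k"
proof -
  let ?L = "real W + real k"
  have pr: "real (n - w choose d) = (\<Prod>j<d. real n - real w - real j) / fact d"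
    using assms(1) by (simp add: binomial_gbinomial gbinomial_prod_rev of_nat_diff atLeast0LessThan)
  have ap: "\<bar>(\<Prod>j<d. real n - real w - real j) - real n ^ d\<bar> \<le> ((1 + ?L) ^ d - 1) * real n ^ d / real n"
    using assms by (intro falling_product_approx) auto
  have nd: "real n ^ d = real n * real n ^ (d - 1)" using assms(4) by (cases d) auto
  have eq: "real (n - w choose d) * (1 / real n) ^ (d - 1) - real n / fact d
      = ((\<Prod>j<d. real n - real w - real j) - real n ^ d) * ((1 / real n) ^ (d - 1) / fact d)"
    unfolding pr using assms(2) by (simp add: nd field_simps power_one_over)
  have "\<bar>real (n - w choose d) * (1 / real n) ^ (d - 1) - real n / fact d\<bar>
      = \<bar>(\<Prod>j<d. real n - real w - real j) - real n ^ d\<bar> * ((1 / real n) ^ (d - 1) / fact d)"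
    unfolding eq by (simp add: abs_mult)
  also have "\<dots> \<le> ((1 + ?L) ^ d - 1) * real n ^ d / real n * ((1 / real n) ^ (d - 1) / fact d)"
    using ap by (intro mult_right_mono) auto
  also have "\<dots> = ((1 + ?L) ^ d - 1) / fact d"
    using assms(2) by (simp add: nd power_one_over)
  also have "\<dots> \<le> ((1 + ?L) ^ d - 1) / 1"
    by (intro divide_left_mono) (auto simp: fact_ge_1 intro!: one_le_power)
  also have "\<dots> \<le> (1 + ?L) ^ d" by simp
  also have "\<dots> \<le> (1 + ?L) ^ k" using assms by (intro power_increasing) auto
  finally show ?thesis by (simp add: add.assoc)
qed

text \<open>The limiting expected number of conflicts with at least three edges through a given
  triple whose other edges are all chosen. Conflicts with two edges are accounted for by the
  shadow.\<close>

definition closure_exponent :: "nat \<Rightarrow> real \<Rightarrow> real" where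
  "closure_exponent k p = (\<Sum>i=3..k. real (kappa i) / fact (i - 1) * p ^ (i - 1))"

definition closure_exponent' :: "nat \<Rightarrow> real \<Rightarrow> real" where
  "closure_exponent' k p = (\<Sum>i=3..k. real (kappa i) / fact (i - 1) * (real (i - 1) * p ^ (i - 2)))"

definition survive :: "nat \<Rightarrow> real \<Rightarrow> real" where
  "survive k p = exp (- closure_exponent k p)"

text \<open>The exponents stand for \<open>card Y\<close>, \<open>card (shadow X)\<close> and
  \<open>card X\<close>; the power of 1/n is absorbed in the rescaling of
  \<open>sprob\<close>.\<close>

definition lim_val :: "nat \<Rightarrow> real \<Rightarrow> nat \<Rightarrow> nat \<Rightarrow> nat \<Rightarrow> real" where
  "lim_val k p y b a = p ^ y * (1 - p) ^ b * survive k p ^ a"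

text \<open>The derivative of \<open>lim_val\<close> along the flow with velocity
  \<open>speed\<close>, arranged to match the three sums of \<open>drift_op\<close>: choice of a
  member of \<open>Y\<close>, loss through pairs, loss through larger conflicts.\<close>

definition lim_drift :: "nat \<Rightarrow> real \<Rightarrow> nat \<Rightarrow> nat \<Rightarrow> nat \<Rightarrow> real" where
  "lim_drift k p y b a = real y * lim_val k p (y - 1) (b + 3) (a + 1)
     - real b * lim_val k p y (b + 2) (a + 1)
     - real a * closure_exponent' k p * lim_val k p y (b + 3) (a + 1)"

text \<open>The 3 stands for the pairs of a triple, the sum for the choices of a conflict and of the
  proposal in it.\<close>

definition lip_const :: "nat \<Rightarrow> real" where
  "lip_const k = 3 + (\<Sum>i=3..k. real (kappa i) * real (i - 1))"

text \<open>The first term bounds shadow size times support size, each at most \<open>3 * m\<close>;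
  the second is the error of \<open>binomial_scaled_approx\<close> for each member of
  \<open>X\<close>.\<close>

definition count_const :: "nat \<Rightarrow> nat \<Rightarrow> real" where
  "count_const k m = 9 * real m * real m
     + real m * ((\<Sum>i=3..k. real (kappa i) * real (i - 1)) * (1 + real (3 * m) + real k) ^ k)"

lemma survive_bounds: "0 \<le> p \<Longrightarrow> 0 < survive k p \<and> survive k p \<le> 1"
  by (auto simp: survive_def closure_exponent_def intro!: sum_nonneg)

lemma lim_val_bounds:
  assumes "0 \<le> p" "p \<le> 1"
  shows "0 \<le> lim_val k p y b a" "lim_val k p y b a \<le> 1"
proof -
  note s = survive_bounds[OF assms(1), of k]
  show "0 \<le> lim_val k p y b a" unfolding lim_val_def using assms s by auto
  have "p ^ y * (1 - p) ^ b * survive k p ^ a \<le> 1 * 1 * 1"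
    using assms s by (intro mult_mono power_le_one mult_nonneg_nonneg zero_le_power) auto
  then show "lim_val k p y b a \<le> 1" unfolding lim_val_def by simp
qed

section \<open>The rescaled correlation probabilities\<close>

context lazy_process
begin

definition sprob :: "nat \<Rightarrow> 'a set set \<Rightarrow> 'a set set \<Rightarrow> real" where
  "sprob u X Y = real (card V) ^ card Y * ev u (ind X Y)"

text \<open>The rescaling by \<open>n ^ card Y\<close> leaves a factor n where \<open>Y\<close>
  loses a triple and a negative power where it gains \<open>card S - 2\<close> triples.\<close>

definition drift_op :: "('a set set \<Rightarrow> 'a set set \<Rightarrow> real) \<Rightarrow> 'a set set \<Rightarrow> 'a set set \<Rightarrow> real" where
  "drift_op R X Y = real (card V) * (\<Sum>c\<in>Y. R (insert c X) (Y - {c})) - (\<Sum>U\<in>pair_idx X Y. R (insert U X) Y)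
    - (\<Sum>(T, S, U)\<in>conf_idx X Y. (1 / real (card V)) ^ (card S - 2) * R (insert U X) (Y \<union> (S - {T, U})))"

lemma sprob_step:
  assumes cons: "consistent X Y" and m: "card X + card Y \<le> m"
    and \<sigma>: "1 \<le> \<sigma>" "real u * (real (card V) / M) \<le> \<sigma>"
  shows "\<bar>M * (sprob (Suc u) X Y - sprob u X Y) - drift_op (sprob u) X Y\<bar> \<le> err_const k m \<sigma>"
proof -
  let ?n = "real (card V)" and ?y = "card Y"
  have n: "?n > 0" using card_V_ge by simp
  note fin = finite_idx[OF cons] and fY = consistentD(5)[OF cons]
  let ?D = "\<lambda>C. \<Sum>U\<in>triples V. ind X Y (lazy_step C U) - ind X Y C"
  have step: "M * (sprob (Suc u) X Y - sprob u X Y) = ?n ^ ?y * ev u ?D"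
    using M_pos by (simp add: sprob_def ev_Suc right_diff_distrib distrib_left del: ev.simps)
  have drift: "?n ^ ?y * ev u (drift X Y) = drift_op (sprob u) X Y"
  proof -
    have "ev u (drift X Y) = (\<Sum>c\<in>Y. ev u (ind (insert c X) (Y - {c})))
        - (\<Sum>U\<in>pair_idx X Y. ev u (ind (insert U X) Y))
        - (\<Sum>(T, S, U)\<in>conf_idx X Y. ev u (ind (insert U X) (Y \<union> (S - {T, U}))))"
      unfolding drift_def by (simp only: ev_diff ev_sum fin fY case_prod_unfold)
    then have "?n ^ ?y * ev u (drift X Y) = (\<Sum>c\<in>Y. ?n ^ ?y * ev u (ind (insert c X) (Y - {c})))
        - (\<Sum>U\<in>pair_idx X Y. ?n ^ ?y * ev u (ind (insert U X) Y))
        - (\<Sum>(T, S, U)\<in>conf_idx X Y. ?n ^ ?y * ev u (ind (insert U X) (Y \<union> (S - {T, U}))))"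
      by (simp only: right_diff_distrib sum_distrib_left case_prod_unfold)
    also have "(\<Sum>c\<in>Y. ?n ^ ?y * ev u (ind (insert c X) (Y - {c}))) 
        = ?n * (\<Sum>c\<in>Y. sprob u (insert c X) (Y - {c}))"
      unfolding sum_distrib_left
    proof (rule sum.cong[OF refl])
      fix c assume c: "c \<in> Y"
      then have "?y = Suc (card (Y - {c}))" using fY by (metis card.remove)
      then show "?n ^ ?y * ev u (ind (insert c X) (Y - {c})) = ?n * sprob u (insert c X) (Y - {c})"
        by (simp add: sprob_def)
    qed
    also have "(\<Sum>(T, S, U)\<in>conf_idx X Y. ?n ^ ?y * ev u (ind (insert U X) (Y \<union> (S - {T, U}))))
        = (\<Sum>(T, S, U)\<in>conf_idx X Y. (1 / ?n) ^ (card S - 2) * sprob u (insert U X) (Y \<union> (S - {T, U})))"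
    proof (rule sum.cong[OF refl], clarify)
      fix T S U assume "(T, S, U) \<in> conf_idx X Y"
      from conf_idx_extend(3)[OF cons this]
      show "?n ^ ?y * ev u (ind (insert U X) (Y \<union> (S - {T, U})))
          = (1 / ?n) ^ (card S - 2) * sprob u (insert U X) (Y \<union> (S - {T, U}))"
        using n by (simp add: sprob_def power_add power_one_over)
    qed
    finally show ?thesis by (simp add: drift_op_def sprob_def)
  qed
  have "ev u ?D - ev u (drift X Y) \<le> ev u (drift_error X Y)"
    unfolding ev_diff[symmetric] using drift_approx[OF cons] by (intro ev_mono) force
  moreover have "ev u (drift X Y) - ev u ?D \<le> ev u (drift_error X Y)"
    unfolding ev_diff[symmetric] using drift_approx[OF cons] by (intro ev_mono) force
  ultimately have "\<bar>ev u ?D - ev u (drift X Y)\<bar> \<le> ev u (drift_error X Y)" by linarith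
  then have "?n ^ ?y * \<bar>ev u ?D - ev u (drift X Y)\<bar> \<le> ?n ^ ?y * ev u (drift_error X Y)"
    using n by (intro mult_left_mono) auto
  also have "\<dots> \<le> err_const k m \<sigma>" by (rule ev_drift_error_le[OF cons m \<sigma>])
  finally have "\<bar>?n ^ ?y * (ev u ?D - ev u (drift X Y))\<bar> \<le> err_const k m \<sigma>"
    by (simp add: abs_mult)
  then show ?thesis unfolding step drift[symmetric] by (simp only: right_diff_distrib)
qed

text \<open>Such a triple is a shadow pair plus one vertex off the support, and both can be read off
  from it.\<close>

lemma card_pair_idx:
  assumes cons: "consistent X Y"
  shows "card (pair_idx X Y) = card (shadow X) * (card V - card (\<Union>(X \<union> Y)))"
proof -
  let ?W = "\<Union>(X \<union> Y)" and ?f = "\<lambda>(e, x). insert x e"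
  note cD = consistentD[OF cons]
  have sh: "e \<subseteq> ?W" "card e = 2" "finite e" if "e \<in> shadow X" for e
    using that shadow_subset_support[of e X Y] by (auto simp: shadow_def intro: card_ge_0_finite)
  have inj: "inj_on ?f (shadow X \<times> (V - ?W))"
  proof (rule inj_onI, clarify)
    fix e x e' x' assume *: "e \<in> shadow X" "e' \<in> shadow X" "x \<notin> ?W" "x' \<notin> ?W" "insert x e = insert x' e'"
    have "e = insert x e \<inter> ?W" "e' = insert x' e' \<inter> ?W" using sh(1) * by blast+
    then have "e = e'" using *(5) by simp
    moreover have "x = x'"
    proof -
      have "x \<in> insert x' e'" using *(5) by blast
      then show ?thesis using sh(1)[OF *(2)] *(3) by blast
    qed
    ultimately show "e = e' \<and> x = x'" by simp
  qed
  have "pair_idx X Y = ?f ` (shadow X \<times> (V - ?W))"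
  proof (intro set_eqI iffI)
    fix U assume U: "U \<in> pair_idx X Y"
    let ?e = "U \<inter> ?W"
    have e: "?e \<in> shadow X" "card U = 3" "U \<subseteq> V" "finite U"
      using U tripleD by (auto simp: pair_idx_def)
    have "card (U - ?W) = 1" using e sh(2)[OF e(1)] by (simp add: card_Diff_subset_Int)
    then obtain x where x: "U - ?W = {x}" by (auto simp: card_1_singleton_iff)
    then have "U = insert x ?e" "x \<in> V - ?W" using e by blast+
    then show "U \<in> ?f ` (shadow X \<times> (V - ?W))" using e(1) by (intro image_eqI[of _ _ "(?e, x)"]) auto
  next
    fix U assume "U \<in> ?f ` (shadow X \<times> (V - ?W))"
    then obtain q where "q \<in> shadow X \<times> (V - ?W)" "U = ?f q" by blast
    moreover obtain e x where "q = (e, x)" by (cases q)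
    ultimately have *: "e \<in> shadow X" "x \<in> V" "x \<notin> ?W" "U = insert x e"
      by simp_all
    have "U \<inter> ?W = e" using * sh(1)[OF *(1)] by blast
    moreover have "x \<notin> e" using * sh(1)[OF *(1)] by blast
    then have "card U = 3" using *(4) sh[OF *(1)] by simp
    moreover have "U \<subseteq> V" using * sh(1)[OF *(1)] cD(7) by blast
    ultimately show "U \<in> pair_idx X Y" using *(1) by (auto simp: pair_idx_def triples_def)
  qed
  then have "card (pair_idx X Y) = card (shadow X \<times> (V - ?W))" using card_image[OF inj] by simp
  also have "\<dots> = card (shadow X) * (card V - card ?W)"
    using card_Diff_subset[OF cD(8,7)] by (simp add: card_cartesian_product)
  finally show ?thesis .
qed

text \<open>Such a conflict has \<open>i - 1\<close> vertices off the support; once these are chosen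
  its vertex set is fixed and \<open>kappa i\<close> counts the possibilities.\<close>

lemma card_conflicts_at:
  assumes cons: "consistent X Y" and T: "T \<in> X" and i: "3 \<le> i" "i \<le> k"
  shows "card {S. conflict k S \<and> S \<subseteq> triples V \<and> T \<in> S \<and> \<Union>S \<inter> \<Union>(X \<union> Y) = T \<and> card S = i}
    = (card V - card (\<Union>(X \<union> Y)) choose (i - 1)) * kappa i"
proof -
  let ?W = "\<Union>(X \<union> Y)"
  let ?Z = "{Z. Z \<subseteq> V - ?W \<and> card Z = i - 1}"
  let ?C = "\<lambda>Z. {S. erdos_configuration S \<and> \<Union>S = T \<union> Z \<and> T \<in> S}"
  note cD = consistentD[OF cons]
  have T3: "card T = 3" "finite T" "T \<subseteq> V" "T \<subseteq> ?W" using T cD(1) tripleD by auto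
  have Z: "finite Z" "T \<inter> Z = {}" "card (T \<union> Z) = i + 2" if "Z \<in> ?Z" for Z
  proof -
    show fZ: "finite Z" using that finite_V finite_subset by auto
    show d: "T \<inter> Z = {}" using that T3(4) by blast
    show "card (T \<union> Z) = i + 2" using card_Un_disjoint[OF T3(2) fZ d] that T3(1) i by simp
  qed
  have eq: "{S. conflict k S \<and> S \<subseteq> triples V \<and> T \<in> S \<and> \<Union>S \<inter> ?W = T \<and> card S = i} = (\<Union>Z\<in>?Z. ?C Z)"
  proof (intro set_eqI iffI)
    fix S assume "S \<in> {S. conflict k S \<and> S \<subseteq> triples V \<and> T \<in> S \<and> \<Union>S \<inter> ?W = T \<and> card S = i}"
    then have S: "conflict k S" "S \<subseteq> triples V" "T \<in> S" "\<Union>S \<inter> ?W = T" "card S = i" by auto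
    have "card (\<Union>S - ?W) = card (\<Union>S) - card (\<Union>S \<inter> ?W)"
      using T3(2) unfolding S(4) by (intro card_Diff_subset_Int[of "\<Union>S" ?W, unfolded S(4)])
    then have "card (\<Union>S - ?W) = i - 1"
      unfolding S(4) using conflict_Union(2)[OF S(1)] S(5) T3(1) by simp
    moreover have "\<Union>S - ?W \<subseteq> V - ?W" using S(2) by (auto simp: triples_def)
    ultimately have "\<Union>S - ?W \<in> ?Z" by simp
    moreover have "\<Union>S = T \<union> (\<Union>S - ?W)" using S(4) by blast
    then have "S \<in> ?C (\<Union>S - ?W)" using S(1,3) by (auto simp: conflict_def)
    ultimately show "S \<in> (\<Union>Z\<in>?Z. ?C Z)" by (rule UN_I)
  next
    fix S assume "S \<in> (\<Union>Z\<in>?Z. ?C Z)"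
    then obtain Z where ZS: "Z \<in> ?Z" "erdos_configuration S" "\<Union>S = T \<union> Z" "T \<in> S" by blast
    have "\<Union>S \<inter> ?W = T" using ZS(1,3) T3(4) by blast
    moreover have "card (\<Union>S) = i + 2" using Z(3)[OF ZS(1)] ZS(3) by simp
    moreover have "S \<subseteq> triples V"
    proof
      fix E assume E: "E \<in> S"
      have "E \<subseteq> T \<union> Z" using E ZS(3) by blast
      also have "\<dots> \<subseteq> V" using ZS(1) T3(3) by blast
      finally show "E \<in> triples V" using erdos_edge[OF ZS(2) E] by (simp add: triples_def)
    qed
    ultimately show "S \<in> {S. conflict k S \<and> S \<subseteq> triples V \<and> T \<in> S \<and> \<Union>S \<inter> ?W = T \<and> card S = i}"
      using ZS i erdos_card(1)[OF ZS(2)] by (simp add: conflict_def)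
  qed
  have "card (\<Union>Z\<in>?Z. ?C Z) = (\<Sum>Z\<in>?Z. card (?C Z))"
  proof (rule card_UN_disjoint)
    show "finite ?Z" using finite_V by simp
    show "\<forall>Z\<in>?Z. finite (?C Z)"
    proof
      fix Z assume Zin: "Z \<in> ?Z"
      have "?C Z \<subseteq> Pow (Pow (T \<union> Z))" by blast
      moreover have "finite (Pow (Pow (T \<union> Z)))" using Z(1)[OF Zin] T3(2) by simp
      ultimately show "finite (?C Z)" by (rule finite_subset)
    qed
    show "\<forall>Z\<in>?Z. \<forall>Z'\<in>?Z. Z \<noteq> Z' \<longrightarrow> ?C Z \<inter> ?C Z' = {}"
    proof (intro ballI impI)
      fix Z Z' assume ZZ: "Z \<in> ?Z" "Z' \<in> ?Z" "Z \<noteq> Z'"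
      then have "T \<union> Z \<noteq> T \<union> Z'" using Z(2) by blast
      then show "?C Z \<inter> ?C Z' = {}" by blast
    qed
  qed
  also have "\<dots> = (\<Sum>Z\<in>?Z. kappa i)"
    using Z T3 by (intro sum.cong refl card_configs_eq_kappa) auto
  also have "\<dots> = (card V - card ?W choose (i - 1)) * kappa i"
    using n_subsets[of "V - ?W" "i - 1"] finite_V card_Diff_subset[OF cD(8,7)] by simp
  finally show ?thesis unfolding eq .
qed

lemma sum_conf_idx:
  fixes g :: "nat \<Rightarrow> real"
  assumes cons: "consistent X Y"
  shows "(\<Sum>(T, S, U)\<in>conf_idx X Y. g (card S)) = real (card X) *
    (\<Sum>i=3..k. real (kappa i) * real (i - 1) * (real (card V - card (\<Union>(X \<union> Y)) choose (i - 1)) * g i))"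
proof -
  let ?W = "\<Union>(X \<union> Y)"
  note cD = consistentD[OF cons]
  let ?CS = "\<lambda>T. {S. conflict k S \<and> S \<subseteq> triples V \<and> T \<in> S \<and> 3 \<le> card S \<and> \<Union>S \<inter> ?W = T}"
  have finCS: "finite (?CS T)" for T
    by (rule finite_subset[of _ "Pow (triples V)"]) (use finite_trip in auto)
  have fS: "finite (S - {T})" if "S \<in> ?CS T" for S T
    using that conflict_card(4) by auto
  have "conf_idx X Y = (SIGMA T:X. SIGMA S:?CS T. S - {T})" by (auto simp: conf_idx_def)
  then have "(\<Sum>(T, S, U)\<in>conf_idx X Y. g (card S)) = (\<Sum>T\<in>X. \<Sum>(S, U)\<in>(SIGMA S:?CS T. S - {T}). g (card S))"
    using cD(4) finCS fS by (simp only:) (subst sum.Sigma, auto)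
  also have "\<dots> = (\<Sum>T\<in>X. \<Sum>S\<in>?CS T. \<Sum>U\<in>S - {T}. g (card S))"
    using finCS fS by (intro sum.cong refl sum.Sigma[symmetric]) auto
  also have "\<dots> = (\<Sum>T\<in>X. \<Sum>S\<in>?CS T. real (card S - 1) * g (card S))"
  proof (intro sum.cong refl)
    fix T S assume "S \<in> ?CS T"
    then have "card (S - {T}) = card S - 1" using conflict_card(4) by (subst card_Diff_singleton) auto
    then show "(\<Sum>U\<in>S - {T}. g (card S)) = real (card S - 1) * g (card S)" by simp
  qed
  also have "\<dots> = (\<Sum>T\<in>X. \<Sum>i\<in>{3..k}. \<Sum>S\<in>{S \<in> ?CS T. card S = i}. real (card S - 1) * g (card S))"
    using finCS conflict_card(2) by (intro sum.cong refl sum.group[symmetric]) auto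
  also have "\<dots> = (\<Sum>T\<in>X. \<Sum>i=3..k. real (kappa i) * real (i - 1) * (real (card V - card ?W choose (i - 1)) * g i))"
  proof (intro sum.cong refl)
    fix T i assume T: "T \<in> X" and i: "i \<in> {3..k}"
    have "{S \<in> ?CS T. card S = i}
        = {S. conflict k S \<and> S \<subseteq> triples V \<and> T \<in> S \<and> \<Union>S \<inter> ?W = T \<and> card S = i}" using i by auto
    then have c: "card {S \<in> ?CS T. card S = i} = (card V - card ?W choose (i - 1)) * kappa i"
      using card_conflicts_at[OF cons T] i by simp
    have "(\<Sum>S\<in>{S \<in> ?CS T. card S = i}. real (card S - 1) * g (card S))
        = (\<Sum>S\<in>{S \<in> ?CS T. card S = i}. real (i - 1) * g i)" by (intro sum.cong) auto
    also have "\<dots> = real (card {S \<in> ?CS T. card S = i}) * (real (i - 1) * g i)"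
      by (rule sum_constant)
    finally show "(\<Sum>S\<in>{S \<in> ?CS T. card S = i}. real (card S - 1) * g (card S))
        = real (kappa i) * real (i - 1) * (real (card V - card ?W choose (i - 1)) * g i)"
      unfolding c by (simp only: of_nat_mult mult_ac)
  qed
  also have "\<dots> = real (card X) * (\<Sum>i=3..k. real (kappa i) * real (i - 1) * (real (card V - card ?W choose (i - 1)) * g i))"
    by simp
  finally show ?thesis .
qed

text \<open>The sums of \<open>drift_op\<close> have total weight of order n, with a factor linear
  in \<open>m\<close>. The range \<open>m + k\<close> suffices because a conflict with at most
  \<open>k\<close> edges adds fewer than \<open>k\<close> triples.\<close>

lemma drift_op_diff_le:
  assumes cons: "consistent X Y" and m: "card X + card Y \<le> m" and e: "0 \<le> e"
    and R: "\<And>X' Y'. consistent X' Y' \<Longrightarrow> card X' + card Y' \<le> m + k \<Longrightarrow> \<bar>R X' Y' - R' X' Y'\<bar> \<le> e"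
  shows "\<bar>drift_op R X Y - drift_op R' X Y\<bar> \<le> real (card V) * (real m * lip_const k * e)"
proof -
  let ?n = "real (card V)" and ?W = "\<Union>(X \<union> Y)"
  let ?S = "\<Sum>i=3..k. real (kappa i) * real (i - 1)"
  have n: "?n > 0" using card_V_ge by simp
  note cD = consistentD[OF cons]
  have S0: "0 \<le> ?S" by (intro sum_nonneg) auto
  have 1: "\<bar>(\<Sum>c\<in>Y. R (insert c X) (Y - {c})) - (\<Sum>c\<in>Y. R' (insert c X) (Y - {c}))\<bar> \<le> real (card Y) * e"
    unfolding sum_subtractf[symmetric]
  proof (rule order_trans[OF sum_abs sum_bounded_above])
    fix c assume c: "c \<in> Y"
    have "card Y = Suc (card (Y - {c}))" using c cD(5) by (metis card.remove)
    then show "\<bar>R (insert c X) (Y - {c}) - R' (insert c X) (Y - {c})\<bar> \<le> e"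
      using chosen_extend[OF cons c] m cD(4) by (intro R) auto
  qed
  have 2: "\<bar>(\<Sum>U\<in>pair_idx X Y. R (insert U X) Y) - (\<Sum>U\<in>pair_idx X Y. R' (insert U X) Y)\<bar>
      \<le> ?n * (3 * real (card X)) * e"
  proof -
    have "\<bar>(\<Sum>U\<in>pair_idx X Y. R (insert U X) Y) - (\<Sum>U\<in>pair_idx X Y. R' (insert U X) Y)\<bar>
        \<le> real (card (pair_idx X Y)) * e"
      unfolding sum_subtractf[symmetric]
    proof (rule order_trans[OF sum_abs sum_bounded_above])
      fix U assume U: "U \<in> pair_idx X Y"
      show "\<bar>R (insert U X) Y - R' (insert U X) Y\<bar> \<le> e"
        using pair_idx_extend[OF cons U] m cD(4) k_ge by (intro R) auto
    qed
    also have "real (card (pair_idx X Y)) \<le> ?n * (3 * real (card X))"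
    proof -
      have "card (shadow X) * (card V - card ?W) \<le> 3 * card X * card V"
        using card_shadow_le[OF cons] by (intro mult_le_mono) auto
      then have "real (card (pair_idx X Y)) \<le> real (3 * card X * card V)"
        unfolding card_pair_idx[OF cons] by (rule of_nat_mono)
      then show ?thesis by (simp add: mult_ac)
    qed
    finally show ?thesis using e by (simp add: mult_right_mono)
  qed
  have 3: "\<bar>(\<Sum>(T, S, U)\<in>conf_idx X Y. (1 / ?n) ^ (card S - 2) * R (insert U X) (Y \<union> (S - {T, U})))
       - (\<Sum>(T, S, U)\<in>conf_idx X Y. (1 / ?n) ^ (card S - 2) * R' (insert U X) (Y \<union> (S - {T, U})))\<bar>
      \<le> ?n * (real (card X) * ?S) * e" (is "\<bar>?A - ?B\<bar> \<le> _")
  proof -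
    have "?A - ?B = (\<Sum>(T, S, U)\<in>conf_idx X Y. (1 / ?n) ^ (card S - 2) *
        (R (insert U X) (Y \<union> (S - {T, U})) - R' (insert U X) (Y \<union> (S - {T, U}))))"
      by (simp add: sum_subtractf[symmetric] case_prod_unfold right_diff_distrib)
    also have "\<bar>\<dots>\<bar> \<le> (\<Sum>(T, S, U)\<in>conf_idx X Y. (1 / ?n) ^ (card S - 2) * e)"
    proof (rule order_trans[OF sum_abs sum_mono], clarify)
      fix T S U assume i: "(T, S, U) \<in> conf_idx X Y"
      have "\<bar>R (insert U X) (Y \<union> (S - {T, U})) - R' (insert U X) (Y \<union> (S - {T, U}))\<bar> \<le> e"
        using conf_idx_extend[OF cons i] m cD(4) by (intro R) auto
      then show "\<bar>(1 / ?n) ^ (card S - 2) *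
        (R (insert U X) (Y \<union> (S - {T, U})) - R' (insert U X) (Y \<union> (S - {T, U})))\<bar> \<le> (1 / ?n) ^ (card S - 2) * e"
        unfolding abs_mult by (intro mult_mono) auto
    qed
    also have "\<dots> = real (card X) * (\<Sum>i=3..k. real (kappa i) * real (i - 1)
        * (real (card V - card ?W choose (i - 1)) * ((1 / ?n) ^ (i - 2) * e)))"
      by (rule sum_conf_idx[OF cons])
    also have "\<dots> \<le> real (card X) * (\<Sum>i=3..k. real (kappa i) * real (i - 1) * (?n * e))"
    proof (intro mult_left_mono sum_mono)
      fix i assume i: "i \<in> {3..k}"
      have "(card V - card ?W choose (i - 1)) \<le> card V choose (i - 1)" by (rule binomial_right_mono) simp
      also have "\<dots> \<le> card V ^ (i - 1)"
        using binomial_le_pow[of "i - 1" "card V"] by (cases "i - 1 \<le> card V") (auto simp: binomial_eq_0)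
      finally have "real (card V - card ?W choose (i - 1)) \<le> ?n ^ (i - 1)"
        by (metis of_nat_le_iff of_nat_power)
      then have "real (card V - card ?W choose (i - 1)) * (1 / ?n) ^ (i - 2) \<le> ?n ^ (i - 1) * (1 / ?n) ^ (i - 2)"
        by (intro mult_right_mono) auto
      also have "?n ^ (i - 1) = ?n * ?n ^ (i - 2)"
      proof -
        have "i - 1 = Suc (i - 2)" using i by auto
        then show ?thesis by simp
      qed
      also have "?n * ?n ^ (i - 2) * (1 / ?n) ^ (i - 2) = ?n" using n by (simp add: power_one_over)
      finally have "real (card V - card ?W choose (i - 1)) * (1 / ?n) ^ (i - 2) * e \<le> ?n * e"
        using e by (rule mult_right_mono)
      then show "real (card V - card ?W choose (i - 1)) * ((1 / ?n) ^ (i - 2) * e) \<le> ?n * e"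
        by (simp add: mult.assoc)
    qed auto
    also have "\<dots> = ?n * (real (card X) * ?S) * e" by (simp add: sum_distrib_right sum_distrib_left mult_ac)
    finally show ?thesis .
  qed
  have "\<bar>drift_op R X Y - drift_op R' X Y\<bar> \<le> ?n * (real (card Y) * e)
      + ?n * (3 * real (card X)) * e + ?n * (real (card X) * ?S) * e"
  proof -
    have *: "\<bar>?n * (\<Sum>c\<in>Y. R (insert c X) (Y - {c})) - ?n * (\<Sum>c\<in>Y. R' (insert c X) (Y - {c}))\<bar>
      \<le> ?n * (real (card Y) * e)"
      using mult_left_mono[OF 1, of ?n] n by (simp add: abs_mult flip: right_diff_distrib)
    show ?thesis unfolding drift_op_def using * 2 3 by linarith
  qed
  also have "\<dots> = ?n * ((real (card Y) + (3 + ?S) * real (card X)) * e)" by (simp add: algebra_simps)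
  also have "\<dots> \<le> ?n * ((real m * (3 + ?S)) * e)"
  proof (intro mult_left_mono mult_right_mono)
    have "real (card Y) + (3 + ?S) * real (card X) \<le> (3 + ?S) * real (card Y) + (3 + ?S) * real (card X)"
      using S0 mult_right_mono[of 1 "3 + ?S" "real (card Y)"] by simp
    also have "\<dots> = (3 + ?S) * real (card X + card Y)" by (simp add: algebra_simps)
    also have "\<dots> \<le> (3 + ?S) * real m" using S0 m by (intro mult_left_mono) auto
    finally show "real (card Y) + (3 + ?S) * real (card X) \<le> real m * (3 + ?S)" by (simp add: mult.commute)
  qed (use e n in auto)
  finally show ?thesis by (simp add: lip_const_def)
qed

definition lim_prob :: "real \<Rightarrow> 'a set set \<Rightarrow> 'a set set \<Rightarrow> real" where
  "lim_prob p X Y = lim_val k p (card Y) (card (shadow X)) (card X)"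

text \<open>On the product, the terms of each sum depend at most on the size of the conflict, so
  only the numbers of indices need comparing with their leading order in n.\<close>

lemma drift_op_lim:
  assumes cons: "consistent X Y" and m: "card X + card Y \<le> m" and p: "0 \<le> p" "p \<le> 1"
  shows "\<bar>drift_op (lim_prob p) X Y
    - real (card V) * lim_drift k p (card Y) (card (shadow X)) (card X)\<bar> \<le> count_const k m"
proof -
  let ?n = "real (card V)" and ?W = "\<Union>(X \<union> Y)"
  let ?y = "card Y" and ?b = "card (shadow X)" and ?a = "card X"
  let ?S = "\<Sum>i=3..k. real (kappa i) * real (i - 1)"
  have n: "?n > 0" using card_V_ge by simp
  note cD = consistentD[OF cons]
  have Wm: "card ?W \<le> 3 * m" using card_support_le[OF cons] m by simp
  have WV: "card ?W \<le> card V" using card_mono[OF finite_V cD(7)] .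
  note lv = lim_val_bounds[OF p, of k]
  let ?q = "lim_val k p ?y (?b + 2) (?a + 1)" and ?r = "lim_val k p ?y (?b + 3) (?a + 1)"
  have 1: "(\<Sum>c\<in>Y. lim_prob p (insert c X) (Y - {c})) = real ?y * lim_val k p (?y - 1) (?b + 3) (?a + 1)"
  proof -
    have "(\<Sum>c\<in>Y. lim_prob p (insert c X) (Y - {c})) = (\<Sum>c\<in>Y. lim_val k p (?y - 1) (?b + 3) (?a + 1))"
      using chosen_extend[OF cons] card_shadow_chosen[OF cons] cD(4,5)
      by (intro sum.cong) (auto simp: lim_prob_def)
    then show ?thesis by simp
  qed
  have 2: "(\<Sum>U\<in>pair_idx X Y. lim_prob p (insert U X) Y) = real ?b * (?n - real (card ?W)) * ?q"
  proof -
    have "(\<Sum>U\<in>pair_idx X Y. lim_prob p (insert U X) Y) = (\<Sum>U\<in>pair_idx X Y. ?q)"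
      using pair_idx_extend[OF cons] card_shadow_pair[OF cons] cD(4)
      by (intro sum.cong) (auto simp: lim_prob_def)
    then show ?thesis using WV by (simp add: card_pair_idx[OF cons] of_nat_diff)
  qed
  have 3: "(\<Sum>(T, S, U)\<in>conf_idx X Y. (1 / ?n) ^ (card S - 2) * lim_prob p (insert U X) (Y \<union> (S - {T, U})))
     = real ?a * (\<Sum>i=3..k. real (kappa i) * real (i - 1) *
        (real (card V - card ?W choose (i - 1)) * ((1 / ?n) ^ (i - 2) * (p ^ (i - 2) * ?r))))"
  proof -
    have "(\<Sum>(T, S, U)\<in>conf_idx X Y. (1 / ?n) ^ (card S - 2) * lim_prob p (insert U X) (Y \<union> (S - {T, U})))
      = (\<Sum>(T, S, U)\<in>conf_idx X Y. (1 / ?n) ^ (card S - 2) * (p ^ (card S - 2) * ?r))"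
    proof (intro sum.cong refl, clarify)
      fix T S U assume i: "(T, S, U) \<in> conf_idx X Y"
      have "card (insert U X) = ?a + 1" using conf_idx_extend(2)[OF cons i] cD(4) by simp
      then show "(1 / ?n) ^ (card S - 2) * lim_prob p (insert U X) (Y \<union> (S - {T, U}))
         = (1 / ?n) ^ (card S - 2) * (p ^ (card S - 2) * ?r)"
        unfolding lim_prob_def lim_val_def conf_idx_extend(3)[OF cons i] card_shadow_conf[OF cons i]
        by (simp add: power_add)
    qed
    also have "\<dots> = real ?a * (\<Sum>i=3..k. real (kappa i) * real (i - 1) *
        (real (card V - card ?W choose (i - 1)) * ((1 / ?n) ^ (i - 2) * (p ^ (i - 2) * ?r))))"
      by (rule sum_conf_idx[OF cons])
    finally show ?thesis .
  qed
  have b3: "real ?b \<le> 3 * real m" using card_shadow_le[OF cons] m by linarith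
  have conf: "\<bar>real ?a * (\<Sum>i=3..k. real (kappa i) * real (i - 1) *
        (real (card V - card ?W choose (i - 1)) * ((1 / ?n) ^ (i - 2) * (p ^ (i - 2) * ?r))))
     - ?n * (real ?a * closure_exponent' k p * ?r)\<bar> \<le> real m * (?S * (1 + real (3 * m) + real k) ^ k)"
  proof -
    let ?d = "\<lambda>i. real (card V - card ?W choose (i - 1)) * (1 / ?n) ^ (i - 2) - ?n / fact (i - 1)"
    have eq: "real ?a * (\<Sum>i=3..k. real (kappa i) * real (i - 1) *
        (real (card V - card ?W choose (i - 1)) * ((1 / ?n) ^ (i - 2) * (p ^ (i - 2) * ?r))))
     - ?n * (real ?a * closure_exponent' k p * ?r)
     = real ?a * (\<Sum>i=3..k. real (kappa i) * real (i - 1) * (?d i * (p ^ (i - 2) * ?r)))"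
      by (simp add: closure_exponent'_def sum_distrib_left sum_distrib_right flip: sum_subtractf)
        (simp add: algebra_simps)
    have "\<bar>real ?a * (\<Sum>i=3..k. real (kappa i) * real (i - 1) * (?d i * (p ^ (i - 2) * ?r)))\<bar>
        = real ?a * \<bar>\<Sum>i=3..k. real (kappa i) * real (i - 1) * (?d i * (p ^ (i - 2) * ?r))\<bar>"
      by (simp add: abs_mult)
    also have "\<dots> \<le> real m * (\<Sum>i=3..k. real (kappa i) * real (i - 1) * (1 + real (3 * m) + real k) ^ k)"
    proof (intro mult_mono order_trans[OF sum_abs] sum_mono)
      fix i assume i: "i \<in> {3..k}"
      have "\<bar>real (card V - card ?W choose (i - 1)) * (1 / ?n) ^ (i - 1 - 1) - ?n / fact (i - 1)\<bar>
          \<le> (1 + real (3 * m) + real k) ^ k"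
        using WV Wm i card_V_ge by (intro binomial_scaled_approx) auto
      moreover have "i - 1 - 1 = i - 2" by simp
      ultimately have d: "\<bar>?d i\<bar> \<le> (1 + real (3 * m) + real k) ^ k" by (simp only:)
      have "\<bar>p ^ (i - 2) * ?r\<bar> \<le> 1 * 1"
        unfolding abs_mult using p lv by (intro mult_mono) (auto simp: power_le_one)
      then have "\<bar>?d i * (p ^ (i - 2) * ?r)\<bar> \<le> (1 + real (3 * m) + real k) ^ k * 1"
        unfolding abs_mult[of "?d i"] using d by (intro mult_mono) auto
      then show "\<bar>real (kappa i) * real (i - 1) * (?d i * (p ^ (i - 2) * ?r))\<bar>
          \<le> real (kappa i) * real (i - 1) * (1 + real (3 * m) + real k) ^ k"
        unfolding abs_mult[of "real (kappa i) * real (i - 1)"] by (intro mult_mono) auto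
    qed (use m in auto)
    finally show ?thesis unfolding eq sum_distrib_right .
  qed
  have pair: "\<bar>real ?b * (?n - real (card ?W)) * ?q - ?n * (real ?b * ?q)\<bar> \<le> 9 * real m * real m"
  proof -
    have "\<bar>real ?b * (?n - real (card ?W)) * ?q - ?n * (real ?b * ?q)\<bar> = real ?b * real (card ?W) * ?q"
      using lv(1) by (simp add: algebra_simps abs_mult)
    also have "\<dots> \<le> (3 * real m) * (3 * real m) * 1"
      using b3 Wm lv by (intro mult_mono) auto
    finally show ?thesis by simp
  qed
  define A where "A = real ?a * (\<Sum>i=3..k. real (kappa i) * real (i - 1) *
        (real (card V - card ?W choose (i - 1)) * ((1 / ?n) ^ (i - 2) * (p ^ (i - 2) * ?r))))"
  have "drift_op (lim_prob p) X Y - ?n * lim_drift k p ?y ?b ?a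
    = - (real ?b * (?n - real (card ?W)) * ?q - ?n * (real ?b * ?q))
      - (A - ?n * (real ?a * closure_exponent' k p * ?r))"
    unfolding drift_op_def 1 2 3 lim_drift_def A_def[symmetric] by (simp only: right_diff_distrib)
  then show ?thesis using conf[folded A_def] pair unfolding count_const_def by linarith
qed

end

text \<open>A quantitative form of differentiability on the unit interval with derivative
  \<open>f'\<close>: bounds, a Lipschitz estimate and a quadratic remainder with one constant. It is
  stable under products and \<open>exp\<close> and yields the Euler error directly.\<close>

definition taylor2 :: "(real \<Rightarrow> real) \<Rightarrow> (real \<Rightarrow> real) \<Rightarrow> bool" where
  "taylor2 f f' \<longleftrightarrow> (\<exists>C\<ge>0. \<forall>p\<in>{0..1}. \<forall>q\<in>{0..1}.
     \<bar>f p\<bar> \<le> C \<and> \<bar>f' p\<bar> \<le> C \<and> \<bar>f q - f p\<bar> \<le> C * \<bar>q - p\<bar> \<and>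
     \<bar>f q - f p - f' p * (q - p)\<bar> \<le> C * (q - p)\<^sup>2)"

lemma taylor2E:
  assumes "taylor2 f f'"
  obtains C where "0 \<le> C" "\<And>p. p \<in> {0..1} \<Longrightarrow> \<bar>f p\<bar> \<le> C" "\<And>p. p \<in> {0..1} \<Longrightarrow> \<bar>f' p\<bar> \<le> C"
    "\<And>p q. p \<in> {0..1} \<Longrightarrow> q \<in> {0..1} \<Longrightarrow> \<bar>f q - f p\<bar> \<le> C * \<bar>q - p\<bar>"
    "\<And>p q. p \<in> {0..1} \<Longrightarrow> q \<in> {0..1} \<Longrightarrow> \<bar>f q - f p - f' p * (q - p)\<bar> \<le> C * (q - p)\<^sup>2"
  using assms unfolding taylor2_def by blast

lemma taylor2_const: "taylor2 (\<lambda>p. c) (\<lambda>p. 0)"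
  unfolding taylor2_def by (rule exI[of _ "\<bar>c\<bar>"]) auto

lemma taylor2_ident: "taylor2 (\<lambda>p. p) (\<lambda>p. 1)"
  unfolding taylor2_def by (rule exI[of _ 1]) auto

lemma taylor2_add:
  assumes "taylor2 f f'" "taylor2 g g'"
  shows "taylor2 (\<lambda>p. f p + g p) (\<lambda>p. f' p + g' p)"
proof -
  obtain C where C: "0 \<le> C" "\<And>p. p \<in> {0..1} \<Longrightarrow> \<bar>f p\<bar> \<le> C" "\<And>p. p \<in> {0..1} \<Longrightarrow> \<bar>f' p\<bar> \<le> C"
    "\<And>p q. p \<in> {0..1} \<Longrightarrow> q \<in> {0..1} \<Longrightarrow> \<bar>f q - f p\<bar> \<le> C * \<bar>q - p\<bar>"
    "\<And>p q. p \<in> {0..1} \<Longrightarrow> q \<in> {0..1} \<Longrightarrow> \<bar>f q - f p - f' p * (q - p)\<bar> \<le> C * (q - p)\<^sup>2"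
    using taylor2E[OF assms(1)] by metis
  obtain D where D: "0 \<le> D" "\<And>p. p \<in> {0..1} \<Longrightarrow> \<bar>g p\<bar> \<le> D" "\<And>p. p \<in> {0..1} \<Longrightarrow> \<bar>g' p\<bar> \<le> D"
    "\<And>p q. p \<in> {0..1} \<Longrightarrow> q \<in> {0..1} \<Longrightarrow> \<bar>g q - g p\<bar> \<le> D * \<bar>q - p\<bar>"
    "\<And>p q. p \<in> {0..1} \<Longrightarrow> q \<in> {0..1} \<Longrightarrow> \<bar>g q - g p - g' p * (q - p)\<bar> \<le> D * (q - p)\<^sup>2"
    using taylor2E[OF assms(2)] by metis
  show ?thesis unfolding taylor2_def
  proof (intro exI[of _ "C + D"] conjI ballI)
    show "0 \<le> C + D" using C(1) D(1) by simp
    fix p q :: real assume pq: "p \<in> {0..1}" "q \<in> {0..1}"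
    note c = C(2,3)[OF pq(1)] C(4,5)[OF pq] and d = D(2,3)[OF pq(1)] D(4,5)[OF pq]
    show "\<bar>f p + g p\<bar> \<le> C + D" using c(1) d(1) by linarith
    show "\<bar>f' p + g' p\<bar> \<le> C + D" using c(2) d(2) by linarith
    show "\<bar>(f q + g q) - (f p + g p)\<bar> \<le> (C + D) * \<bar>q - p\<bar>"
      unfolding distrib_right using c(3) d(3) by linarith
    show "\<bar>(f q + g q) - (f p + g p) - (f' p + g' p) * (q - p)\<bar> \<le> (C + D) * (q - p)\<^sup>2"
      unfolding distrib_right using c(4) d(4) by linarith
  qed
qed

lemma taylor2_mult:
  assumes "taylor2 f f'" "taylor2 g g'"
  shows "taylor2 (\<lambda>p. f p * g p) (\<lambda>p. f' p * g p + f p * g' p)"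
proof -
  obtain C where C: "0 \<le> C" "\<And>p. p \<in> {0..1} \<Longrightarrow> \<bar>f p\<bar> \<le> C" "\<And>p. p \<in> {0..1} \<Longrightarrow> \<bar>f' p\<bar> \<le> C"
    "\<And>p q. p \<in> {0..1} \<Longrightarrow> q \<in> {0..1} \<Longrightarrow> \<bar>f q - f p\<bar> \<le> C * \<bar>q - p\<bar>"
    "\<And>p q. p \<in> {0..1} \<Longrightarrow> q \<in> {0..1} \<Longrightarrow> \<bar>f q - f p - f' p * (q - p)\<bar> \<le> C * (q - p)\<^sup>2"
    using taylor2E[OF assms(1)] by metis
  obtain D where D: "0 \<le> D" "\<And>p. p \<in> {0..1} \<Longrightarrow> \<bar>g p\<bar> \<le> D" "\<And>p. p \<in> {0..1} \<Longrightarrow> \<bar>g' p\<bar> \<le> D"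
    "\<And>p q. p \<in> {0..1} \<Longrightarrow> q \<in> {0..1} \<Longrightarrow> \<bar>g q - g p\<bar> \<le> D * \<bar>q - p\<bar>"
    "\<And>p q. p \<in> {0..1} \<Longrightarrow> q \<in> {0..1} \<Longrightarrow> \<bar>g q - g p - g' p * (q - p)\<bar> \<le> D * (q - p)\<^sup>2"
    using taylor2E[OF assms(2)] by metis
  have CD: "0 \<le> C * D" using C(1) D(1) by simp
  show ?thesis unfolding taylor2_def
  proof (intro exI[of _ "3 * (C * D)"] conjI ballI)
    show "0 \<le> 3 * (C * D)" using CD by simp
    fix p q :: real assume pq: "p \<in> {0..1}" "q \<in> {0..1}"
    note c = C(2,3)[OF pq(1)] C(4,5)[OF pq] and d = D(2,3)[OF pq(1)] D(4,5)[OF pq]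
    have cq: "\<bar>f q\<bar> \<le> C" by (rule C(2)[OF pq(2)])
    have b: "\<bar>f p * g p\<bar> \<le> C * D" "\<bar>f' p * g p\<bar> \<le> C * D" "\<bar>f p * g' p\<bar> \<le> C * D"
      unfolding abs_mult by (intro mult_mono c d C(1) abs_ge_zero)+
    show "\<bar>f p * g p\<bar> \<le> 3 * (C * D)" using b CD by linarith
    show "\<bar>f' p * g p + f p * g' p\<bar> \<le> 3 * (C * D)" using b CD by linarith
    have 1: "\<bar>(f q - f p) * g p\<bar> \<le> (C * \<bar>q - p\<bar>) * D"
      unfolding abs_mult by (intro mult_mono c d C(1) D(1) mult_nonneg_nonneg abs_ge_zero zero_le_power2)
    have 2: "\<bar>f q * (g q - g p)\<bar> \<le> C * (D * \<bar>q - p\<bar>)"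
      unfolding abs_mult by (intro mult_mono cq d C(1) mult_nonneg_nonneg abs_ge_zero)
    have "f q * g q - f p * g p = (f q - f p) * g p + f q * (g q - g p)" by (simp add: algebra_simps)
    then have "\<bar>f q * g q - f p * g p\<bar> \<le> (C * \<bar>q - p\<bar>) * D + C * (D * \<bar>q - p\<bar>)"
      using 1 2 by linarith
    also have "\<dots> = 2 * (C * D) * \<bar>q - p\<bar>" by simp
    also have "\<dots> \<le> 3 * (C * D) * \<bar>q - p\<bar>" using CD by (intro mult_right_mono) auto
    finally show "\<bar>f q * g q - f p * g p\<bar> \<le> 3 * (C * D) * \<bar>q - p\<bar>" .
    have 3: "\<bar>(f q - f p - f' p * (q - p)) * g p\<bar> \<le> (C * (q - p)\<^sup>2) * D"
      unfolding abs_mult by (intro mult_mono c d C(1) D(1) mult_nonneg_nonneg abs_ge_zero zero_le_power2)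
    have 4: "\<bar>f p * (g q - g p - g' p * (q - p))\<bar> \<le> C * (D * (q - p)\<^sup>2)"
      unfolding abs_mult by (intro mult_mono c d C(1) D(1) mult_nonneg_nonneg abs_ge_zero zero_le_power2)
    have 5: "\<bar>(f q - f p) * (g q - g p)\<bar> \<le> (C * \<bar>q - p\<bar>) * (D * \<bar>q - p\<bar>)"
      unfolding abs_mult by (intro mult_mono c d C(1) D(1) mult_nonneg_nonneg abs_ge_zero zero_le_power2)
    have sq: "\<bar>q - p\<bar> * \<bar>q - p\<bar> = (q - p)\<^sup>2" by (simp add: power2_eq_square flip: abs_mult)
    have "f q * g q - f p * g p - (f' p * g p + f p * g' p) * (q - p)
        = (f q - f p - f' p * (q - p)) * g p + f p * (g q - g p - g' p * (q - p))
          + (f q - f p) * (g q - g p)" by (simp add: algebra_simps)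
    then have "\<bar>f q * g q - f p * g p - (f' p * g p + f p * g' p) * (q - p)\<bar>
        \<le> (C * (q - p)\<^sup>2) * D + C * (D * (q - p)\<^sup>2) + (C * \<bar>q - p\<bar>) * (D * \<bar>q - p\<bar>)"
      using 3 4 5 by linarith
    also have "(C * \<bar>q - p\<bar>) * (D * \<bar>q - p\<bar>) = C * D * (q - p)\<^sup>2" by (simp add: mult_ac flip: sq)
    finally show "\<bar>f q * g q - f p * g p - (f' p * g p + f p * g' p) * (q - p)\<bar> \<le> 3 * (C * D) * (q - p)\<^sup>2"
      by (simp add: mult_ac)
  qed
qed

lemma exp_minus_one_bound: "\<bar>exp x - 1\<bar> \<le> \<bar>x\<bar> * exp \<bar>x\<bar>" for x :: real
proof -
  have 1: "1 + x \<le> exp x" "1 - x \<le> exp (- x)" using exp_ge_add_one_self[of x] exp_ge_add_one_self[of "-x"] by auto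
  have "(1 - x) * exp x \<le> exp (- x) * exp x" using 1(2) by (intro mult_right_mono) auto
  then have 2: "exp x - 1 \<le> x * exp x" by (simp add: algebra_simps flip: exp_add)
  show ?thesis
  proof (cases "x \<ge> 0")
    case False
    then have "- x * 1 \<le> - x * exp (- x)" by (intro mult_left_mono) auto
    moreover have "\<bar>exp x - 1\<bar> = 1 - exp x" "\<bar>x\<bar> * exp \<bar>x\<bar> = - x * exp (- x)" using False by auto
    ultimately show ?thesis using 1(1) by linarith
  qed (use 2 in simp)
qed

lemma exp_taylor_bound: "\<bar>exp x - 1 - x\<bar> \<le> x\<^sup>2 * exp \<bar>x\<bar>" for x :: real
proof -
  have 1: "1 + x \<le> exp x" "1 - x \<le> exp (- x)" using exp_ge_add_one_self[of x] exp_ge_add_one_self[of "-x"] by auto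
  have "(1 - x) * exp x \<le> exp (- x) * exp x" using 1(2) by (intro mult_right_mono) auto
  then have "exp x - 1 - x \<le> x * (exp x - 1)" by (simp add: algebra_simps flip: exp_add)
  also have "\<dots> \<le> \<bar>x\<bar> * \<bar>exp x - 1\<bar>" by (simp flip: abs_mult)
  also have "\<dots> \<le> \<bar>x\<bar> * (\<bar>x\<bar> * exp \<bar>x\<bar>)" using exp_minus_one_bound by (intro mult_left_mono) auto
  also have "\<dots> = x\<^sup>2 * exp \<bar>x\<bar>" by (simp add: power2_eq_square flip: abs_mult mult.assoc)
  finally show ?thesis using 1(1) by linarith
qed

text \<open>The factor \<open>exp (g p)\<close> splits off, and the elementary bounds for
  \<open>exp\<close> near 0 apply to the increment \<open>g q - g p\<close>, which is bounded by
  \<open>C\<close>.\<close>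

lemma taylor2_exp:
  assumes "taylor2 g g'"
  shows "taylor2 (\<lambda>p. exp (g p)) (\<lambda>p. exp (g p) * g' p)"
proof -
  obtain C where C: "0 \<le> C" "\<And>p. p \<in> {0..1} \<Longrightarrow> \<bar>g p\<bar> \<le> C" "\<And>p. p \<in> {0..1} \<Longrightarrow> \<bar>g' p\<bar> \<le> C"
    "\<And>p q. p \<in> {0..1} \<Longrightarrow> q \<in> {0..1} \<Longrightarrow> \<bar>g q - g p\<bar> \<le> C * \<bar>q - p\<bar>"
    "\<And>p q. p \<in> {0..1} \<Longrightarrow> q \<in> {0..1} \<Longrightarrow> \<bar>g q - g p - g' p * (q - p)\<bar> \<le> C * (q - p)\<^sup>2"
    using taylor2E[OF assms(1)] by metis
  obtain D where D: "exp C \<le> D" "exp C * C \<le> D" "exp C * (C * exp C) \<le> D"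
      "exp C * (C * C * exp C) + exp C * C \<le> D" "0 \<le> D"
  proof -
    let ?D = "exp C + exp C * C + exp C * (C * exp C) + (exp C * (C * C * exp C) + exp C * C)"
    have "0 \<le> exp C" "0 \<le> exp C * C" "0 \<le> exp C * (C * exp C)" "0 \<le> exp C * (C * C * exp C)"
      using C(1) by auto
    then show thesis by (intro that[of ?D]) linarith+
  qed
  show ?thesis unfolding taylor2_def
  proof (intro exI[of _ D] conjI ballI)
    show "0 \<le> D" by (rule D)
    fix p q :: real assume pq: "p \<in> {0..1}" "q \<in> {0..1}"
    note c = C(2,3)[OF pq(1)] C(4,5)[OF pq]
    have e: "exp (g p) \<le> exp C" using c by simp
    show "\<bar>exp (g p)\<bar> \<le> D" using order_trans[OF e D(1)] by simp
    have "\<bar>exp (g p) * g' p\<bar> \<le> exp C * C" unfolding abs_mult using e c by (intro mult_mono) auto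
    then show "\<bar>exp (g p) * g' p\<bar> \<le> D" using D(2) by linarith
    let ?x = "g q - g p"
    have x1: "\<bar>?x\<bar> \<le> C * 1" 
      using c pq C(1) by (intro order_trans[OF _ mult_left_mono[of "\<bar>q - p\<bar>" 1 C]]) auto
    then have ex: "exp \<bar>?x\<bar> \<le> exp C" by simp
    have eq: "exp (g q) = exp (g p) * exp ?x" by (simp flip: exp_add)
    have "\<bar>exp (g q) - exp (g p)\<bar> = exp (g p) * \<bar>exp ?x - 1\<bar>"
    proof -
      have "exp (g q) - exp (g p) = exp (g p) * (exp ?x - 1)" unfolding eq by (simp add: right_diff_distrib)
      then show ?thesis by (simp add: abs_mult)
    qed
    also have "\<dots> \<le> exp C * ((C * \<bar>q - p\<bar>) * exp C)"
      using e c ex by (intro mult_mono order_trans[OF exp_minus_one_bound] mult_nonneg_nonneg C(1)) auto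
    also have "\<dots> = exp C * (C * exp C) * \<bar>q - p\<bar>" by simp
    also have "\<dots> \<le> D * \<bar>q - p\<bar>" using D by (intro mult_right_mono) auto
    finally show "\<bar>exp (g q) - exp (g p)\<bar> \<le> D * \<bar>q - p\<bar>" .
    have "exp (g q) - exp (g p) - exp (g p) * g' p * (q - p)
        = exp (g p) * (exp ?x - 1 - ?x) + exp (g p) * (?x - g' p * (q - p))"
      unfolding eq by (simp add: algebra_simps)
    also have "\<bar>\<dots>\<bar> \<le> exp (g p) * \<bar>exp ?x - 1 - ?x\<bar> + exp (g p) * \<bar>?x - g' p * (q - p)\<bar>"
      by (rule order_trans[OF abs_triangle_ineq]) (simp add: abs_mult)
    also have "\<dots> \<le> exp C * ((C * \<bar>q - p\<bar>)\<^sup>2 * exp C) + exp C * (C * (q - p)\<^sup>2)"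
    proof (intro add_mono mult_mono e)
      have "?x\<^sup>2 \<le> (C * \<bar>q - p\<bar>)\<^sup>2" using c by (subst abs_le_square_iff[symmetric]) auto
      then show "\<bar>exp ?x - 1 - ?x\<bar> \<le> (C * \<bar>q - p\<bar>)\<^sup>2 * exp C"
        using ex by (intro order_trans[OF exp_taylor_bound] mult_mono) auto
    qed (use c in auto)
    also have "\<dots> = (exp C * (C * C * exp C) + exp C * C) * (q - p)\<^sup>2"
      by (simp add: power_mult_distrib power2_eq_square algebra_simps flip: abs_mult)
    also have "\<dots> \<le> D * (q - p)\<^sup>2" using D by (intro mult_right_mono) auto
    finally show "\<bar>exp (g q) - exp (g p) - exp (g p) * g' p * (q - p)\<bar> \<le> D * (q - p)\<^sup>2" .
  qed
qed

lemma taylor2_cong: "taylor2 f f' \<Longrightarrow> (\<And>p. f p = g p) \<Longrightarrow> (\<And>p. f' p = g' p) \<Longrightarrow> taylor2 g g'"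
  by (simp add: taylor2_def)

lemma taylor2_power:
  assumes "taylor2 f f'"
  shows "taylor2 (\<lambda>p. f p ^ m) (\<lambda>p. real m * f p ^ (m - 1) * f' p)"
proof (induction m)
  case 0
  show ?case by (rule taylor2_cong[OF taylor2_const[of 1]]) auto
next
  case (Suc m)
  show ?case
  proof (rule taylor2_cong[OF taylor2_mult[OF assms Suc]])
    fix p show "f' p * f p ^ m + f p * (real m * f p ^ (m - 1) * f' p) = real (Suc m) * f p ^ (Suc m - 1) * f' p"
      by (cases m) (auto simp: algebra_simps)
  qed simp
qed

lemma taylor2_cmult: "taylor2 f f' \<Longrightarrow> taylor2 (\<lambda>p. c * f p) (\<lambda>p. c * f' p)"
  by (rule taylor2_cong[OF taylor2_mult[OF taylor2_const[of c]]]) auto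

lemma taylor2_sum:
  assumes "finite I" "\<And>i. i \<in> I \<Longrightarrow> taylor2 (f i) (f' i)"
  shows "taylor2 (\<lambda>p. \<Sum>i\<in>I. f i p) (\<lambda>p. \<Sum>i\<in>I. f' i p)"
  using assms
proof (induction I rule: finite_induct)
  case empty show ?case by (rule taylor2_cong[OF taylor2_const[of 0]]) auto
next
  case (insert i I)
  show ?case
    by (rule taylor2_cong[OF taylor2_add[of "f i" "f' i" "\<lambda>p. \<Sum>i\<in>I. f i p" "\<lambda>p. \<Sum>i\<in>I. f' i p"]])
      (use insert in auto)
qed

lemma taylor2_closure: "taylor2 (closure_exponent k) (closure_exponent' k)"
proof -
  have "taylor2 (\<lambda>p. \<Sum>i=3..k. real (kappa i) / fact (i - 1) * p ^ (i - 1))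
      (\<lambda>p. \<Sum>i=3..k. real (kappa i) / fact (i - 1) * (real (i - 1) * p ^ (i - 1 - 1) * 1))"
    by (intro taylor2_sum taylor2_cmult taylor2_power taylor2_ident) simp
  then show ?thesis
    by (rule taylor2_cong) (simp_all add: closure_exponent_def closure_exponent'_def numeral_2_eq_2)
qed

lemma taylor2_survive: "taylor2 (survive k) (\<lambda>p. - closure_exponent' k p * survive k p)"
  by (rule taylor2_cong[OF taylor2_exp[OF taylor2_cmult[OF taylor2_closure, of "-1"]]])
    (auto simp: survive_def)

definition speed :: "nat \<Rightarrow> real \<Rightarrow> real" where
  "speed k p = (1 - p) ^ 3 * survive k p"

text \<open>Multiplying by \<open>speed\<close> contributes three powers of \<open>1 - p\<close> and
  one factor \<open>survive\<close>, which yields the exponents of \<open>lim_drift\<close>. This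
  identity is why the product solves the limiting hierarchy.\<close>

lemma taylor2_lim_val:
  "\<exists>f'. taylor2 (\<lambda>p. lim_val k p y b a) f' \<and> (\<forall>p. f' p * speed k p = lim_drift k p y b a)"
proof -
  have lin: "taylor2 (\<lambda>p. 1 - p) (\<lambda>p. -1)"
    by (rule taylor2_cong[OF taylor2_add[OF taylor2_const[of 1] taylor2_cmult[OF taylor2_ident, of "-1"]]]) auto
  let ?s = "survive k" and ?c = "closure_exponent' k"
  let ?f' = "\<lambda>p. (real y * p ^ (y - 1) * 1 * (1 - p) ^ b + p ^ y * (real b * (1 - p) ^ (b - 1) * -1)) * ?s p ^ a
     + p ^ y * (1 - p) ^ b * (real a * ?s p ^ (a - 1) * (- ?c p * ?s p))"
  have "taylor2 (\<lambda>p. lim_val k p y b a) ?f'"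
    unfolding lim_val_def
    by (intro taylor2_mult taylor2_power taylor2_ident lin taylor2_survive)
  moreover have "?f' p * speed k p = lim_drift k p y b a" for p
  proof -
    \<comment> \<open>For \<open>b = 0\<close> both sides vanish, so the truncated
      \<open>b - 1\<close> is harmless.\<close>
    have b: "real b * (1 - p) ^ (b - 1) * (1 - p) ^ 3 = real b * (1 - p) ^ (b + 2)"
      by (cases b) (simp_all add: power_add power3_eq_cube power2_eq_square)
    have a: "real a * ?s p ^ (a - 1) * ?s p = real a * ?s p ^ a"
      by (cases a) simp_all
    have "?f' p * speed k p
      = real y * p ^ (y - 1) * ((1 - p) ^ b * (1 - p) ^ 3) * (?s p ^ a * ?s p)
        - p ^ y * (real b * (1 - p) ^ (b - 1) * (1 - p) ^ 3) * (?s p ^ a * ?s p)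
        - ?c p * (p ^ y * ((1 - p) ^ b * (1 - p) ^ 3) * (real a * ?s p ^ (a - 1) * ?s p) * ?s p)"
    proof -
      have "((y1 * 1 * A + py * (B * -1)) * sa + py * A * (s1 * (- c * s))) * (A3 * s)
          = y1 * (A * A3) * (sa * s) - py * (B * A3) * (sa * s) - c * (py * (A * A3) * (s1 * s) * s)"
        for y1 A py B sa s1 c s A3 :: real by (simp add: algebra_simps)
      from this[of "real y * p ^ (y - 1)" "(1 - p) ^ b" "p ^ y" "real b * (1 - p) ^ (b - 1)" "?s p ^ a"
          "real a * ?s p ^ (a - 1)" "?c p" "?s p" "(1 - p) ^ 3"]
      show ?thesis unfolding speed_def .
    qed
    also have "\<dots> = lim_drift k p y b a"
      unfolding a b lim_drift_def lim_val_def power_add power_one_right by (simp add: algebra_simps)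
    finally show ?thesis .
  qed
  ultimately show ?thesis by blast
qed

text \<open>The bound by \<open>1 - p\<close> keeps the Euler iterates in the unit interval.\<close>

lemma speed_bounds:
  assumes "0 \<le> p" "p \<le> 1" shows "0 \<le> speed k p" "speed k p \<le> 1 - p" "speed k p \<le> 1"
proof -
  note s = survive_bounds[OF assms(1), of k]
  show "0 \<le> speed k p" using assms s by (simp add: speed_def)
  have "(1 - p) ^ 3 \<le> (1 - p) ^ 1" using assms by (intro power_decreasing) auto
  then have "(1 - p) ^ 3 * survive k p \<le> (1 - p) * 1" using s assms by (intro mult_mono) auto
  then show "speed k p \<le> 1 - p" by (simp add: speed_def)
  then show "speed k p \<le> 1" using assms by simp
qed

lemma lim_val_step:
  "\<exists>C\<ge>0. \<forall>h p. 0 \<le> h \<longrightarrow> h \<le> 1 \<longrightarrow> 0 \<le> p \<longrightarrow> p \<le> 1 \<longrightarrow>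
     \<bar>lim_val k (p + h * speed k p) y b a - lim_val k p y b a - h * lim_drift k p y b a\<bar> \<le> C * h\<^sup>2"
proof -
  obtain f' C where f': "\<And>p. f' p * speed k p = lim_drift k p y b a" and C: "C \<ge> 0"
    "\<And>p q. p \<in> {0..1} \<Longrightarrow> q \<in> {0..1} \<Longrightarrow>
      \<bar>lim_val k q y b a - lim_val k p y b a - f' p * (q - p)\<bar> \<le> C * (q - p)\<^sup>2"
    using taylor2_lim_val[of k y b a] unfolding taylor2_def by blast
  show ?thesis
  proof (intro exI[of _ C] conjI allI impI C(1))
    fix h p :: real assume h: "0 \<le> h" "h \<le> 1" and p: "0 \<le> p" "p \<le> 1"
    note sp = speed_bounds[OF p, of k]
    have "h * speed k p \<le> 1 * (1 - p)" using h sp by (intro mult_mono) auto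
    then have q: "p + h * speed k p \<in> {0..1}" using h p sp by auto
    have "\<bar>lim_val k (p + h * speed k p) y b a - lim_val k p y b a - f' p * (h * speed k p)\<bar>
        \<le> C * (h * speed k p)\<^sup>2" using C(2)[OF _ q, of p] p by simp
    also have "\<dots> \<le> C * h\<^sup>2"
      using sp h C(1) by (intro mult_left_mono power_mono) (auto intro: mult_left_le)
    also have "f' p * (h * speed k p) = h * lim_drift k p y b a" using f'[of p] by (simp add: mult_ac)
    finally show "\<bar>lim_val k (p + h * speed k p) y b a - lim_val k p y b a - h * lim_drift k p y b a\<bar> \<le> C * h\<^sup>2" .
  qed
qed

text \<open>Only finitely many exponents occur up to \<open>m\<close>, so the sum of their constants
  serves for all.\<close>

lemma lim_val_step_uniform:
  "\<exists>C\<ge>0. \<forall>y\<le>m. \<forall>b\<le>m. \<forall>a\<le>m. \<forall>h p. 0 \<le> h \<longrightarrow> h \<le> 1 \<longrightarrow> 0 \<le> p \<longrightarrow> p \<le> 1 \<longrightarrow>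
     \<bar>lim_val k (p + h * speed k p) y b a - lim_val k p y b a - h * lim_drift k p y b a\<bar> \<le> C * h\<^sup>2"
proof -
  obtain C where C: "\<And>y b a. C y b a \<ge> 0" "\<And>y b a h p. 0 \<le> h \<Longrightarrow> h \<le> 1 \<Longrightarrow> 0 \<le> p \<Longrightarrow> p \<le> 1 \<Longrightarrow>
     \<bar>lim_val k (p + h * speed k p) y b a - lim_val k p y b a - h * lim_drift k p y b a\<bar> \<le> C y b a * h\<^sup>2"
    using lim_val_step[of k] by metis
  let ?D = "\<Sum>(y, b, a)\<in>{..m} \<times> {..m} \<times> {..m}. C y b a"
  show ?thesis
  proof (intro exI[of _ ?D] conjI allI impI)
    show "0 \<le> ?D" by (intro sum_nonneg) (auto simp: C(1))
    fix y b a and h p :: real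
    assume le: "y \<le> m" "b \<le> m" "a \<le> m" and hp: "0 \<le> h" "h \<le> 1" "0 \<le> p" "p \<le> 1"
    have "(case (y, b, a) of (y, b, a) \<Rightarrow> C y b a) \<le> ?D"
      using le C(1) by (intro member_le_sum) auto
    then have "C y b a * h\<^sup>2 \<le> ?D * h\<^sup>2" by (intro mult_right_mono) auto
    with C(2)[OF hp, of y b a]
    show "\<bar>lim_val k (p + h * speed k p) y b a - lim_val k p y b a - h * lim_drift k p y b a\<bar> \<le> ?D * h\<^sup>2"
      by linarith
  qed
qed

text \<open>The Euler scheme for \<open>p' = speed k p\<close> with step \<open>h\<close>; working
  with the iterates avoids solving the differential equation.\<close>

primrec pseq :: "nat \<Rightarrow> real \<Rightarrow> nat \<Rightarrow> real" where
  "pseq k h 0 = 0"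
| "pseq k h (Suc u) = pseq k h u + h * speed k (pseq k h u)"

lemma pseq_bounds:
  assumes "0 \<le> h" "h \<le> 1" shows "0 \<le> pseq k h u \<and> pseq k h u \<le> 1"
proof (induction u)
  case (Suc u)
  then have p: "0 \<le> pseq k h u" "pseq k h u \<le> 1" by auto
  note sp = speed_bounds[OF p, of k]
  have "h * speed k (pseq k h u) \<le> 1 * (1 - pseq k h u)" using assms sp by (intro mult_mono) auto
  then show ?case using p sp assms by auto
qed simp

lemma survive_ge: 
  assumes "0 \<le> p" "p \<le> 1" shows "survive k 1 \<le> survive k p"
proof -
  have "closure_exponent k p \<le> closure_exponent k 1"
    unfolding closure_exponent_def using assms
    by (intro sum_mono mult_left_mono) (auto simp: power_le_one)
  then show ?thesis by (simp add: survive_def)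
qed

text \<open>While the iterates stay below \<open>1 - \<epsilon>\<close>, each step gains at least
  \<open>h * \<epsilon> ^ 3 * survive k 1\<close>, and after the stated time the sum would exceed
  1.\<close>

lemma pseq_ge:
  assumes h: "0 \<le> h" "h \<le> 1" and \<epsilon>: "0 < \<epsilon>"
    and u: "1 / (\<epsilon> ^ 3 * survive k 1) < real u * h"
  shows "1 - \<epsilon> \<le> pseq k h u"
proof (rule ccontr)
  assume "\<not> ?thesis"
  then have lt: "pseq k h u < 1 - \<epsilon>" by simp
  have s: "0 < survive k 1" using survive_bounds[of 1 k] by simp
  have "mono (pseq k h)"
    unfolding mono_iff_le_Suc using pseq_bounds[OF h] speed_bounds h by simp
  then have le: "pseq k h v < 1 - \<epsilon>" if "v \<le> u" for v using lt that by (meson monoD le_less_trans)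
  have "real v * h * (\<epsilon> ^ 3 * survive k 1) \<le> pseq k h v" if "v \<le> u" for v
    using that
  proof (induction v)
    case (Suc v)
    have p: "0 \<le> pseq k h v" "pseq k h v \<le> 1" "pseq k h v < 1 - \<epsilon>"
      using pseq_bounds[OF h] le[of v] Suc.prems by auto
    have "\<epsilon> ^ 3 * survive k 1 \<le> speed k (pseq k h v)"
      unfolding speed_def using p \<epsilon> s survive_ge[OF p(1,2)] by (intro mult_mono power_mono) auto
    then have "h * (\<epsilon> ^ 3 * survive k 1) \<le> h * speed k (pseq k h v)" using h by (intro mult_left_mono) auto
    then show ?case using Suc by (simp add: algebra_simps)
  qed simp
  then have "real u * h * (\<epsilon> ^ 3 * survive k 1) \<le> 1" using pseq_bounds[OF h, of k u] by force
  moreover have "1 < real u * h * (\<epsilon> ^ 3 * survive k 1)"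
    using u \<epsilon> s by (simp add: field_simps)
  ultimately show False by simp
qed

section \<open>Convergence of the hierarchy\<close>

text \<open>The discrete integral of \<open>w ^ L\<close>; it raises the power of the elapsed time
  by one in each iteration.\<close>

lemma sum_power_le: "real (\<Sum>w<v. w ^ L) * real (L + 1) \<le> real v ^ (L + 1)"
proof (induction v)
  case (Suc v)
  have "real v ^ Suc L + real (Suc L) * real v ^ L * 1 \<le> (real v + 1) ^ Suc L"
    by (rule power_add_ge) auto
  then show ?case using Suc by (simp add: algebra_simps)
qed simp

text \<open>An infinite hierarchy of differential inequalities \<open>e_b' \<le> K b e_{b+1}\<close> with the a priori bound
  \<open>e_b \<le> \<beta>^b\<close> forces the errors to stay negligible: expanding it \<open>L\<close> times gives a factor
  \<open>O(\<theta>)^L\<close> over a time slab of length \<open>\<theta>\<close>, and boundedly many slabs cover the time horizon.\<close>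

locale error_hierarchy =
  fixes good :: "'i \<Rightarrow> bool" and n :: "'i \<Rightarrow> nat" and h :: "'i \<Rightarrow> real"
    and close :: "'i \<Rightarrow> nat \<Rightarrow> nat \<Rightarrow> real \<Rightarrow> bool"
    and \<sigma> \<beta> K :: real and D :: "nat \<Rightarrow> real"
  assumes params: "0 \<le> \<sigma>" "1 \<le> \<beta>" "0 < K" "\<And>b. 0 \<le> D b"
    and h_pos: "\<And>i. good i \<Longrightarrow> 0 < h i" and h_le: "\<And>i. good i \<Longrightarrow> h i \<le> 27 / real (n i)"
    and n_pos: "\<And>i. good i \<Longrightarrow> 0 < n i"
    and mono: "\<And>i u b e e'. good i \<Longrightarrow> close i u b e \<Longrightarrow> e \<le> e' \<Longrightarrow> close i u b e'"
    and init: "\<And>i b. good i \<Longrightarrow> close i 0 b 0"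
    and apriori: "\<And>i u b. good i \<Longrightarrow> real u * h i \<le> \<sigma> \<Longrightarrow> close i u b (\<beta> ^ b)"
    and step: "\<And>i u b e e1. good i \<Longrightarrow> real u * h i \<le> \<sigma> \<Longrightarrow> 0 \<le> e1 \<Longrightarrow>
      close i u b e \<Longrightarrow> close i u (b + 1) e1 \<Longrightarrow>
      close i (Suc u) b (e + h i * (K * real b * e1 + D b / real (n i)))"
begin

text \<open>The errors of all levels tend to zero up to time \<open>s\<close>. The threshold may
  depend on the level and the tolerance, but not on the step within that range.\<close>

definition conv :: "real \<Rightarrow> bool" where
  "conv s \<longleftrightarrow> (\<forall>b. \<forall>e>0. \<exists>n0. \<forall>i u. good i \<longrightarrow> n0 \<le> n i \<longrightarrow> real u * h i \<le> s \<longrightarrow>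
     real u * h i \<le> \<sigma> \<longrightarrow> close i u b e)"

text \<open>Expanding \<open>L\<close> times from level \<open>b\<close> yields
  \<open>K ^ L * b * (b + 1) * ... * (b + L - 1) / L!\<close> times the a priori bound at level
  \<open>b + L\<close>; the quotient is the binomial coefficient.\<close>

definition coef :: "nat \<Rightarrow> nat \<Rightarrow> real" where
  "coef L b = \<beta> ^ (b + L) * K ^ L * real (b + L - 1 choose L)"

lemma coef_Suc: "K * real b * coef L (b + 1) = coef (Suc L) b * real (L + 1)"
proof -
  have "b * (b + L choose L) = Suc L * (b + L choose Suc L)"
    using binomial_absorb_comp[of "b + L" L] binomial_absorption[of L "b + L"] by (simp only: add_diff_cancel_right')
  then have "real b * real (b + L choose L) = real (Suc L) * real (b + L choose Suc L)"
    by (metis of_nat_mult)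
  then show ?thesis unfolding coef_def by (simp del: binomial_Suc_Suc add: mult_ac)
qed

lemma coef_nonneg: "0 \<le> coef L b"
  using params by (simp add: coef_def)

text \<open>The slab starts at \<open>u0\<close>, where convergence is known. Inserting the estimate
  with \<open>L\<close> for the next level and summing the recursion over the slab gives the
  estimate with \<open>Suc L\<close>.\<close>

lemma slab_iterate:
  assumes "conv s" "0 \<le> s"
  shows "\<forall>b. \<forall>e>0. \<exists>n0. \<forall>i u0 v. good i \<longrightarrow> n0 \<le> n i \<longrightarrow> real u0 * h i \<le> s \<longrightarrow>
     real (u0 + v) * h i \<le> \<sigma> \<longrightarrow> close i (u0 + v) b (coef L b * (real v * h i) ^ L + e)"
proof (induction L)
  case 0
  show ?case
  proof (intro allI impI exI[of _ 0])
    fix b i u0 v and e :: real assume "0 < e" "good i" "real (u0 + v) * h i \<le> \<sigma>"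
    then show "close i (u0 + v) b (coef 0 b * (real v * h i) ^ 0 + e)"
      using mono[OF \<open>good i\<close> apriori[of i "u0 + v" b]] by (simp add: coef_def)
  qed
next
  case (Suc L)
  show ?case
  proof (intro allI impI)
    fix b :: nat and e :: real assume e: "0 < e"
    \<comment> \<open>The tolerance is split in thirds between the start of the slab, the slack
      \<open>e1\<close> of the next level and the term \<open>D b / n\<close>; the summand 1 keeps
      \<open>Q\<close> positive when \<open>b = 0\<close>.\<close>
    define Q where "Q = K * real b * \<sigma> + 1"
    have Q: "0 < Q" using params by (simp add: Q_def add_nonneg_pos)
    define e1 where "e1 = e / (3 * Q)"
    have e1: "0 < e1" using e Q by (simp add: e1_def)
    obtain n1 where n1: "\<And>i u. good i \<Longrightarrow> n1 \<le> n i \<Longrightarrow> real u * h i \<le> s \<Longrightarrow> real u * h i \<le> \<sigma> \<Longrightarrow>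
        close i u b (e / 3)"
      using assms(1) e unfolding conv_def by (meson divide_pos_pos zero_less_numeral)
    obtain n2 where n2: "\<And>i u0 v. good i \<Longrightarrow> n2 \<le> n i \<Longrightarrow> real u0 * h i \<le> s \<Longrightarrow>
        real (u0 + v) * h i \<le> \<sigma> \<Longrightarrow> close i (u0 + v) (b + 1) (coef L (b + 1) * (real v * h i) ^ L + e1)"
      using Suc e1 by meson
    obtain n3 :: nat where n3: "3 * D b * \<sigma> / e < real n3" using reals_Archimedean2 by blast
    show "\<exists>n0. \<forall>i u0 v. good i \<longrightarrow> n0 \<le> n i \<longrightarrow> real u0 * h i \<le> s \<longrightarrow>
       real (u0 + v) * h i \<le> \<sigma> \<longrightarrow> close i (u0 + v) b (coef (Suc L) b * (real v * h i) ^ Suc L + e)"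
    proof (intro exI[of _ "max n1 (max n2 n3)"] allI impI)
      fix i u0 v
      assume g: "good i" and ni: "max n1 (max n2 n3) \<le> n i" and u0: "real u0 * h i \<le> s"
        and v: "real (u0 + v) * h i \<le> \<sigma>"
      note hp = h_pos[OF g] and np = n_pos[OF g]
      \<comment> \<open>The bound after \<open>w\<close> steps of the slab, chosen so that
        \<open>step\<close> reproduces it exactly at \<open>Suc w\<close>.\<close>
      define B where "B w = e / 3 + K * real b * coef L (b + 1) * (h i ^ Suc L * real (\<Sum>w<w. w ^ L))
         + real w * h i * (K * real b * e1 + D b / real (n i))" for w :: nat
      have "close i (u0 + w) b (B w)" if "w \<le> v" for w
        using that
      proof (induction w)
        case 0
        have "real u0 * h i \<le> real (u0 + v) * h i" using hp by (intro mult_right_mono) auto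
        then show ?case using n1[OF g _ u0] ni v by (simp add: B_def)
      next
        case (Suc w)
        have "real (u0 + w) * h i \<le> real (u0 + v) * h i" using hp Suc.prems by (intro mult_right_mono) auto
        then have le: "real (u0 + w) * h i \<le> \<sigma>" using v by simp
        let ?e1 = "coef L (b + 1) * (real w * h i) ^ L + e1"
        have "close i (u0 + w) (b + 1) ?e1" using n2[OF g _ u0 le] ni by simp
        moreover have "0 \<le> ?e1" using coef_nonneg hp e1 by simp
        ultimately have "close i (Suc (u0 + w)) b (B w + h i * (K * real b * ?e1 + D b / real (n i)))"
          using Suc by (intro step[OF g le]) auto
        moreover have "B w + h i * (K * real b * ?e1 + D b / real (n i)) = B (Suc w)"
          by (simp add: B_def algebra_simps power_mult_distrib)
        ultimately show ?case by simp
      qed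
      then have "close i (u0 + v) b (B v)" by simp
      moreover have "B v \<le> coef (Suc L) b * (real v * h i) ^ Suc L + e"
      proof -
        have "real v * h i \<le> real (u0 + v) * h i" using hp by (intro mult_right_mono) auto
        then have vh: "real v * h i \<le> \<sigma>" using v by linarith
        have "K * real b * coef L (b + 1) * (h i ^ Suc L * real (\<Sum>w<v. w ^ L))
            = coef (Suc L) b * h i ^ Suc L * (real (\<Sum>w<v. w ^ L) * real (L + 1))"
          unfolding coef_Suc by (simp only: mult_ac)
        also have "\<dots> \<le> coef (Suc L) b * h i ^ Suc L * real v ^ (L + 1)"
          using coef_nonneg hp by (intro mult_left_mono sum_power_le) auto
        also have "\<dots> = coef (Suc L) b * (real v * h i) ^ Suc L" by (simp add: power_mult_distrib)
        finally have 1: "K * real b * coef L (b + 1) * (h i ^ Suc L * real (\<Sum>w<v. w ^ L))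
            \<le> coef (Suc L) b * (real v * h i) ^ Suc L" .
        have "real v * h i * (K * real b * e1 + D b / real (n i)) \<le> \<sigma> * (K * real b * e1 + D b / real (n i))"
          using vh params e1 by (intro mult_right_mono) auto
        also have "\<dots> = (K * real b * \<sigma>) * e1 + D b * \<sigma> / real (n i)" by (simp add: algebra_simps)
        also have "\<dots> \<le> Q * e1 + e / 3"
        proof (intro add_mono mult_right_mono)
          show "K * real b * \<sigma> \<le> Q" by (simp add: Q_def)
          have "real n3 \<le> real (n i)" using ni by simp
          then have "3 * D b * \<sigma> / e < real (n i)" using n3 by linarith
          then show "D b * \<sigma> / real (n i) \<le> e / 3" using e np by (simp add: field_simps)
        qed (use e1 in simp)
        also have "Q * e1 = e / 3" using Q by (simp add: e1_def)
        finally show ?thesis using 1 unfolding B_def by linarith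
      qed
      ultimately show "close i (u0 + v) b (coef (Suc L) b * (real v * h i) ^ Suc L + e)"
        using mono[OF g] by blast
    qed
  qed
qed

text \<open>The binomial coefficient is at most \<open>2 ^ (b + L)\<close> and the elapsed time at
  most \<open>2 * \<theta>\<close>, so the iterated bound is
  \<open>(2 * \<beta>) ^ b * (4 * \<beta> * K * \<theta>) ^ L\<close>, with ratio at most 1/2. The
  slab length does not depend on the level.\<close>

lemma conv_slab:
  assumes s: "conv s" "0 \<le> s" and \<theta>: "0 < \<theta>" "8 * \<beta> * K * \<theta> \<le> 1"
  shows "conv (s + \<theta>)"
  unfolding conv_def
proof (intro allI impI)
  fix b :: nat and e :: real assume e: "0 < e"
  have bp: "0 < (2 * \<beta>) ^ b" using params by simp
  obtain L where L: "(1 / 2 :: real) ^ L < e / 2 / (2 * \<beta>) ^ b"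
    using real_arch_pow_inv[of "e / 2 / (2 * \<beta>) ^ b" "1 / 2"] e bp by auto
  obtain n1 where n1: "\<And>i u. good i \<Longrightarrow> n1 \<le> n i \<Longrightarrow> real u * h i \<le> s \<Longrightarrow> real u * h i \<le> \<sigma> \<Longrightarrow> close i u b e"
    using s(1) e unfolding conv_def by meson
  have "0 < e / 2" using e by simp
  then obtain n2 where n2: "\<And>i u0 v. good i \<Longrightarrow> n2 \<le> n i \<Longrightarrow> real u0 * h i \<le> s \<Longrightarrow>
      real (u0 + v) * h i \<le> \<sigma> \<Longrightarrow> close i (u0 + v) b (coef L b * (real v * h i) ^ L + e / 2)"
    using slab_iterate[OF s, of L] by meson
  obtain n3 :: nat where n3: "27 / \<theta> < real n3" using reals_Archimedean2 by blast
  show "\<exists>n0. \<forall>i u. good i \<longrightarrow> n0 \<le> n i \<longrightarrow> real u * h i \<le> s + \<theta> \<longrightarrow> real u * h i \<le> \<sigma> \<longrightarrow> close i u b e"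
  proof (intro exI[of _ "max n1 (max n2 n3)"] allI impI)
    fix i u assume g: "good i" and ni: "max n1 (max n2 n3) \<le> n i" and u: "real u * h i \<le> s + \<theta>" "real u * h i \<le> \<sigma>"
    note hp = h_pos[OF g] and np = n_pos[OF g]
    show "close i u b e"
    proof (cases "real u * h i \<le> s")
      case True
      then show ?thesis using n1[OF g _ True u(2)] ni by simp
    next
      case False
      \<comment> \<open>The last step up to time \<open>s\<close>. Rounding costs at most one step,
        which is shorter than \<open>\<theta>\<close> or equal to it for large n.\<close>
      define u0 where "u0 = nat \<lfloor>s / h i\<rfloor>"
      have "real u0 = of_int \<lfloor>s / h i\<rfloor>" using s(2) hp by (simp add: u0_def)
      then have fl: "real u0 \<le> s / h i" "s / h i < real u0 + 1" by linarith+
      have u0: "real u0 * h i \<le> s" "s < real u0 * h i + h i"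
        using fl hp by (simp_all add: field_simps)
      have "real u0 * h i < real u * h i" using u0 False by linarith
      then have "u0 < u" using hp by simp
      then obtain v where v: "u = u0 + v" using less_imp_add_positive by blast
      have "h i \<le> \<theta>"
      proof -
        have "real n3 \<le> real (n i)" using ni by simp
        then have "27 / \<theta> < real (n i)" using n3 by linarith
        then have "27 / real (n i) \<le> \<theta>" using \<theta> np by (simp add: field_simps)
        then show ?thesis using h_le[OF g] by simp
      qed
      then have vh: "real v * h i \<le> 2 * \<theta>" using u(1) u0(2) unfolding v by (simp add: algebra_simps)
      have "coef L b * (real v * h i) ^ L \<le> coef L b * (2 * \<theta>) ^ L"
        using vh hp coef_nonneg by (intro mult_left_mono power_mono) auto
      also have "\<dots> \<le> (\<beta> ^ (b + L) * K ^ L * 2 ^ (b + L)) * (2 * \<theta>) ^ L"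
      proof (intro mult_right_mono)
        have "(b + L - 1 choose L) \<le> 2 ^ (b + L - 1)" by (rule binomial_le_pow2)
        also have "\<dots> \<le> 2 ^ (b + L)" by (intro power_increasing) auto
        finally have "real (b + L - 1 choose L) \<le> 2 ^ (b + L)"
          by (metis of_nat_le_iff of_nat_numeral of_nat_power)
        then show "coef L b \<le> \<beta> ^ (b + L) * K ^ L * 2 ^ (b + L)"
          unfolding coef_def using params by (intro mult_left_mono) auto
      qed (use \<theta> in auto)
      also have "\<dots> = (2 * \<beta>) ^ b * (4 * \<beta> * K * \<theta>) ^ L"
      proof -
        have "(4::real) ^ L = 2 ^ L * 2 ^ L" by (simp flip: power_mult_distrib)
        then show ?thesis by (simp add: power_add power_mult_distrib mult_ac)
      qed
      also have "\<dots> \<le> (2 * \<beta>) ^ b * (1 / 2) ^ L"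
        using \<theta> params by (intro mult_left_mono power_mono) auto
      also have "\<dots> \<le> e / 2" using L bp by (simp add: field_simps)
      finally have "coef L b * (real v * h i) ^ L + e / 2 \<le> e" by simp
      moreover have "close i (u0 + v) b (coef L b * (real v * h i) ^ L + e / 2)"
        using n2[OF g _ u0(1)] ni u(2) v by simp
      ultimately show ?thesis using mono[OF g] v by blast
    qed
  qed
qed

theorem errors_vanish:
  assumes "0 < e"
  shows "\<exists>n0. \<forall>i u. good i \<longrightarrow> n0 \<le> n i \<longrightarrow> real u * h i \<le> \<sigma> \<longrightarrow> close i u b e"
proof -
  define \<theta> where "\<theta> = 1 / (8 * \<beta> * K)"
  have \<theta>: "0 < \<theta>" "8 * \<beta> * K * \<theta> \<le> 1" using params by (auto simp: \<theta>_def)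
  have "conv 0"
    unfolding conv_def
  proof (intro allI impI exI[of _ 0])
    fix b :: nat and e :: real and i u assume *: "0 < e" "good i" "real u * h i \<le> 0"
    then have "u = 0" using h_pos[OF *(2)] by (simp add: mult_le_0_iff)
    then show "close i u b e" using mono[OF *(2) init[OF *(2)]] * by simp
  qed
  have "conv (real j * \<theta>)" for j
  proof (induction j)
    case (Suc j)
    then have "conv (real j * \<theta> + \<theta>)" using \<theta> by (intro conv_slab) auto
    then show ?case by (simp add: algebra_simps)
  qed (use \<open>conv 0\<close> in simp)
  moreover obtain j where "\<sigma> < real j * \<theta>" using reals_Archimedean3[OF \<theta>(1)] by blast
  ultimately show ?thesis using assms unfolding conv_def by (meson less_imp_le order_trans)
qed

end

section \<open>The hierarchy satisfied by the process\<close>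

context lazy_process
begin

definition hstep :: real where "hstep = real (card V) / M"

lemma hstep_bounds:
  assumes "4 \<le> card V"
  shows "0 < hstep" "hstep \<le> 1" "hstep\<^sup>2 \<le> hstep * (27 / real (card V))" "hstep \<le> 27 / real (card V)"
    "1 / M = hstep / real (card V)"
proof -
  let ?n = "real (card V)"
  have n: "4 \<le> ?n" using assms by simp
  have eq: "hstep = 6 / ((?n - 1) * (?n - 2))" using n by (simp add: hstep_def M_eq)
  show h0: "0 < hstep" using M_pos n by (simp add: hstep_def)
  have "3 * 2 \<le> (?n - 1) * (?n - 2)" using n by (intro mult_mono) auto
  then show "hstep \<le> 1" unfolding eq by simp
  \<comment> \<open>For n at least 3, n - 1 is at least 2n/3 and n - 2 at least n/3, whence 27 = 6 *
    9 / 2.\<close>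
  have "(2 * ?n / 3) * (?n / 3) \<le> (?n - 1) * (?n - 2)" using n by (intro mult_mono) auto
  then have "hstep \<le> 6 / ((2 * ?n / 3) * (?n / 3))" unfolding eq using n by (intro divide_left_mono) auto
  also have "\<dots> = 27 / ?n * (1 / ?n)" using n by (simp add: field_simps)
  also have "\<dots> \<le> 27 / ?n * 1" using n by (intro mult_left_mono) auto
  finally show le: "hstep \<le> 27 / ?n" by simp
  show "hstep\<^sup>2 \<le> hstep * (27 / ?n)"
    unfolding power2_eq_square using le h0 by (intro mult_left_mono) auto
  show "1 / M = hstep / ?n" using n by (simp add: hstep_def)
qed

text \<open>Level \<open>b\<close> admits total size \<open>k * b\<close>, because one application
  of the drift adds fewer than \<open>k\<close> triples and so leads at most into level
  \<open>b + 1\<close>.\<close>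

definition close_to :: "nat \<Rightarrow> nat \<Rightarrow> real \<Rightarrow> bool" where
  "close_to u b e \<longleftrightarrow> (\<forall>X Y. consistent X Y \<longrightarrow> card X + card Y \<le> k * b \<longrightarrow>
     \<bar>sprob u X Y - lim_prob (pseq k hstep u) X Y\<bar> \<le> e)"

text \<open>Initially everything is available and nothing chosen, which is the product at
  \<open>p = 0\<close> because \<open>closure_exponent\<close> has no constant term.\<close>

lemma close_to_0: "close_to 0 b 0"
  unfolding close_to_def
proof (intro allI impI)
  fix X Y assume cons: "consistent X Y"
  note cD = consistentD[OF cons]
  have "sprob 0 X Y = of_bool (Y = {})" using cD(1) by (auto simp: sprob_def ind_def avail_empty)
  moreover have "lim_prob (pseq k hstep 0) X Y = of_bool (Y = {})"
    using cD(5) by (auto simp: lim_prob_def lim_val_def survive_def closure_exponent_def power_0_left)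
  ultimately show "\<bar>sprob 0 X Y - lim_prob (pseq k hstep 0) X Y\<bar> \<le> 0" by simp
qed

text \<open>Both quantities lie between 0 and \<open>\<sigma> ^ (k * b)\<close>: the probability by
  the bound for chosen triples, the limit because it is at most 1.\<close>

lemma close_to_apriori:
  assumes n: "4 \<le> card V" and \<sigma>: "1 \<le> \<sigma>" "real u * hstep \<le> \<sigma>"
  shows "close_to u b ((\<sigma> ^ k) ^ b)"
  unfolding close_to_def
proof (intro allI impI)
  fix X Y assume cons: "consistent X Y" and m: "card X + card Y \<le> k * b"
  let ?n = "real (card V)"
  note cD = consistentD[OF cons] and h = hstep_bounds[OF n]
  have "ev u (ind X Y) \<le> ev u (\<lambda>C. of_bool (Y \<subseteq> C))" by (intro ev_mono) (auto simp: ind_def)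
  then have "sprob u X Y \<le> ?n ^ card Y * ev u (\<lambda>C. of_bool (Y \<subseteq> C))"
    unfolding sprob_def by (intro mult_left_mono) auto
  also have "\<dots> \<le> \<sigma> ^ (k * b) * (1 / ?n) ^ 0"
    using \<sigma> cD m by (intro ev_weight_le) (auto simp: hstep_def)
  finally have 1: "sprob u X Y \<le> (\<sigma> ^ k) ^ b" by (simp add: power_mult)
  have 2: "0 \<le> sprob u X Y" unfolding sprob_def by (intro mult_nonneg_nonneg ev_nonneg) (auto simp: ind_def)
  have p: "0 \<le> pseq k hstep u" "pseq k hstep u \<le> 1" using pseq_bounds[of hstep k u] h by auto
  have 3: "0 \<le> lim_prob (pseq k hstep u) X Y" "lim_prob (pseq k hstep u) X Y \<le> 1"
    unfolding lim_prob_def by (rule lim_val_bounds[OF p])+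
  have "1 \<le> (\<sigma> ^ k) ^ b" using \<sigma>(1) by (intro one_le_power)
  then show "\<bar>sprob u X Y - lim_prob (pseq k hstep u) X Y\<bar> \<le> (\<sigma> ^ k) ^ b"
    using 1 2 3 by linarith
qed

text \<open>Four errors add up: the lazy drift against \<open>drift_op\<close>, the Lipschitz
  dependence on the next level, \<open>drift_op\<close> of the product against
  \<open>lim_drift\<close>, and the quadratic Euler error, which \<open>hstep \<le> 27 / n\<close>
  turns into order \<open>hstep / n\<close>.\<close>

lemma close_to_step:
  assumes n: "4 \<le> card V" and \<sigma>: "1 \<le> \<sigma>" "real u * hstep \<le> \<sigma>" and e1: "0 \<le> e1"
    and close: "close_to u b e" "close_to u (b + 1) e1"
    and C: "0 \<le> C" "\<And>y b' a h p. y \<le> 3 * (k * b) \<Longrightarrow> b' \<le> 3 * (k * b) \<Longrightarrow> a \<le> 3 * (k * b) \<Longrightarrow>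
      0 \<le> h \<Longrightarrow> h \<le> 1 \<Longrightarrow> 0 \<le> p \<Longrightarrow> p \<le> 1 \<Longrightarrow>
      \<bar>lim_val k (p + h * speed k p) y b' a - lim_val k p y b' a - h * lim_drift k p y b' a\<bar> \<le> C * h\<^sup>2"
  shows "close_to (Suc u) b (e + hstep * (real k * lip_const k * real b * e1
     + (count_const k (k * b) + err_const k (k * b) \<sigma> + 27 * C) / real (card V)))"
  unfolding close_to_def
proof (intro allI impI)
  fix X Y assume cons: "consistent X Y" and m: "card X + card Y \<le> k * b"
  let ?n = "real (card V)" and ?p = "pseq k hstep u" and ?p' = "pseq k hstep (Suc u)"
  note h = hstep_bounds[OF n]
  have np: "0 < ?n" using n by simp
  have p: "0 \<le> ?p" "?p \<le> 1" using pseq_bounds[of hstep k u] h by auto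
  let ?ld = "lim_drift k ?p (card Y) (card (shadow X)) (card X)"
  define d where "d = drift_op (sprob u) X Y"
  define d' where "d' = drift_op (lim_prob ?p) X Y"
  have 1: "\<bar>M * (sprob (Suc u) X Y - sprob u X Y) - d\<bar> \<le> err_const k (k * b) \<sigma>"
    using sprob_step[OF cons m \<sigma>(1)] \<sigma>(2) unfolding d_def hstep_def by simp
  have 2: "\<bar>d - d'\<bar> \<le> ?n * (real (k * b) * lip_const k * e1)"
    unfolding d_def d'_def
  proof (rule drift_op_diff_le[OF cons m e1])
    fix X' Y' assume "consistent X' Y'" "card X' + card Y' \<le> k * b + k"
    then show "\<bar>sprob u X' Y' - lim_prob ?p X' Y'\<bar> \<le> e1"
      using close(2) by (auto simp: close_to_def algebra_simps)
  qed
  have 3: "\<bar>d' - ?n * ?ld\<bar> \<le> count_const k (k * b)"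
    unfolding d'_def by (rule drift_op_lim[OF cons m p])
  have "card (shadow X) \<le> 3 * (k * b)" using card_shadow_le[OF cons] m by linarith
  then have "\<bar>lim_prob ?p' X Y - lim_prob ?p X Y - hstep * ?ld\<bar> \<le> C * hstep\<^sup>2"
    unfolding lim_prob_def pseq.simps using m h p by (intro C(2)) auto
  also have "\<dots> \<le> C * (hstep * (27 / ?n))" using h(3) C(1) by (rule mult_left_mono)
  finally have 4: "\<bar>lim_prob ?p' X Y - lim_prob ?p X Y - hstep * ?ld\<bar> \<le> hstep * (27 * C / ?n)"
    by (simp add: mult_ac)
  have 5: "\<bar>sprob u X Y - lim_prob ?p X Y\<bar> \<le> e" using close(1) cons m by (auto simp: close_to_def)
  have "\<bar>M * (sprob (Suc u) X Y - sprob u X Y) - ?n * ?ld\<bar>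
      \<le> ?n * (real (k * b) * lip_const k * e1) + (count_const k (k * b) + err_const k (k * b) \<sigma>)"
    using 1 2 3 by linarith
  then have "\<bar>M * (sprob (Suc u) X Y - sprob u X Y) - ?n * ?ld\<bar> * (1 / M)
      \<le> (?n * (real (k * b) * lip_const k * e1) + (count_const k (k * b) + err_const k (k * b) \<sigma>)) * (1 / M)"
    using M_pos by (intro mult_right_mono) auto
  also have "\<dots> = hstep * (real k * lip_const k * real b * e1 + (count_const k (k * b) + err_const k (k * b) \<sigma>) / ?n)"
    unfolding h(5) using np by (simp add: field_simps)
  also have "\<bar>M * (sprob (Suc u) X Y - sprob u X Y) - ?n * ?ld\<bar> * (1 / M)
      = \<bar>sprob (Suc u) X Y - sprob u X Y - hstep * ?ld\<bar>"
  proof -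
    have "\<bar>M * (sprob (Suc u) X Y - sprob u X Y) - ?n * ?ld\<bar> * (1 / M)
        = \<bar>(M * (sprob (Suc u) X Y - sprob u X Y) - ?n * ?ld) * (1 / M)\<bar>"
      using M_pos by (simp add: abs_mult)
    also have "(M * (sprob (Suc u) X Y - sprob u X Y) - ?n * ?ld) * (1 / M)
        = sprob (Suc u) X Y - sprob u X Y - hstep * ?ld"
      using M_pos by (simp add: hstep_def field_simps)
    finally show ?thesis .
  qed
  finally have 6: "\<bar>sprob (Suc u) X Y - sprob u X Y - hstep * ?ld\<bar>
      \<le> hstep * (real k * lip_const k * real b * e1 + (count_const k (k * b) + err_const k (k * b) \<sigma>) / ?n)" .
  have "\<bar>sprob (Suc u) X Y - lim_prob ?p' X Y\<bar> \<le> e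
      + hstep * (real k * lip_const k * real b * e1 + (count_const k (k * b) + err_const k (k * b) \<sigma>) / ?n)
      + hstep * (27 * C / ?n)"
    using 4 5 6 by linarith
  also have "\<dots> = e + hstep * (real k * lip_const k * real b * e1
     + (count_const k (k * b) + err_const k (k * b) \<sigma> + 27 * C) / ?n)"
    by (simp add: algebra_simps add_divide_distrib)
  finally show "\<bar>sprob (Suc u) X Y - lim_prob ?p' X Y\<bar> \<le> e + hstep * (real k * lip_const k * real b * e1
     + (count_const k (k * b) + err_const k (k * b) \<sigma> + 27 * C) / ?n)" .
qed

section \<open>Termination time\<close>

text \<open>The number of chosen triples is a sum of indicators for the pairs
  \<open>({}, {c})\<close>, which lie in level 1 and have limit \<open>p\<close>.\<close>

lemma ev_card_ge:
  assumes close: "close_to u 1 e" and p: "1 - \<epsilon> \<le> pseq k hstep u"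
  shows "M / real (card V) * (1 - (\<epsilon> + e)) \<le> ev u (\<lambda>C. real (card C))"
proof -
  let ?n = "real (card V)"
  have n: "0 < ?n" using card_V_ge by simp
  have cons: "consistent {} {c}" if "c \<in> triples V" for c
    unfolding consistent_def
  proof (intro conjI allI impI)
    fix S assume "conflict k S" "S \<subseteq> {} \<union> {c}"
    then have False using conflict_not_singleton[of S c] by simp
    then show "2 \<le> card (S \<inter> {})" ..
  qed (use that in auto)
  have ge: "(1 - (\<epsilon> + e)) / ?n \<le> ev u (ind {} {c})" if "c \<in> triples V" for c
  proof -
    have "\<bar>sprob u {} {c} - lim_prob (pseq k hstep u) {} {c}\<bar> \<le> e"
      using close cons[OF that] k_ge by (auto simp: close_to_def)
    moreover have "lim_prob (pseq k hstep u) {} {c} = pseq k hstep u"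
      by (simp add: lim_prob_def lim_val_def shadow_def)
    moreover have "sprob u {} {c} = ?n * ev u (ind {} {c})" by (simp add: sprob_def)
    ultimately have "1 - (\<epsilon> + e) \<le> ?n * ev u (ind {} {c})" using p by linarith
    then show ?thesis using n by (simp add: field_simps)
  qed
  have "M / ?n * (1 - (\<epsilon> + e)) = (\<Sum>c\<in>triples V. (1 - (\<epsilon> + e)) / ?n)" by (simp add: M_def)
  also have "\<dots> \<le> (\<Sum>c\<in>triples V. ev u (ind {} {c}))" by (rule sum_mono) (rule ge)
  also have "\<dots> = ev u (\<lambda>C. \<Sum>c\<in>triples V. ind {} {c} C)" by (rule ev_sum[OF finite_trip, symmetric])
  also have "\<dots> = ev u (\<lambda>C. real (card C))"
  proof (rule ev_cong)
    fix C assume "conflict_free C"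
    then have "{c \<in> triples V. c \<in> C} = C" by (auto simp: conflict_free_def)
    then show "(\<Sum>c\<in>triples V. ind {} {c} C) = real (card C)"
      using sum_of_bool_card[OF finite_trip, of "\<lambda>c. c \<in> C"] by (simp add: ind_def)
  qed
  finally show ?thesis .
qed

text \<open>The deficit of the number of triples below n^2/6 is nonnegative with mean at most
  \<open>(3/n + \<epsilon> + e) * n^2/6\<close>; the 3/n comes from
  \<open>M / n = (n - 1) * (n - 2) / 6\<close>.\<close>

lemma ev_large_ge:
  assumes close: "close_to u 1 e" and p: "1 - \<epsilon> \<le> pseq k hstep u" and pos: "0 \<le> e" "0 \<le> \<epsilon>" "0 < \<gamma>"
  shows "1 - (3 / real (card V) + \<epsilon> + e) / \<gamma>
    \<le> ev u (\<lambda>C. of_bool ((1 - \<gamma>) * (real (card V))\<^sup>2 / 6 \<le> real (card C)))"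
proof -
  let ?n = "real (card V)" and ?\<delta> = "\<epsilon> + e"
  let ?Q = "\<lambda>C. (1 - \<gamma>) * ?n\<^sup>2 / 6 \<le> real (card C)"
  let ?P = "ev u (\<lambda>C. of_bool (?Q C))"
  have n: "3 \<le> ?n" using card_V_ge by simp
  have Mn: "M / ?n = (?n - 1) * (?n - 2) / 6" using n by (simp add: M_eq)
  have "M / ?n * (1 - ?\<delta>) = M / ?n - ?\<delta> * (M / ?n)"
    by (simp only: right_diff_distrib mult_1_right mult.commute[of "M / ?n" ?\<delta>])
  also have "\<dots> \<ge> (?n\<^sup>2 - 3 * ?n) / 6 - ?\<delta> * (?n\<^sup>2 / 6)"
  proof (intro diff_mono mult_left_mono)
    show "(?n\<^sup>2 - 3 * ?n) / 6 \<le> M / ?n" unfolding Mn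
      by (intro divide_right_mono) (simp_all add: power2_eq_square algebra_simps)
    show "M / ?n \<le> ?n\<^sup>2 / 6" unfolding Mn using n
      by (intro divide_right_mono) (simp_all add: power2_eq_square algebra_simps)
  qed (use pos in simp)
  finally have 1: "(?n\<^sup>2 - 3 * ?n) / 6 - ?\<delta> * (?n\<^sup>2 / 6) \<le> ev u (\<lambda>C. real (card C))"
    using ev_card_ge[OF close p] by linarith
  have "ev u (\<lambda>C. real (card C)) \<le> ev u (\<lambda>C. (1 - \<gamma>) * ?n\<^sup>2 / 6 + \<gamma> * ?n\<^sup>2 / 6 * of_bool (?Q C))"
  proof (rule ev_mono)
    fix C assume "conflict_free C"
    then have "real (card C) \<le> ?n\<^sup>2 / 6" using card_conflict_free_le by fastforce
    moreover have "(1 - \<gamma>) * ?n\<^sup>2 / 6 + \<gamma> * ?n\<^sup>2 / 6 = ?n\<^sup>2 / 6" by (simp add: field_simps)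
    ultimately show "real (card C) \<le> (1 - \<gamma>) * ?n\<^sup>2 / 6 + \<gamma> * ?n\<^sup>2 / 6 * of_bool (?Q C)"
      by (cases "?Q C") simp_all
  qed
  also have "\<dots> = (1 - \<gamma>) * ?n\<^sup>2 / 6 + \<gamma> * ?n\<^sup>2 / 6 * ?P"
    by (simp only: ev_add ev_const ev_cmult)
  finally have 2: "(?n\<^sup>2 - 3 * ?n) / 6 - ?\<delta> * (?n\<^sup>2 / 6) \<le> (1 - \<gamma>) * ?n\<^sup>2 / 6 + \<gamma> * ?n\<^sup>2 / 6 * ?P"
    using 1 by linarith
  have "g * s - 3 * m - d * s \<le> g * s * P"
    if "(s - 3 * m) / 6 - d * (s / 6) \<le> (1 - g) * s / 6 + g * s / 6 * P" for s m d g P :: real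
    using that by (simp add: field_simps)
  from this[OF 2] have "\<gamma> * ?n\<^sup>2 - 3 * ?n - ?\<delta> * ?n\<^sup>2 \<le> \<gamma> * ?n\<^sup>2 * ?P" .
  moreover have "\<gamma> * ?n\<^sup>2 * (1 - (3 / ?n + \<epsilon> + e) / \<gamma>) = \<gamma> * ?n\<^sup>2 - 3 * ?n - ?\<delta> * ?n\<^sup>2"
    using n pos by (simp add: field_simps power2_eq_square)
  ultimately have "\<gamma> * ?n\<^sup>2 * (1 - (3 / ?n + \<epsilon> + e) / \<gamma>) \<le> \<gamma> * ?n\<^sup>2 * ?P" by linarith
  then show ?thesis using n pos by (simp add: mult_le_cancel_left)
qed

end

text \<open>The vertex set itself is the index of the hierarchy, so one threshold \<open>n0\<close>
  serves all vertex sets at once.\<close>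

lemma close_to_uniform:
  fixes k b :: nat and \<sigma> e :: real
  assumes k: "2 \<le> k" and \<sigma>: "1 \<le> \<sigma>" and e: "0 < e"
  shows "\<exists>n0. \<forall>(V :: 'a set) u. finite V \<longrightarrow> 4 \<le> card V \<longrightarrow> n0 \<le> card V \<longrightarrow>
     real u * lazy_process.hstep V \<le> \<sigma> \<longrightarrow> lazy_process.close_to k V u b e"
proof -
  define good where "good V \<longleftrightarrow> finite V \<and> 4 \<le> card V" for V :: "'a set"
  have lp: "lazy_process k V" if "good V" for V
    using that k by (auto simp: good_def lazy_process_def)
  have four: "4 \<le> card V" if "good V" for V using that by (simp add: good_def)
  obtain C where C: "\<And>b. 0 \<le> C b" "\<And>b y b' a h p. y \<le> 3 * (k * b) \<Longrightarrow> b' \<le> 3 * (k * b) \<Longrightarrow> a \<le> 3 * (k * b) \<Longrightarrow>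
      0 \<le> h \<Longrightarrow> h \<le> 1 \<Longrightarrow> 0 \<le> p \<Longrightarrow> p \<le> 1 \<Longrightarrow>
      \<bar>lim_val k (p + h * speed k p) y b' a - lim_val k p y b' a - h * lim_drift k p y b' a\<bar> \<le> C b * h\<^sup>2"
  proof -
    have "\<forall>b. \<exists>C\<ge>0. \<forall>y\<le>3 * (k * b). \<forall>b'\<le>3 * (k * b). \<forall>a\<le>3 * (k * b). \<forall>h p.
      0 \<le> h \<longrightarrow> h \<le> 1 \<longrightarrow> 0 \<le> p \<longrightarrow> p \<le> 1 \<longrightarrow>
      \<bar>lim_val k (p + h * speed k p) y b' a - lim_val k p y b' a - h * lim_drift k p y b' a\<bar> \<le> C * h\<^sup>2"
      using lim_val_step_uniform by blast
    then show thesis using that by metis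
  qed
  \<comment> \<open>The absolute value supplies the required nonnegativity without a sign analysis
    of the constants.\<close>
  define D where "D b = \<bar>count_const k (k * b) + err_const k (k * b) \<sigma> + 27 * C b\<bar>" for b
  have lip: "0 < lip_const k"
    unfolding lip_const_def by (intro add_pos_nonneg sum_nonneg) auto
  interpret error_hierarchy good card "\<lambda>V. lazy_process.hstep V"
    "\<lambda>V. lazy_process.close_to k V" \<sigma> "\<sigma> ^ k" "real k * lip_const k" D
  proof
    show "0 \<le> \<sigma>" "1 \<le> \<sigma> ^ k" "0 < real k * lip_const k" using \<sigma> k lip by (auto simp: one_le_power)
    show "0 \<le> D b" for b by (simp add: D_def)
    fix V :: "'a set" assume g: "good V"
    interpret L: lazy_process k V by (rule lp[OF g])
    note h = L.hstep_bounds[OF four[OF g]]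
    show "0 < L.hstep" "L.hstep \<le> 27 / real (card V)" by (rule h)+
    show "0 < card V" using four[OF g] by simp
    show "L.close_to u b e'" if "L.close_to u b e" "e \<le> e'" for u b e e'
      using that by (fastforce simp: L.close_to_def)
    show "L.close_to 0 b 0" for b by (rule L.close_to_0)
    show "L.close_to u b ((\<sigma> ^ k) ^ b)" if "real u * L.hstep \<le> \<sigma>" for u b
      by (rule L.close_to_apriori[OF four[OF g] \<sigma> that])
    fix u b e e1
    assume *: "real u * L.hstep \<le> \<sigma>" "0 \<le> e1" "L.close_to u b e" "L.close_to u (b + 1) e1"
    have "L.close_to (Suc u) b (e + L.hstep * (real k * lip_const k * real b * e1
      + (count_const k (k * b) + err_const k (k * b) \<sigma> + 27 * C b) / real (card V)))"
      by (rule L.close_to_step[OF four[OF g] \<sigma> *(1,2,3,4) C(1)[of b]]) (rule C(2)[of _ b])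
    moreover have "(count_const k (k * b) + err_const k (k * b) \<sigma> + 27 * C b) / real (card V) \<le> D b / real (card V)"
      unfolding D_def by (intro divide_right_mono) auto
    then have "e + L.hstep * (real k * lip_const k * real b * e1
        + (count_const k (k * b) + err_const k (k * b) \<sigma> + 27 * C b) / real (card V))
      \<le> e + L.hstep * (real k * lip_const k * real b * e1 + D b / real (card V))"
      using h(1) by (intro add_left_mono mult_left_mono) auto
    ultimately show "L.close_to (Suc u) b (e + L.hstep * (real k * lip_const k * real b * e1 + D b / real (card V)))"
      unfolding L.close_to_def by (meson order_trans)
  qed
  show ?thesis using errors_vanish[OF e, of b] unfolding good_def by blast
qed

theorem theorem4p4:
  fixes \<gamma> :: real and k :: nat and V :: "nat \<Rightarrow> 'a set"
  assumes "0 < \<gamma>" and "\<gamma> < 1" and "2 \<le> k"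
    and "\<And>n. finite (V n)" and "\<And>n. card (V n) = n"
  shows "(\<lambda>n. measure_pmf.prob (high_girth_process k (V n))
            {ss. real (tau_max ss) \<ge> (1 - \<gamma>) * (real n)\<^sup>2 / 6}) \<longlonglongrightarrow> 1"
proof (rule LIMSEQ_I)
  fix r :: real assume r: "0 < r"
  \<comment> \<open>The failure probability will be at most
    \<open>(3 / n + 2 * \<epsilon>) / \<gamma>\<close>. Here \<open>2 * \<epsilon>\<close> is
    \<open>\<gamma> * r / 4\<close>, and \<open>n1\<close> makes 3/n smaller than the same
    amount.\<close>
  define \<epsilon> where "\<epsilon> = \<gamma> * r / 8"
  have \<epsilon>: "0 < \<epsilon>" using assms(1) r by (simp add: \<epsilon>_def)
  define \<tau> where "\<tau> = 1 / (\<epsilon> ^ 3 * survive k 1)"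
  have \<tau>: "0 < \<tau>" using \<epsilon> survive_bounds[of 1 k] by (simp add: \<tau>_def)
  \<comment> \<open>Rounding up the number of steps overshoots \<open>\<tau>\<close> by at most two
    steps, each of length at most 1.\<close>
  have \<sigma>: "1 \<le> \<tau> + 2" using \<tau> by simp
  obtain n0 where n0: "\<And>(W :: 'a set) u. finite W \<Longrightarrow> 4 \<le> card W \<Longrightarrow> n0 \<le> card W \<Longrightarrow>
      real u * lazy_process.hstep W \<le> \<tau> + 2 \<Longrightarrow> lazy_process.close_to k W u 1 \<epsilon>"
    using close_to_uniform[OF assms(3) \<sigma> \<epsilon>, of 1, where 'a = 'a] by blast
  obtain n1 :: nat where n1: "12 / (\<gamma> * r) < real n1" using reals_Archimedean2 by blast
  show "\<exists>N. \<forall>n\<ge>N. norm (measure_pmf.prob (high_girth_process k (V n))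
      {ss. real (tau_max ss) \<ge> (1 - \<gamma>) * (real n)\<^sup>2 / 6} - 1) < r"
  proof (intro exI[of _ "max 4 (max n0 n1)"] allI impI)
    fix n assume n: "max 4 (max n0 n1) \<le> n"
    let ?P = "measure_pmf.prob (high_girth_process k (V n)) {ss. real (tau_max ss) \<ge> (1 - \<gamma>) * (real n)\<^sup>2 / 6}"
    interpret lazy_process k "V n" using assms(3-5) n by unfold_locales auto
    have cV: "card (V n) = n" by (rule assms(5))
    have four: "4 \<le> card (V n)" using n cV by simp
    note h = hstep_bounds[OF four]
    define u where "u = nat \<lceil>\<tau> / hstep\<rceil> + 1"
    have "real (nat \<lceil>\<tau> / hstep\<rceil>) = of_int \<lceil>\<tau> / hstep\<rceil>" using \<tau> h(1) by simp
    then have u: "\<tau> / hstep < real u" "real u \<le> \<tau> / hstep + 2" unfolding u_def by linarith+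
    have u1: "\<tau> < real u * hstep" using u(1) h(1) by (simp add: field_simps)
    have "real u * hstep \<le> (\<tau> / hstep + 2) * hstep" using u(2) h(1) by (intro mult_right_mono) auto
    also have "\<dots> = \<tau> + 2 * hstep" using h(1) by (simp add: field_simps)
    also have "\<dots> \<le> \<tau> + 2" using h(2) by simp
    finally have u2: "real u * hstep \<le> \<tau> + 2" .
    have close: "close_to u 1 \<epsilon>" using n0[OF assms(4) four _ u2] n cV by simp
    have p: "1 - \<epsilon> \<le> pseq k hstep u"
      using u1 h \<epsilon> unfolding \<tau>_def by (intro pseq_ge) auto
    have "1 - (3 / real n + \<epsilon> + \<epsilon>) / \<gamma> \<le> ?P"
      using ev_large_ge[OF close p _ _ assms(1)] prob_tau_max_ge[of u "(1 - \<gamma>) * (real n)\<^sup>2 / 6"] \<epsilon>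
      unfolding cV by linarith
    moreover have "(3 / real n + \<epsilon> + \<epsilon>) / \<gamma> < r"
    proof -
      have "real n1 \<le> real n" using n by simp
      then have "12 / (\<gamma> * r) < real n" using n1 by linarith
      then have "3 / real n < \<gamma> * r / 4" using assms(1) r n by (simp add: field_simps)
      then have "3 / real n + \<epsilon> + \<epsilon> < \<gamma> * r" using assms(1) r mult_pos_pos[OF assms(1) r] unfolding \<epsilon>_def by linarith
      then show ?thesis using assms(1) by (simp add: field_simps)
    qed
    moreover have "?P \<le> 1" by (rule measure_pmf.prob_le_1)
    ultimately show "norm (?P - 1) < r" using r unfolding real_norm_def by linarith
  qed
qed

end
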